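(* Let $R'=R[[\lambda]]$, let $M'=R'e_1'\oplus R'e_2$ be the free rank $2$ module with $q$-connection $\nabla_q$ and filtration $\mathrm{Fil}^\bullet M'$ described in the context, and let $\rho_{M'}$ be the continuous $\rho$-semilinear action of $\Gamma$ on $M'$ associated to $\nabla_q$. Then there exists a $\varphi$-semilinear endomorphism $\varphi_{M'}$ of $M'$ satisfying the following conditions. (i) There exists a basis $(f_1,f_2)$ of $M'$ such that $\varphi_{M'}(e_1')=[p]_q f_1$ and $\varphi_{M'}(e_2)=f_2$. (ii) The quartet $(M',\mathrm{Fil}^\bullet M',\varphi_{M'},\rho_{M'})$ is an object of $\mathrm{MF}^{[p]_q,q-1}_{[0,1]}(R[[\lambda]],\varphi,\Gamma)$, i.e. $\rho_{M'}(\gamma)(\mathrm{Fil}^1M')=\mathrm{Fil}^1M'$ and $\rho_{M'}(\gamma)\circ\varphi_{M'}=\varphi_{M'}\circ\rho_{M'}(\gamma)$. (iii) The isomorphism $M'\otimes_{R[[\lambda]]}\mathbb{Z}_p[[\lambda]]\cong H_0$ sending $e_1'\mapsto\omega$, $e_2\mapsto-\lambda(1-\lambda)D(\omega)$ is an isomorphism $$(M',\varphi_{M'},\nabla_q,\mathrm{Fil}^\bullet M')\otimes_{R[[\lambda]]}\mathbb{Z}_p[[\lambda]]\cong(H_0,\varphi_{H_0},\nabla,\mathrm{Fil}^\bullet H_0),$$ where the base change is reduction modulo $q-1$. Moreover, it can be lifted to an isomorphism between $(M',\mathrm{Fil}^\bullet M',\varphi_{M'},\rho_{M'})$ and the canonical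 $q$-deformation of $(H_0,\nabla,\varphi_{H_0},\mathrm{Fil}^\bullet H_0)$ in $\mathrm{MF}^{[p]_q,q-1}_{[0,1]}(R[[\lambda]],\varphi,\Gamma)$.
   Context: Rings. $p$ is an odd prime, $q$ a formal variable, $R=\mathbb{Z}_p[[q-1]]$. For $a\in\mathbb{Q}\cap\mathbb{Z}_p$, $q^a=\sum_{i\ge0}\binom ai(q-1)^i\in R$ and $[a]_q=\frac{q^a-1}{q-1}\in R$. $R'=R[[\lambda]]$ has the $(p,q-1)$-adic topology; $A=R'/(q-1)=\mathbb{Z}_p[[\lambda]]$. $\varphi$ is the ring endomorphism of $R[[\lambda]]$ (continuous) with $\varphi(a)=a$ ($a\in\mathbb{Z}_p$), $\varphi(q)=q^p$, $\varphi(\lambda)=\lambda^p$; it induces $\varphi$ on $A$. $\Gamma\cong\mathbb{Z}$, with generator $\gamma$ and discrete topology, acts on $R'$ (action $\rho$) by continuous $R$-algebra automorphisms with $\gamma(\lambda)=q\lambda$; $d_q=\frac{\gamma-1}{(q-1)\lambda}$. $\mathrm{Fil}^rR'=R'$ for $r<0$, $\mathrm{Fil}^rR'=(q-1)^rR'$ for $r\ge0$. $\mathrm{Fil}^rA=A$ for $r\le0$ and $0$ for $r>0$. $q$-connections. $q\Omega_{R'/R}=R'\,d\log\lambda$, $d\lambda=\lambda\,d\log\lambda$, $\delta_q(x)=d_q(x)d\lambda$. A $q$-connection on an $R'$-module $M$ is an $R$-linear map $\nabla_q:M\to M\otimes_{R'}q\Omega_{R'/R}$ with $\nabla_q(am)=m\otimes\delta_q(a)+\gamma(a)\nabla_q(m)$.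 Writing $\nabla_q=D_q^{\log}\otimes d\log\lambda$, the associated $\rho$-semilinear action $\rho_M$ of $\Gamma$ is the one in which $\gamma$ acts by $1+(q-1)D_q^{\log}$. Reduction mod $q-1$ of a $q$-connection is a connection with values in $A\,d\log\lambda$. The module $M'$. $M'=R'e_1'\oplus R'e_2$ with $$\nabla_q(e_1')=-\tfrac1{\lambda(1-\lambda)}e_2\otimes d\lambda,\qquad\nabla_q(e_2)=\Big(-[\tfrac12]_q^2e_1'+[\tfrac12]_q^2\tfrac{q-1}{1-\lambda}e_2\Big)\otimes d\lambda$$ (note $1-\lambda\in R[[\lambda]]^\times$), $\mathrm{Fil}^0M'=M'$, $\mathrm{Fil}^1M'=R'e_1'\oplus(q-1)R'e_2$. (With $e_1=\lambda(1-\lambda)e_1'$, $\nabla_q(f_1e_1+f_2e_2)=0$ iff $f_1=d_qf_2$ and $f_2$ satisfies the $q$-hypergeometric equation $q\lambda(1-q\lambda)d_q^2f+(1-(1+[2]_q-2[\frac12]_q)\lambda)d_qf-[\frac12]_q^2f=0$.) The classical object $H_0$. Let $h(\lambda)=\sum_{i=0}^{(p-1)/2}\binom{(p-1)/2}{i}^2\lambda^i$, $B'=\mathbb{Z}_p\langle\lambda,\frac1{h}\rangle$, $B''=\mathbb{Z}_p\langle\lambda,\frac1{(1-\lambda)h}\rangle$ ($p$-adic completions of $\mathbb{Z}_p[\lambda,\frac1h]$, $\mathbb{Z}_p[\lambda,\frac1{(1-\lambda)h}]$), with Frobenius lift $\varphi(\lambda)=\lambda^p$. Let $T=\mathrm{Spec}(B')$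 with log structure given by $\lambda(1-\lambda)=0$, $E'/T$ the log smooth Legendre family $Y^2Z=X(X-Z)(X-\lambda Z)$, $H_{B'}=H^1_{\mathrm{dR}}(E'/T)$ its relative log de Rham cohomology with logarithmic Gauss–Manin connection $\nabla$ and Hodge filtration $\mathrm{Fil}^1H_{B'}=B'\omega$, $\omega=dx/y$. Write $\nabla=D\otimes d\lambda$ after inverting $\lambda(1-\lambda)$; then $H_{B'}$ is free with basis $(\omega,\lambda(1-\lambda)D(\omega))$ and $D(-\lambda(1-\lambda)D(\omega))=-\frac14\omega$. Put $H_{B''}=H_{B'}\otimes_{B'}B''$; since $\varphi$ of $B''$ preserves the divisor $\lambda=0$, the comparison isomorphism with the log crystalline cohomology of the reduction mod $p$ of $E'$ over $B''$ gives a $\varphi$-semilinear Frobenius $\varphi_{H_{B''}}$ of $H_{B''}$. In terms of $f=\sum_{n\ge0}\big(\prod_{i=0}^{n-1}\frac{i+1/2}{i+1}\big)^2\lambda^n$, $\overline e_1'=\omega$ and $\overline e_2'=\lambda(1-\lambda)\big(\frac1f\frac{df}{d\lambda}\omega-D(\omega)\big)$, it is given by $\varphi_{H_{B''}}(\overline e_2')=\varepsilon\frac f{\varphi(f)}\overline e_2'$ and $\varphi_{H_{B''}}(\overline e_1')=p\varepsilon\frac{\varphi(f)}f\overline e_1'+pb\,\overline e_2'$ for some $b\in B''$, with $\varepsilon=(-1)^{(p-1)/2}$. Finally $H_0=H_{B''}\otimes_{B''}\mathbb{Z}_p[[\lambda]]$ with induced $\nabla$, $\varphi_{H_0}$, and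 filtration $\mathrm{Fil}^0H_0=H_0$, $\mathrm{Fil}^1H_0=\mathbb{Z}_p[[\lambda]]\,\omega$. The map $e_1'\mapsto\omega$, $e_2\mapsto-\lambda(1-\lambda)D(\omega)$ induces an isomorphism $M'\otimes_{R'}A\cong H_0$ compatible with connections and filtrations. Categories. $\mathrm{MIC}_{[0,1]}(A,\varphi,\mathrm{Fil}^\bullet)$: objects $(M,\mathrm{Fil}^\bullet M,\varphi_M,\nabla)$, where $M$ is a free $A$-module of finite type; $\mathrm{Fil}^rM$ ($r=0,1$) is a decreasing filtration such that there are a basis $(e_\nu)$ and $r_\nu\in\{0,1\}$ with $\mathrm{Fil}^rM=\bigoplus_\nu\mathrm{Fil}^{r-r_\nu}A\,e_\nu$; $\varphi_M$ is $\varphi$-semilinear with $\varphi_M(\mathrm{Fil}^rM)\subset p^rM$ and $M=\sum_{r=0,1}A\,p^{-r}\varphi_M(\mathrm{Fil}^rM)$; $\nabla:M\to M\otimes_AA\,d\log\lambda$ is a connection with $\nabla\circ\varphi_M=(\varphi_M\otimes\varphi^1)\circ\nabla$, where $\varphi^1$ is $\varphi$-semilinear with $\varphi^1(d\log\lambda)=p\,d\log\lambda$ (and $\nabla(\mathrm{Fil}^1M)\subset\mathrm{Fil}^0M\otimes A\,d\log\lambda$). Let $\mathcal R$ be $R'$ or $R'/(q-1)^2$ with the induced $\varphi$, $\Gamma$-action $\rho$ and (image) filtration. $\mathrm{MF}^{[p]_q,q-1}_{[0,1]}(\mathcal R,\varphi,\Gamma)$: objects $(M,\mathrm{Fil}^\bullet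 M,\varphi_M,\rho_M)$, where $M$ is a free $\mathcal R$-module of finite type; $\mathrm{Fil}^rM$ ($r=0,1$) is a decreasing filtration such that there are a basis $(e_\nu)$ and $r_\nu\in\{0,1\}$ with $\mathrm{Fil}^rM=\bigoplus_\nu\mathrm{Fil}^{r-r_\nu}\mathcal R\,e_\nu$; $\varphi_M$ is $\varphi$-semilinear with $\varphi_M(\mathrm{Fil}^rM)\subset[p]_q^rM$ and $M=\sum_{r=0,1}\mathcal R\,[p]_q^{-r}\varphi_M(\mathrm{Fil}^rM)$; $\rho_M:\Gamma\to\mathrm{Aut}(M)$ is a continuous $\rho$-semilinear action preserving $\mathrm{Fil}^rM$ and commuting with $\varphi_M$, with $(\rho_M(\gamma)-1)(M)\subset(q-1)M$. Morphisms in both categories are linear maps compatible with all structures. Canonical $q$-deformation. There is a functor $\mathrm{MIC}_{[0,1]}(A,\varphi,\mathrm{Fil}^\bullet)\to\mathrm{MF}^{[p]_q,q-1}_{[0,1]}(R'/(q-1)^2,\varphi,\Gamma)$ sending $M$ to $M\otimes_AR'/(q-1)^2$ (along the natural inclusion $A=\mathbb{Z}_p[[\lambda]]\to R'/(q-1)^2$) with tensor product filtration, Frobenius $\varphi_M\otimes\varphi$ and the $\rho$-semilinear action determined by $\gamma(m\otimes1)=m\otimes1+D^{\log}(m)\otimes(q-1)$, where $\nabla=D^{\log}\otimes d\log\lambda$. By a theorem of Tsuji, reduction mod $(q-1)^2$ is an equivalence $\mathrm{MF}^{[p]_q,q-1}_{[0,1]}(R',\varphi,\Gamma)\to\mathrm{MF}^{[p]_q,q-1}_{[0,1]}(R'/(q-1)^2,\varphi,\Gamma)$.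 The canonical $q$-deformation of an object of $\mathrm{MIC}_{[0,1]}(A,\varphi,\mathrm{Fil}^\bullet)$ is its image under the first functor followed by a quasi-inverse of this equivalence; its reduction mod $q-1$ is identified with the original object. "Lifted" means that the isomorphism in $\mathrm{MF}$ reduces modulo $q-1$ to the given one. *)

theory Defs
  imports
    "HOL-Analysis.Cartesian_Space"
    "HOL-Computational_Algebra.Formal_Power_Series"
    "HOL-Computational_Algebra.Polynomial_FPS"
    "HOL-Computational_Algebra.Primes"
begin

section \<open>The p-adic integers\<close>

text \<open>
  The prime is the cardinality of the type parameter, and the ring is the inverse limit of
  the rings of integers modulo \<open>p ^ n\<close>.
\<close>

class prime_card = finite +
  assumes prime_card: "prime CARD('a)"

typedef (overloaded) ('p :: prime_card) padic_int =
  "{x :: nat \<Rightarrow> int. \<forall>n. x n \<in> {0..<int CARD('p) ^ n} \<and> x (Suc n) mod int CARD('p) ^ n = x n}"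
proof -
  have "CARD('p) > 0" using prime_card[where 'a = 'p] by (simp add: prime_gt_0_nat)
  then show ?thesis by (intro exI[of _ "\<lambda>_. 0"]) auto
qed

setup_lifting type_definition_padic_int

lemma CARD_prime_pos: "int CARD('p :: prime_card) > 0"
  using prime_card[where 'a = 'p] by (simp add: prime_gt_0_nat)

lemma padic_reduct:
  fixes a :: "nat \<Rightarrow> int"
  assumes "\<And>n. a (Suc n) mod int CARD('p :: prime_card) ^ n = a n mod int CARD('p) ^ n"
  shows "a n mod int CARD('p) ^ n \<in> {0..<int CARD('p) ^ n} \<and>
    (a (Suc n) mod int CARD('p) ^ Suc n) mod int CARD('p) ^ n = a n mod int CARD('p) ^ n"
  using assms CARD_prime_pos[where 'p = 'p] by (simp add: mod_mod_cancel)

instantiation padic_int :: (prime_card) comm_ring_1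
begin

lift_definition zero_padic_int :: "'a padic_int" is "\<lambda>_. 0"
  using CARD_prime_pos[where 'p = 'a] by auto

lift_definition one_padic_int :: "'a padic_int" is "\<lambda>n. 1 mod int CARD('a) ^ n"
  by (rule padic_reduct) simp

lift_definition plus_padic_int :: "'a padic_int \<Rightarrow> 'a padic_int \<Rightarrow> 'a padic_int"
  is "\<lambda>x y n. (x n + y n) mod int CARD('a) ^ n"
  by (rule padic_reduct) (metis mod_add_eq)

lift_definition uminus_padic_int :: "'a padic_int \<Rightarrow> 'a padic_int"
  is "\<lambda>x n. (- x n) mod int CARD('a) ^ n"
  by (rule padic_reduct) (metis mod_minus_eq)

lift_definition minus_padic_int :: "'a padic_int \<Rightarrow> 'a padic_int \<Rightarrow> 'a padic_int"
  is "\<lambda>x y n. (x n - y n) mod int CARD('a) ^ n"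
  by (rule padic_reduct) (metis mod_diff_eq)

lift_definition times_padic_int :: "'a padic_int \<Rightarrow> 'a padic_int \<Rightarrow> 'a padic_int"
  is "\<lambda>x y n. (x n * y n) mod int CARD('a) ^ n"
  by (rule padic_reduct) (metis mod_mult_eq)

instance
proof
  fix a b c :: "'a padic_int"
  show "a * b * c = a * (b * c)"
    by transfer (simp add: mod_mult_left_eq mod_mult_right_eq mult.assoc)
  show "a * b = b * a" by transfer (simp add: mult.commute)
  show "1 * a = a" by transfer (auto simp: mod_mult_left_eq)
  show "a + b + c = a + (b + c)"
    by transfer (simp add: mod_add_left_eq mod_add_right_eq add.assoc)
  show "a + b = b + a" by transfer (simp add: add.commute)
  show "0 + a = a" by transfer auto
  show "- a + a = 0" by transfer (simp add: mod_add_left_eq)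
  show "a - b = a + - b" by transfer (simp add: mod_add_right_eq)
  show "(a + b) * c = a * c + b * c"
    by transfer (simp add: mod_mult_left_eq mod_add_eq distrib_right)
  show "(0 :: 'a padic_int) \<noteq> 1"
  proof transfer
    have "CARD('a) > 1" using prime_card[where 'a = 'a] by (rule prime_gt_1_nat)
    then have "(1 :: int) mod int CARD('a) ^ 1 = 1" by simp
    then show "(\<lambda>_. 0) \<noteq> (\<lambda>n. (1 :: int) mod int CARD('a) ^ n)"
      by (metis zero_neq_one)
  qed
qed

end

section \<open>The rings\<close>

text \<open>
  With \<open>'p padic_int\<close> as coefficients, \<open>'p padic_int fps\<close> is used both for the ring \<open>R\<close> of
  power series in \<open>q - 1\<close> and for the ring \<open>A\<close> of power series in \<open>\<lambda>\<close>. The ring \<open>R'\<close> is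
  \<open>'p padic_int fps fps\<close>: the outer variable is \<open>\<lambda>\<close>, the inner one is \<open>q - 1\<close>.
\<close>

text \<open>Exact quotient; only meaningful if \<open>b\<close> is a non-zero-divisor that divides \<open>a\<close>.\<close>

definition exquo :: "'a :: comm_ring_1 \<Rightarrow> 'a \<Rightarrow> 'a"
  where "exquo a b = (THE x. b * x = a)"

definition zbinom :: "'p :: prime_card padic_int \<Rightarrow> nat \<Rightarrow> 'p padic_int"
  where "zbinom a i = exquo (\<Prod>j<i. a - of_nat j) (of_nat (fact i))"

definition qpow :: "'p :: prime_card padic_int \<Rightarrow> 'p padic_int fps"
  where "qpow a = Abs_fps (zbinom a)"

definition qint :: "'p :: prime_card padic_int \<Rightarrow> 'p padic_int fps"
  where "qint a = exquo (qpow a - 1) fps_X"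

definition half :: "'p :: prime_card padic_int"
  where "half = exquo 1 2"

definition fps_map :: "('a :: zero \<Rightarrow> 'b :: zero) \<Rightarrow> 'a fps \<Rightarrow> 'b fps"
  where "fps_map f g = Abs_fps (\<lambda>n. f (fps_nth g n))"

definition phi_R :: "'p :: prime_card padic_int fps \<Rightarrow> 'p padic_int fps"
  where "phi_R g = g oo ((1 + fps_X) ^ CARD('p) - 1)"

definition phi_A :: "'p :: prime_card padic_int fps \<Rightarrow> 'p padic_int fps"
  where "phi_A g = g oo fps_X ^ CARD('p)"

definition phi_R' :: "'p :: prime_card padic_int fps fps \<Rightarrow> 'p padic_int fps fps"
  where "phi_R' g = fps_map phi_R g oo fps_X ^ CARD('p)"

definition gamma_R' :: "'p :: prime_card padic_int fps fps \<Rightarrow> 'p padic_int fps fps"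
  where "gamma_R' g = g oo (fps_const (1 + fps_X) * fps_X)"

definition q1_R' :: "'p :: prime_card padic_int fps fps"
  where "q1_R' = fps_const fps_X"

definition d_q :: "'p :: prime_card padic_int fps fps \<Rightarrow> 'p padic_int fps fps"
  where "d_q g = exquo (gamma_R' g - g) (q1_R' * fps_X)"

quotient_type (overloaded) 'p R'_mod =
  "'p :: prime_card padic_int fps fps" / "\<lambda>a b. q1_R' ^ 2 dvd a - b"
proof (rule equivpI)
  show "reflp (\<lambda>a b. (q1_R' :: 'p padic_int fps fps) ^ 2 dvd a - b)"
    by (rule reflpI) simp
  show "symp (\<lambda>a b. (q1_R' :: 'p padic_int fps fps) ^ 2 dvd a - b)"
    by (rule sympI) (metis dvd_minus_iff minus_diff_eq)
  show "transp (\<lambda>a b. (q1_R' :: 'p padic_int fps fps) ^ 2 dvd a - b)"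
  proof (rule transpI)
    fix a b c :: "'p padic_int fps fps"
    assume "q1_R' ^ 2 dvd a - b" "q1_R' ^ 2 dvd b - c"
    from dvd_add[OF this] show "q1_R' ^ 2 dvd a - c" by simp
  qed
qed

instantiation R'_mod :: (prime_card) comm_ring_1
begin

lift_definition zero_R'_mod :: "'a R'_mod" is 0 .

lift_definition one_R'_mod :: "'a R'_mod" is 1 .

lift_definition plus_R'_mod :: "'a R'_mod \<Rightarrow> 'a R'_mod \<Rightarrow> 'a R'_mod" is "(+)"
proof -
  fix a b c d :: "'a padic_int fps fps"
  assume "q1_R' ^ 2 dvd a - b" "q1_R' ^ 2 dvd c - d"
  from dvd_add[OF this] show "q1_R' ^ 2 dvd a + c - (b + d)" by (simp add: algebra_simps)
qed

lift_definition minus_R'_mod :: "'a R'_mod \<Rightarrow> 'a R'_mod \<Rightarrow> 'a R'_mod" is "(-)"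
proof -
  fix a b c d :: "'a padic_int fps fps"
  assume "q1_R' ^ 2 dvd a - b" "q1_R' ^ 2 dvd c - d"
  from dvd_diff[OF this] show "q1_R' ^ 2 dvd a - c - (b - d)" by (simp add: algebra_simps)
qed

lift_definition uminus_R'_mod :: "'a R'_mod \<Rightarrow> 'a R'_mod" is uminus
  by (metis (no_types, lifting) add.commute diff_minus_eq_add dvd_minus_iff minus_diff_eq
      uminus_add_conv_diff)

lift_definition times_R'_mod :: "'a R'_mod \<Rightarrow> 'a R'_mod \<Rightarrow> 'a R'_mod" is "(*)"
proof -
  fix a b c d :: "'a padic_int fps fps"
  assume "q1_R' ^ 2 dvd a - b" "q1_R' ^ 2 dvd c - d"
  then have "q1_R' ^ 2 dvd (a - b) * c + b * (c - d)" by (intro dvd_add dvd_mult dvd_mult2)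
  then show "q1_R' ^ 2 dvd a * c - b * d" by (simp add: algebra_simps)
qed

instance
proof
  show "(0 :: 'a R'_mod) \<noteq> 1"
  proof transfer
    have "fps_nth (fps_nth (q1_R' ^ 2 * x) 0) 0 = 0" for x :: "'a padic_int fps fps"
      by (simp add: q1_R'_def power2_eq_square mult.assoc)
    moreover have "fps_nth (fps_nth (0 - 1 :: 'a padic_int fps fps) 0) 0 \<noteq> 0" by simp
    ultimately show "\<not> (q1_R' :: 'a padic_int fps fps) ^ 2 dvd 0 - 1"
      by (metis dvd_def)
  qed
qed (transfer; simp add: algebra_simps)+

end

text \<open>
  Coefficient rings with the data used below: the images of \<open>p\<close>, \<open>q - 1\<close> and \<open>[p]_q\<close>, the
  Frobenius, and the action of the generator \<open>\<gamma>\<close> of \<open>\<Gamma>\<close>. An action of \<open>\<Gamma>\<close>, which is infinite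
  cyclic, is given throughout by the automorphism through which \<open>\<gamma>\<close> acts.
\<close>

record 'r qring =
  prm :: 'r
  qm1 :: 'r
  pq :: 'r
  phi :: "'r \<Rightarrow> 'r"
  gam :: "'r \<Rightarrow> 'r"

definition ring_R' :: "'p :: prime_card padic_int fps fps qring"
  where "ring_R' = \<lparr>prm = of_nat CARD('p), qm1 = q1_R', pq = fps_const (qint (of_nat CARD('p))),
    phi = phi_R', gam = gamma_R'\<rparr>"

definition ring_R'_mod :: "'p :: prime_card R'_mod qring"
  where "ring_R'_mod = \<lparr>prm = abs_R'_mod (prm ring_R'), qm1 = abs_R'_mod (qm1 ring_R'),
    pq = abs_R'_mod (pq ring_R'), phi = (\<lambda>x. abs_R'_mod (phi_R' (rep_R'_mod x))),
    gam = (\<lambda>x. abs_R'_mod (gamma_R' (rep_R'_mod x)))\<rparr>"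

definition fil_q :: "('r :: comm_ring_1) qring \<Rightarrow> int \<Rightarrow> 'r set"
  where "fil_q Q r = range (\<lambda>x. qm1 Q ^ nat r * x)"

definition fil_A :: "int \<Rightarrow> 'p :: prime_card padic_int fps set"
  where "fil_A r = (if r \<le> 0 then UNIV else {0})"

text \<open>The inclusion of \<open>A\<close> into \<open>R'\<close> and the reduction of \<open>R'\<close> modulo \<open>q - 1\<close>.\<close>

definition incl_A :: "'p :: prime_card padic_int fps \<Rightarrow> 'p padic_int fps fps"
  where "incl_A = fps_map fps_const"

definition mod_q1 :: "'p :: prime_card padic_int fps fps \<Rightarrow> 'p padic_int fps"
  where "mod_q1 = fps_map (\<lambda>c. fps_nth c 0)"

section \<open>Filtered modules\<close>

text \<open>
  A free module of finite type is taken in the form \<open>'r ^ 'n\<close>. Filtrations are indexed by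
  natural numbers, and only the steps \<open>0\<close> and \<open>1\<close> carry information.
\<close>

lemma module_vec: "module ((*s) :: 'r :: comm_ring_1 \<Rightarrow> 'r ^ 'n \<Rightarrow> 'r ^ 'n)"
  by standard (vector algebra_simps)+

definition vec_map :: "('a \<Rightarrow> 'b) \<Rightarrow> 'a ^ 'n \<Rightarrow> 'b ^ 'n"
  where "vec_map f x = (\<chi> i. f (x $ i))"

definition is_basis :: "('n \<Rightarrow> ('r :: comm_ring_1) ^ 'n) \<Rightarrow> bool"
  where "is_basis e \<longleftrightarrow> (\<forall>m. \<exists>!c. m = (\<Sum>\<nu>\<in>UNIV. c \<nu> *s e \<nu>))"

definition adapted_filtration ::
    "(int \<Rightarrow> ('r :: comm_ring_1) set) \<Rightarrow> (nat \<Rightarrow> ('r ^ 'n) set) \<Rightarrow> bool"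
  where "adapted_filtration F G \<longleftrightarrow> G 1 \<subseteq> G 0 \<and>
    (\<exists>e (\<rho> :: 'n \<Rightarrow> nat). is_basis e \<and> (\<forall>\<nu>. \<rho> \<nu> \<in> {0, 1}) \<and>
      (\<forall>r\<in>{0, 1}. G r =
        {\<Sum>\<nu>\<in>UNIV. c \<nu> *s e \<nu> | c. \<forall>\<nu>. c \<nu> \<in> F (int r - int (\<rho> \<nu>))}))"

definition semilinear :: "(('r :: comm_ring_1) \<Rightarrow> 'r) \<Rightarrow> ('r ^ 'n \<Rightarrow> 'r ^ 'n) \<Rightarrow> bool"
  where "semilinear \<sigma> f \<longleftrightarrow> (\<forall>x y. f (x + y) = f x + f y) \<and> (\<forall>a x. f (a *s x) = \<sigma> a *s f x)"

definition strong_frobenius ::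
    "(('r :: comm_ring_1) \<Rightarrow> 'r) \<Rightarrow> 'r \<Rightarrow> (nat \<Rightarrow> ('r ^ 'n) set) \<Rightarrow> ('r ^ 'n \<Rightarrow> 'r ^ 'n) \<Rightarrow> bool"
  where "strong_frobenius \<sigma> P G f \<longleftrightarrow> semilinear \<sigma> f \<and>
    (\<forall>r\<in>{0, 1}. f ` G r \<subseteq> range (\<lambda>y. P ^ r *s y)) \<and>
    module.span (*s) (\<Union>r\<in>{0, 1}. {y. P ^ r *s y \<in> f ` G r}) = UNIV"

record ('r, 'n :: finite) filmod =
  fil :: "nat \<Rightarrow> ('r ^ 'n) set"
  frob :: "'r ^ 'n \<Rightarrow> 'r ^ 'n"

record ('r, 'n :: finite) mic_obj = "('r, 'n) filmod" +
  dlog :: "'r ^ 'n \<Rightarrow> 'r ^ 'n"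

record ('r, 'n :: finite) mf_obj = "('r, 'n) filmod" +
  act :: "'r ^ 'n \<Rightarrow> 'r ^ 'n"

text \<open>
  A connection is represented by the operator \<open>D\<close> with \<open>\<nabla> = D \<otimes> dlog \<lambda>\<close>; the factor \<open>p\<close> in the
  horizontality of Frobenius comes from \<open>dlog \<lambda> \<mapsto> p dlog \<lambda>\<close>.
\<close>

definition log_connection ::
    "('p :: prime_card padic_int fps ^ 'n \<Rightarrow> 'p padic_int fps ^ 'n) \<Rightarrow> bool"
  where "log_connection D \<longleftrightarrow> (\<forall>x y. D (x + y) = D x + D y) \<and>
    (\<forall>a x. D (a *s x) = (fps_X * fps_deriv a) *s x + a *s D x)"

definition MIC :: "('p :: prime_card padic_int fps, 'n :: finite) mic_obj \<Rightarrow> bool"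
  where "MIC M \<longleftrightarrow> adapted_filtration fil_A (fil M) \<and>
    strong_frobenius phi_A (of_nat CARD('p)) (fil M) (frob M) \<and>
    log_connection (dlog M) \<and> dlog M ` fil M 1 \<subseteq> fil M 0 \<and>
    (\<forall>x. dlog M (frob M x) = of_nat CARD('p) *s frob M (dlog M x))"

definition adic_nbhd :: "('r :: comm_ring_1) qring \<Rightarrow> nat \<Rightarrow> ('r ^ 'n) set"
  where "adic_nbhd Q k =
    module.span (*s) {(prm Q ^ i * qm1 Q ^ j) *s m | i j m. i + j = k}"

text \<open>Continuity for the \<open>(p, q - 1)\<close>-adic topology; for additive maps it suffices to test at \<open>0\<close>.\<close>

definition adic_continuous :: "('r :: comm_ring_1) qring \<Rightarrow> ('r ^ 'n \<Rightarrow> 'r ^ 'n) \<Rightarrow> bool"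
  where "adic_continuous Q f \<longleftrightarrow> (\<forall>k. \<exists>l. f ` adic_nbhd Q l \<subseteq> adic_nbhd Q k)"

definition MF :: "('r :: comm_ring_1) qring \<Rightarrow> ('r, 'n :: finite) mf_obj \<Rightarrow> bool"
  where "MF Q M \<longleftrightarrow> adapted_filtration (fil_q Q) (fil M) \<and>
    strong_frobenius (phi Q) (pq Q) (fil M) (frob M) \<and>
    semilinear (gam Q) (act M) \<and> bij (act M) \<and>
    adic_continuous Q (act M) \<and> adic_continuous Q (inv (act M)) \<and>
    (\<forall>r\<in>{0, 1}. act M ` fil M r = fil M r) \<and>
    act M \<circ> frob M = frob M \<circ> act M \<and>
    (\<forall>x. act M x - x \<in> range (\<lambda>y. qm1 Q *s y))"

definition filmod_hom ::
    "('r :: comm_ring_1, 'n :: finite, 'a) filmod_scheme \<Rightarrow> ('r, 'm :: finite, 'b) filmod_scheme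
      \<Rightarrow> ('r ^ 'n \<Rightarrow> 'r ^ 'm) \<Rightarrow> bool"
  where "filmod_hom M N f \<longleftrightarrow> module_hom (*s) (*s) f \<and>
    (\<forall>r\<in>{0, 1}. f ` fil M r \<subseteq> fil N r) \<and> f \<circ> frob M = frob N \<circ> f"

definition mic_iso ::
    "('r :: comm_ring_1, 'n :: finite) mic_obj \<Rightarrow> ('r, 'm :: finite) mic_obj \<Rightarrow> ('r ^ 'n \<Rightarrow> 'r ^ 'm) \<Rightarrow> bool"
  where "mic_iso M N f \<longleftrightarrow> bij f \<and> filmod_hom M N f \<and> filmod_hom N M (inv f) \<and>
    f \<circ> dlog M = dlog N \<circ> f"

definition mf_iso ::
    "('r :: comm_ring_1, 'n :: finite) mf_obj \<Rightarrow> ('r, 'm :: finite) mf_obj \<Rightarrow> ('r ^ 'n \<Rightarrow> 'r ^ 'm) \<Rightarrow> bool"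
  where "mf_iso M N f \<longleftrightarrow> bij f \<and> filmod_hom M N f \<and> filmod_hom N M (inv f) \<and>
    f \<circ> act M = act N \<circ> f"

section \<open>The canonical q-deformation\<close>

definition reduce_mf ::
    "('p :: prime_card padic_int fps fps, 'n :: finite) mf_obj \<Rightarrow> ('p R'_mod, 'n) mf_obj"
  where "reduce_mf M = \<lparr>fil = (\<lambda>r. vec_map abs_R'_mod ` fil M r),
    frob = (\<lambda>y. vec_map abs_R'_mod (frob M (vec_map rep_R'_mod y))),
    act = (\<lambda>y. vec_map abs_R'_mod (act M (vec_map rep_R'_mod y)))\<rparr>"

text \<open>
  The base change of \<open>A ^ n\<close> along the inclusion of \<open>A\<close> is \<open>'p R'_mod ^ n\<close>, and \<open>tensor_one\<close> is
  the map \<open>m \<mapsto> m \<otimes> 1\<close>.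
\<close>

definition tensor_one :: "'p :: prime_card padic_int fps ^ 'n \<Rightarrow> 'p R'_mod ^ 'n"
  where "tensor_one = vec_map (\<lambda>a. abs_R'_mod (incl_A a))"

definition deform_mod ::
    "('p :: prime_card padic_int fps, 'n :: finite) mic_obj \<Rightarrow> ('p R'_mod, 'n) mf_obj"
  where "deform_mod H = \<lparr>
    fil = (\<lambda>r. module.span (*s)
      {a *s tensor_one m | a m. \<exists>i j. j \<in> {0, 1} \<and> i + int j = int r \<and>
        a \<in> fil_q ring_R'_mod i \<and> m \<in> fil H j}),
    frob = (\<lambda>y. \<Sum>\<nu>\<in>UNIV. phi ring_R'_mod (y $ \<nu>) *s tensor_one (frob H (axis \<nu> 1))),
    act = (\<lambda>y. \<Sum>\<nu>\<in>UNIV. gam ring_R'_mod (y $ \<nu>) *s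
      (tensor_one (axis \<nu> 1) + qm1 ring_R'_mod *s tensor_one (dlog H (axis \<nu> 1))))\<rparr>"

text \<open>
  The value of a quasi-inverse of reduction modulo \<open>(q - 1)^2\<close> at \<open>deform_mod H\<close> is an object
  \<open>X\<close> together with an isomorphism \<open>\<theta>\<close> from its reduction to \<open>deform_mod H\<close>.
\<close>

definition canonical_q_deformation ::
    "('p :: prime_card padic_int fps, 'n :: finite) mic_obj \<Rightarrow> ('p padic_int fps fps, 'n) mf_obj
      \<Rightarrow> ('p R'_mod ^ 'n \<Rightarrow> 'p R'_mod ^ 'n) \<Rightarrow> bool"
  where "canonical_q_deformation H X \<theta> \<longleftrightarrow>
    MIC H \<and> MF ring_R' X \<and> mf_iso (reduce_mf X) (deform_mod H) \<theta>"

text \<open>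
  The resulting identification of \<open>X\<close> modulo \<open>q - 1\<close> with \<open>H\<close>, as a map on \<open>X\<close>.
\<close>

definition canonical_reduction ::
    "('p :: prime_card R'_mod ^ 'n \<Rightarrow> 'p R'_mod ^ 'n)
      \<Rightarrow> 'p padic_int fps fps ^ 'n \<Rightarrow> 'p padic_int fps ^ 'n"
  where "canonical_reduction \<theta> x =
    vec_map (\<lambda>c. mod_q1 (rep_R'_mod c)) (\<theta> (vec_map abs_R'_mod x))"

section \<open>The module with q-connection\<close>

text \<open>
  As for \<open>log_connection\<close>, a q-connection is given by its component along \<open>dlog \<lambda>\<close>; hence
  \<open>\<delta>_q(a) = d_q(a) d\<lambda>\<close> contributes \<open>\<lambda> d_q(a)\<close>.
\<close>

definition q_connection ::
    "('p :: prime_card padic_int fps fps ^ 'n \<Rightarrow> 'p padic_int fps fps ^ 'n) \<Rightarrow> bool"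
  where "q_connection D \<longleftrightarrow> (\<forall>x y. D (x + y) = D x + D y) \<and>
    (\<forall>c x. D (fps_const c *s x) = fps_const c *s D x) \<and>
    (\<forall>a x. D (a *s x) = (fps_X * d_q a) *s x + gamma_R' a *s D x)"

definition e1' :: "'p :: prime_card padic_int fps fps ^ 2"
  where "e1' = axis 1 1"

definition e2 :: "'p :: prime_card padic_int fps fps ^ 2"
  where "e2 = axis 2 1"

text \<open>The factor \<open>\<lambda>\<close> in both values is \<open>d\<lambda> = \<lambda> dlog \<lambda>\<close>.\<close>

definition nabla_e1' :: "'p :: prime_card padic_int fps fps ^ 2"
  where "nabla_e1' = - (exquo 1 (1 - fps_X) *s e2)"

definition nabla_e2 :: "'p :: prime_card padic_int fps fps ^ 2"
  where "nabla_e2 = fps_X *s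
    (- (fps_const (qint half) ^ 2) *s e1'
      + (fps_const (qint half) ^ 2 * q1_R' * exquo 1 (1 - fps_X)) *s e2)"

definition nabla_M' ::
    "'p :: prime_card padic_int fps fps ^ 2 \<Rightarrow> 'p padic_int fps fps ^ 2"
  where "nabla_M' m =
    ((fps_X * d_q (m $ 1)) *s e1' + gamma_R' (m $ 1) *s nabla_e1')
    + ((fps_X * d_q (m $ 2)) *s e2 + gamma_R' (m $ 2) *s nabla_e2)"

lemma gamma_R'_nth: "fps_nth (gamma_R' g) n = (1 + fps_X) ^ n * fps_nth g n"
proof -
  have "fps_nth ((fps_const (1 + fps_X :: 'a padic_int fps) * fps_X) ^ i) n =
      (if i = n then (1 + fps_X) ^ n else 0)"
    for i :: nat and n
    by (simp only: power_mult_distrib fps_const_power fps_mult_left_const_nth fps_X_power_nth)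
      (auto simp del: fps_const_power)
  then show ?thesis
    by (simp only: gamma_R'_def fps_compose_nth) (simp add: if_distrib mult.commute cong: if_cong)
qed

lemma gamma_R'_add: "gamma_R' (a + b) = gamma_R' a + gamma_R' b"
  by (simp add: fps_eq_iff gamma_R'_nth distrib_left)

lemma gamma_R'_mult: "gamma_R' (a * b) = gamma_R' a * gamma_R' b"
proof (rule fps_ext)
  fix n
  have "(1 + fps_X) ^ n * (fps_nth a i * fps_nth b (n - i)) =
      ((1 + fps_X) ^ i * fps_nth a i) * ((1 + fps_X) ^ (n - i) * fps_nth b (n - i))"
    if "i \<le> n" for i
  proof -
    have "c ^ n = c ^ i * c ^ (n - i)" for c :: "'a padic_int fps"
      using that by (simp flip: power_add)
    from this[of "1 + fps_X"] show ?thesis by (simp only: mult_ac)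
  qed
  then show "fps_nth (gamma_R' (a * b)) n = fps_nth (gamma_R' a * gamma_R' b) n"
    by (simp add: gamma_R'_nth fps_mult_nth sum_distrib_left)
qed

lemma q1_lambda_cancel:
  assumes "q1_R' * fps_X * x = q1_R' * fps_X * (y :: 'p :: prime_card padic_int fps fps)"
  shows "x = y"
proof (rule fps_ext, rule fps_ext)
  fix n k
  have "fps_nth (fps_nth (q1_R' * fps_X * z) (Suc n)) (Suc k) = fps_nth (fps_nth z n) k"
    for z :: "'p padic_int fps fps"
    by (simp add: q1_R'_def mult.assoc)
  with assms show "fps_nth (fps_nth x n) k = fps_nth (fps_nth y n) k" by metis
qed

lemma d_q_eq: "q1_R' * fps_X * d_q g = gamma_R' g - g"
proof -
  define d where "d = Abs_fps (\<lambda>n. (\<Sum>i<Suc n. (1 + fps_X) ^ i) * fps_nth g (Suc n))"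
  have "fps_X * (\<Sum>i<Suc n. (1 + fps_X) ^ i) = (1 + fps_X) ^ Suc n - (1 :: 'a padic_int fps)" for n
    using power_diff_1_eq[of "1 + fps_X :: 'a padic_int fps" "Suc n"] by simp
  then have "fps_X * ((\<Sum>i<Suc n. (1 + fps_X) ^ i) * fps_nth g (Suc n))
      = (1 + fps_X) ^ Suc n * fps_nth g (Suc n) - fps_nth g (Suc n)" for n
    by (metis (no_types, lifting) mult.assoc left_diff_distrib mult_1)
  then have d: "q1_R' * fps_X * d = gamma_R' g - g"
  proof -
    assume *: "\<And>n. fps_X * ((\<Sum>i<Suc n. (1 + fps_X) ^ i) * fps_nth g (Suc n))
      = (1 + fps_X) ^ Suc n * fps_nth g (Suc n) - fps_nth g (Suc n)"
    have "fps_nth (q1_R' * fps_X * d) n = fps_nth (gamma_R' g - g) n" for n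
      by (cases n) (simp_all add: q1_R'_def mult.assoc d_def gamma_R'_nth * del: sum.lessThan_Suc power_Suc)
    then show ?thesis by (rule fps_ext)
  qed
  have "d_q g = d" unfolding d_q_def exquo_def
    by (rule the_equality) (use d in \<open>auto intro: q1_lambda_cancel\<close>)
  with d show ?thesis by simp
qed

lemma d_q_add: "d_q (a + b) = d_q a + d_q b"
  by (rule q1_lambda_cancel) (simp add: d_q_eq distrib_left gamma_R'_add)

lemma d_q_mult: "d_q (a * b) = d_q a * b + gamma_R' a * d_q b"
proof (rule q1_lambda_cancel)
  have "q1_R' * fps_X * (d_q a * b + gamma_R' a * d_q b)
      = (q1_R' * fps_X * d_q a) * b + gamma_R' a * (q1_R' * fps_X * d_q b)"
    by (simp add: algebra_simps)
  also have "\<dots> = q1_R' * fps_X * d_q (a * b)"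
    by (simp only: d_q_eq gamma_R'_mult) (simp only: algebra_simps)
  finally show "q1_R' * fps_X * d_q (a * b) = q1_R' * fps_X * (d_q a * b + gamma_R' a * d_q b)" ..
qed

lemma gamma_R'_const: "gamma_R' (fps_const c) = fps_const c"
  by (simp add: gamma_R'_def)

lemma d_q_const: "d_q (fps_const c) = 0"
  by (rule q1_lambda_cancel) (simp add: d_q_eq gamma_R'_const)

lemma q_connection_nabla_M':
  "q_connection (nabla_M' :: 'a :: prime_card padic_int fps fps ^ 2 \<Rightarrow> _)"
proof -
  have mult: "nabla_M' (a *s x) = (fps_X * d_q a) *s x + gamma_R' a *s nabla_M' x"
    for a and x :: "'a padic_int fps fps ^ 2"
  proof -
    have *: "m = m $ 1 *s e1' + m $ 2 *s e2" for m :: "'a padic_int fps fps ^ 2"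
      by (simp add: vec_eq_iff forall_2 e1'_def e2_def axis_def)
    have "(fps_X * d_q a) *s x = (fps_X * d_q a * x $ 1) *s e1' + (fps_X * d_q a * x $ 2) *s e2"
      by (subst *[of "(fps_X * d_q a) *s x"]) simp
    then show ?thesis
      by (simp add: nabla_M'_def d_q_mult gamma_R'_mult e1'_def e2_def vec_eq_iff forall_2
          axis_def algebra_simps)
  qed
  have "nabla_M' (x + y) = nabla_M' x + nabla_M' y"
    for x y :: "'a padic_int fps fps ^ 2"
    by (simp add: nabla_M'_def d_q_add gamma_R'_add vec_eq_iff algebra_simps)
  moreover have "nabla_M' (fps_const c *s x) = fps_const c *s nabla_M' x"
    for c and x :: "'a padic_int fps fps ^ 2"
    by (simp add: mult d_q_const gamma_R'_const)
  ultimately show ?thesis using mult by (simp add: q_connection_def)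
qed

lemma nabla_M'_basis:
  "nabla_M' e1' = (nabla_e1' :: 'a :: prime_card padic_int fps fps ^ 2)"
  "nabla_M' e2 = (nabla_e2 :: 'a padic_int fps fps ^ 2)"
proof -
  have "d_q (0 :: 'a padic_int fps fps) = 0" "d_q (1 :: 'a padic_int fps fps) = 0"
    "gamma_R' (0 :: 'a padic_int fps fps) = 0" "gamma_R' (1 :: 'a padic_int fps fps) = 1"
    using d_q_const[of 0] d_q_const[of 1] gamma_R'_const[of 0] gamma_R'_const[of 1] by simp_all
  then show "nabla_M' e1' = (nabla_e1' :: 'a padic_int fps fps ^ 2)"
    "nabla_M' e2 = (nabla_e2 :: 'a padic_int fps fps ^ 2)"
    by (simp_all add: nabla_M'_def e1'_def e2_def axis_def)
qed

definition obj_M' :: "('p :: prime_card padic_int fps fps ^ 2 \<Rightarrow> 'p padic_int fps fps ^ 2)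
      \<Rightarrow> ('p padic_int fps fps, 2) mf_obj"
  where "obj_M' \<phi>M = \<lparr>fil = (\<lambda>r. if r = 0 then UNIV else {a *s e1' + (q1_R' * b) *s e2 | a b. True}),
    frob = \<phi>M,
    act = (\<lambda>m. m + q1_R' *s nabla_M' m)\<rparr>"

definition obj_M'_mod_q1 :: "('p :: prime_card padic_int fps fps ^ 2 \<Rightarrow> 'p padic_int fps fps ^ 2)
      \<Rightarrow> ('p padic_int fps, 2) mic_obj"
  where "obj_M'_mod_q1 \<phi>M = \<lparr>fil = (\<lambda>r. vec_map mod_q1 ` fil (obj_M' \<phi>M) r),
    frob = (\<lambda>y. vec_map mod_q1 (\<phi>M (vec_map incl_A y))),
    dlog = (\<lambda>y. vec_map mod_q1 (nabla_M' (vec_map incl_A y)))\<rparr>"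

section \<open>The Legendre family at the origin\<close>

text \<open>
  \<open>H_0\<close> is given in coordinates for the basis \<open>omega\<close>, \<open>eta = \<lambda>(1 - \<lambda>) D(\<omega>)\<close> of the relative log de Rham cohomology of
  \<open>Y\<^sup>2 Z = X (X - Z) (X - \<lambda> Z)\<close>, where \<open>\<nabla> = D \<otimes> d\<lambda>\<close>. The relation
  \<open>D (\<lambda>(1 - \<lambda>) D(\<omega>)) = \<omega> / 4\<close> then determines the Gauss-Manin connection.
\<close>

definition omega :: "'p :: prime_card padic_int fps ^ 2"
  where "omega = axis 1 1"

definition eta :: "'p :: prime_card padic_int fps ^ 2"
  where "eta = axis 2 1"

definition nabla_H0 :: "'p :: prime_card padic_int fps ^ 2 \<Rightarrow> 'p padic_int fps ^ 2"
  where "nabla_H0 x =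
    ((fps_X * fps_deriv (x $ 1)) *s omega + (x $ 1 * exquo 1 (1 - fps_X)) *s eta)
    + ((fps_X * fps_deriv (x $ 2)) *s eta
        + (x $ 2 * fps_X * fps_const (exquo 1 4)) *s omega)"

definition obj_H0 :: "('p :: prime_card padic_int fps ^ 2 \<Rightarrow> 'p padic_int fps ^ 2)
      \<Rightarrow> ('p padic_int fps, 2) mic_obj"
  where "obj_H0 \<Phi> = \<lparr>fil = (\<lambda>r. if r = 0 then UNIV else range (\<lambda>a. a *s omega)),
    frob = \<Phi>, dlog = nabla_H0\<rparr>"

definition hyper :: "'p :: prime_card padic_int fps"
  where "hyper = Abs_fps (\<lambda>n. exquo (\<Prod>i<n. of_nat i + half) (\<Prod>i<n. of_nat i + 1) ^ 2)"

definition hasse :: "'p :: prime_card padic_int poly"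
  where "hasse = (\<Sum>i\<le>(CARD('p) - 1) div 2.
    monom (of_nat (((CARD('p) - 1) div 2 choose i) ^ 2)) i)"

text \<open>
  Since \<open>h(0) = 1\<close>, the ring \<open>B''\<close>, the p-adic completion of \<open>Z_p[\<lambda>, 1 / ((1 - \<lambda>) h)]\<close>,
  embeds into \<open>A\<close> as the p-adic closure of \<open>Z_p[\<lambda>, 1 / ((1 - \<lambda>) h)]\<close>.
\<close>

definition B'' :: "'p :: prime_card padic_int fps set"
  where "B'' = {g. \<forall>n. \<exists>P k. of_nat (CARD('p) ^ n) dvd
    g - exquo (fps_of_poly P) (((1 - fps_X) * fps_of_poly hasse) ^ k)}"

definition e2_bar :: "'p :: prime_card padic_int fps ^ 2"
  where "e2_bar = (fps_X * (1 - fps_X) * exquo (fps_deriv hyper) hyper) *s omega - eta"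

text \<open>
  The crystalline Frobenius of \<open>H_0\<close>, pinned down by its properties: it is semilinear and
  horizontal, it comes from the lattice \<open>H_B''\<close> of vectors with coordinates in \<open>B''\<close>, and
  it is given by the formulas below in the basis \<open>omega\<close>, \<open>e2_bar\<close>. Horizontality alone would
  leave an additive constant in \<open>b / (f \<phi>(f))\<close> undetermined; \<open>b \<in> B''\<close> fixes it, because no
  non-zero constant multiple of \<open>f \<phi>(f)\<close> lies in \<open>B''\<close>.
\<close>

definition crystalline_frobenius ::
    "('p :: prime_card padic_int fps ^ 2 \<Rightarrow> 'p padic_int fps ^ 2) \<Rightarrow> bool"
  where "crystalline_frobenius \<Phi> \<longleftrightarrow>
    semilinear phi_A \<Phi> \<and>
    (\<forall>x. (\<forall>i. x $ i \<in> B'') \<longrightarrow> (\<forall>i. \<Phi> x $ i \<in> B'')) \<and>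
    (\<forall>x. nabla_H0 (\<Phi> x) = of_nat CARD('p) *s \<Phi> (nabla_H0 x)) \<and>
    (let \<epsilon> = (- 1) ^ ((CARD('p) - 1) div 2) in
      \<Phi> e2_bar = (\<epsilon> * exquo hyper (phi_A hyper)) *s e2_bar \<and>
      (\<exists>b\<in>B''. \<Phi> omega =
        (of_nat CARD('p) * \<epsilon> * exquo (phi_A hyper) hyper) *s omega
        + (of_nat CARD('p) * b) *s e2_bar))"

text \<open>The map \<open>e1' \<mapsto> \<omega>\<close>, \<open>e2 \<mapsto> - \<lambda>(1 - \<lambda>) D(\<omega>)\<close> on the reduction modulo \<open>q - 1\<close>.\<close>

definition compare_H0 :: "'p :: prime_card padic_int fps ^ 2 \<Rightarrow> 'p padic_int fps ^ 2"
  where "compare_H0 y = y $ 1 *s omega + y $ 2 *s (- eta)"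

end

theory Submission
  imports Defs
begin

text \<open>
  Let \<open>f\<close> be the \<open>q\<close>-hypergeometric series \<open>\<Sum> c_n^2 \<lambda>^n\<close> with \<open>c_n = \<Prod>i<n. [i + 1/2]_q / [i + 1]_q\<close>.
  It gives a vector \<open>v\<close> of \<open>M'\<close> fixed by \<open>\<gamma>\<close>, and \<open>w = e1' / f\<close> satisfies \<open>\<gamma>(w) = w - (q - 1) g v\<close> with
  \<open>g = 1 / ((1 - \<lambda>) f \<gamma>(f))\<close>, because the matrix of \<open>\<gamma>\<close> has determinant \<open>1\<close>. A Frobenius
  \<open>v \<mapsto> \<epsilon> v\<close>, \<open>w \<mapsto> [p]_q (\<epsilon> w + b v)\<close> commutes with \<open>\<gamma>\<close> iff \<open>\<gamma>(b) - b = (q - 1) \<epsilon> (g - \<phi>(g))\<close>, so it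
  exists iff \<open>[n]_q\<close> divides the \<open>n\<close>-th coefficient of \<open>\<phi>(g) - g\<close> for all \<open>n > 0\<close>.

  Since \<open>[n]_q\<close> is up to units a product of distinct cyclotomic factors, this can be checked at the roots
  of unity of order \<open>N = p^j\<close>. There a \<open>q\<close>-Lucas theorem splits \<open>f\<close> into a series in \<open>\<lambda>^N\<close> and a
  polynomial of degree \<open>(N - 1) / 2\<close>, and the sum of \<open>g\<close> over the \<open>N\<close> translates of \<open>\<lambda>\<close> is determined by a
  comparison of degrees.

  The classical Frobenius is the reduction of this one by horizontality. Comparison with the canonical
  deformation uses that \<open>(q - 1)^2 \<mapsto> (q - 1)^2 [p]_q^2\<close> under \<open>\<phi>\<close>: equations of the form
  \<open>x = y + [p]_q \<phi>(x)\<close> have unique solutions, so isomorphisms lift uniquely from \<open>R' / (q - 1)^2\<close>.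
\<close>

text \<open>Since \<open>g\<close> is defined by a division by \<open>f \<gamma>(f)\<close>, its
  coefficients do not show the required divisibility. Reduction of order makes them accessible:
  \<open>f(q^k \<lambda>) * (\<Sum>i<k. g(q^i \<lambda>))\<close> solves the same recursion in
  \<open>k\<close> as \<open>f(q^k \<lambda>)\<close> and vanishes at \<open>k = 0\<close>, so
  multiplying by \<open>f\<close> and clearing the leading coefficients gives a polynomial in
  \<lambda>. At a root of unity of order \<open>N\<close>, the sum for \<open>k = N\<close> retains
  only the coefficients of index divisible by \<open>N\<close>, and these turn out to be the
  coefficients of \<open>g\<close> at \<open>q = 1\<close>. The coefficients of \<open>g\<close> and
  of \<open>\<phi>(g)\<close> are thus both compared with one constant.

  The equation for \<open>b\<close> leaves \<open>b(0)\<close> free. Its value at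
  \<open>q = 1\<close> is imposed by the classical Frobenius, its first-order term by the canonical
  deformation: with \<open>u = 1 + (q - 1) / 2\<close> one has
  \<open>[p]_q = p \<phi>(u) / u\<close> modulo \<open>(q - 1)^2\<close>, so \<open>w\<close> is
  matched with \<open>u\<close> times its classical counterpart plus \<open>(q - 1) c v\<close>. The
  condition on \<open>c\<close> has the form \<open>\<phi>(c) - c = y\<close>, solvable only if
  \<open>y(0) = 0\<close>.\<close>

type_synonym 'p R = "'p padic_int fps"

type_synonym 'p R' = "'p padic_int fps fps"

section \<open>Arithmetic of the p-adic integers\<close>

lemma CARD_gt_1: "1 < CARD('p :: prime_card)"
  using prime_card[where 'a = 'p] by (rule prime_gt_1_nat)

lemma Rep_padic_int_range: "0 \<le> Rep_padic_int x n" "Rep_padic_int (x :: 'p :: prime_card padic_int) n < int CARD('p) ^ n"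
  using Rep_padic_int[of x] by auto

lemma Rep_padic_int_Suc_mod:
  "Rep_padic_int (x :: 'p :: prime_card padic_int) (Suc n) mod int CARD('p) ^ n = Rep_padic_int x n"
  using Rep_padic_int[of x] by auto

lemma Rep_padic_int_mod:
  fixes x :: "'p :: prime_card padic_int"
  assumes "m \<le> n"
  shows "Rep_padic_int x n mod int CARD('p) ^ m = Rep_padic_int x m"
  using assms
proof (induction n rule: dec_induct)
  case base
  show ?case using Rep_padic_int_range[of x m] by simp
next
  case (step n)
  have "Rep_padic_int x (Suc n) mod int CARD('p) ^ m
      = Rep_padic_int x (Suc n) mod int CARD('p) ^ n mod int CARD('p) ^ m"
    using step.hyps by (simp add: mod_mod_cancel le_imp_power_dvd)
  then show ?case using step.IH by (simp add: Rep_padic_int_Suc_mod)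
qed

lemma Rep_padic_int_of_nat:
  "Rep_padic_int (of_nat m :: 'p :: prime_card padic_int) n = int m mod int CARD('p) ^ n"
  by (induction m) (simp_all add: zero_padic_int.rep_eq one_padic_int.rep_eq plus_padic_int.rep_eq mod_add_eq
      mod_add_right_eq mod_add_left_eq)

lemma padic_int_eqI:
  assumes "\<And>n. Rep_padic_int x n = Rep_padic_int y n"
  shows "x = (y :: 'p :: prime_card padic_int)"
  using assms by (simp add: Rep_padic_int_inject[symmetric] fun_eq_iff)

lemma Rep_Abs_padic_int:
  fixes x :: "'p :: prime_card padic_int"
  assumes "\<And>n. a n \<in> {0..<int CARD('p) ^ n}" "\<And>n. a (Suc n) mod int CARD('p) ^ n = a n"
    and "x = Abs_padic_int a"
  shows "Rep_padic_int x n = a n"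
proof -
  have "Rep_padic_int x = a"
    unfolding assms(3) using assms(1,2) by (intro Abs_padic_int_inverse) simp
  then show ?thesis by simp
qed

lemma of_nat_CARD_power_dvd_iff:
  fixes x :: "'p :: prime_card padic_int"
  shows "of_nat CARD('p) ^ n dvd x \<longleftrightarrow> Rep_padic_int x n = 0"
proof
  assume "of_nat CARD('p) ^ n dvd x"
  then obtain y where "x = of_nat (CARD('p) ^ n) * y" by auto
  then show "Rep_padic_int x n = 0"
    by (simp del: of_nat_power add: times_padic_int.rep_eq Rep_padic_int_of_nat) simp
next
  define P where "P = int CARD('p)"
  have P: "P > 0" using CARD_prime_pos by (simp add: P_def)
  assume 0: "Rep_padic_int x n = 0"
  have dvd: "P ^ n dvd Rep_padic_int x (n + k)" for k
    using Rep_padic_int_mod[of n "n + k" x] 0 by (simp add: P_def dvd_eq_mod_eq_0)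
  \<comment> \<open>The quotient by \<open>p^n\<close> is known modulo \<open>p^k\<close> only from
    the residue of \<open>x\<close> modulo \<open>p^(n + k)\<close>, hence the shifted
    index.\<close>
  define a where "a k = Rep_padic_int x (n + k) div P ^ n" for k
  have x: "Rep_padic_int x (n + k) = P ^ n * a k" for k
    using dvd[of k] by (simp add: a_def)
  have "a k \<in> {0..<P ^ k}" for k
  proof -
    have "0 \<le> P ^ n * a k" "P ^ n * a k < P ^ n * P ^ k"
      using Rep_padic_int_range[of x "n + k"] x[of k] by (simp_all add: P_def power_add)
    then show ?thesis using P zero_less_power[OF P, of n] by (auto simp: zero_le_mult_iff simp del: zero_less_power)
  qed
  moreover have "a (Suc k) mod P ^ k = a k" for k
  proof -
    have "P ^ n * (a (Suc k) mod P ^ k) = P ^ n * a k"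
      using Rep_padic_int_Suc_mod[of x "n + k"] x[of "Suc k"] x[of k]
      by (simp add: P_def power_add mod_mult_mult1 flip: mult_mod_right)
    then show ?thesis using P by simp
  qed
  ultimately have y: "Rep_padic_int (Abs_padic_int a :: 'p padic_int) k = a k" for k
    unfolding P_def by (intro Rep_Abs_padic_int[OF _ _ refl])
  define y where "y = (Abs_padic_int a :: 'p padic_int)"
  have "x = of_nat (CARD('p) ^ n) * y"
  proof (rule padic_int_eqI)
    fix k
    have "Rep_padic_int x k = P ^ n * a k mod P ^ k"
      using Rep_padic_int_mod[of k "n + k" x] x[of k] by (simp add: P_def)
    then show "Rep_padic_int x k = Rep_padic_int (of_nat (CARD('p) ^ n) * y) k"
      by (simp del: of_nat_power add: times_padic_int.rep_eq Rep_padic_int_of_nat y_def y)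
         (simp add: P_def mod_mult_left_eq)
  qed
  then show "of_nat CARD('p) ^ n dvd x" by simp
qed

lemma padic_int_separated:
  fixes x :: "'p :: prime_card padic_int"
  assumes "\<And>n. of_nat CARD('p) ^ n dvd x"
  shows "x = 0"
  using assms by (intro padic_int_eqI) (simp add: of_nat_CARD_power_dvd_iff zero_padic_int.rep_eq)

lemma padic_int_complete:
  fixes x :: "nat \<Rightarrow> 'p :: prime_card padic_int"
  assumes "\<And>n. of_nat CARD('p) ^ n dvd x (Suc n) - x n"
  obtains y where "\<And>n. of_nat CARD('p) ^ n dvd y - x n"
proof -
  define a where "a n = Rep_padic_int (x n) n" for n
  have Rep: "Rep_padic_int u n = Rep_padic_int v n" if "of_nat CARD('p) ^ n dvd u - v"
    for u v :: "'p padic_int" and n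
    using that Rep_padic_int_range[of u n] Rep_padic_int_range[of v n]
    unfolding of_nat_CARD_power_dvd_iff minus_padic_int.rep_eq
    by (metis mod_eq_dvd_iff mod_pos_pos_trivial dvd_eq_mod_eq_0)
  have "a (Suc n) mod int CARD('p) ^ n = a n" for n
    using Rep[OF assms[of n]] by (simp add: a_def Rep_padic_int_Suc_mod)
  moreover have "a n \<in> {0..<int CARD('p) ^ n}" for n
    using Rep_padic_int_range[of "x n" n] by (simp add: a_def)
  ultimately have "Rep_padic_int (Abs_padic_int a :: 'p padic_int) n = a n" for n
    by (intro Rep_Abs_padic_int[OF _ _ refl])
  then have "of_nat CARD('p) ^ n dvd Abs_padic_int a - x n" for n
    by (simp add: of_nat_CARD_power_dvd_iff minus_padic_int.rep_eq a_def)
  then show ?thesis by (rule that)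
qed

text \<open>Geometric series, summed by completeness and identified with the inverse by
  separatedness.\<close>

lemma padic_int_one_minus_p_unit:
  "1 - of_nat CARD('p) * z dvd (1 :: 'p :: prime_card padic_int)"
proof -
  let ?p = "of_nat CARD('p) :: 'p padic_int"
  define x where "x n = (\<Sum>i<n. (?p * z) ^ i)" for n
  have x: "(1 - ?p * z) * x n = 1 - (?p * z) ^ n" for n
    using one_diff_power_eq[of "?p * z" n] by (simp add: x_def)
  have "?p ^ n dvd x (Suc n) - x n" for n by (simp add: x_def power_mult_distrib)
  then obtain y where y: "\<And>n. ?p ^ n dvd y - x n" using padic_int_complete by metis
  have "1 - (1 - ?p * z) * y = 0"
  proof (rule padic_int_separated)
    fix n
    have "1 - (1 - ?p * z) * y = ?p ^ n * z ^ n - (1 - ?p * z) * (y - x n)"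
      using x[of n] by (simp add: algebra_simps power_mult_distrib)
    then show "?p ^ n dvd 1 - (1 - ?p * z) * y" using y[of n] by simp
  qed
  then have "1 = (1 - ?p * z) * y" by simp
  then show ?thesis by (rule dvdI)
qed

text \<open>Bezout inverts an integer lift of the residue modulo \<open>p\<close>. The product of
  \<open>x\<close> with that inverse is of the form \<open>1 - p z\<close>, which the geometric
  series inverts.\<close>

lemma padic_int_dvd_1_iff:
  fixes x :: "'p :: prime_card padic_int"
  shows "x dvd 1 \<longleftrightarrow> \<not> of_nat CARD('p) dvd x"
proof
  assume "x dvd 1"
  show "\<not> of_nat CARD('p) dvd x"
  proof
    assume "of_nat CARD('p) dvd x"
    then have "of_nat CARD('p) dvd (1 :: 'p padic_int)" using \<open>x dvd 1\<close> by (rule dvd_trans)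
    then have "of_nat CARD('p) ^ 1 dvd (1 :: 'p padic_int)" by simp
    then show False unfolding of_nat_CARD_power_dvd_iff
      using CARD_gt_1[where 'p = 'p] by (simp add: one_padic_int.rep_eq)
  qed
next
  let ?p = "of_nat CARD('p) :: 'p padic_int"
  define r where "r = Rep_padic_int x 1"
  assume "\<not> ?p dvd x"
  then have r: "r \<noteq> 0" using of_nat_CARD_power_dvd_iff[of 1 x] by (simp add: r_def)
  then have r': "0 < r" "r < int CARD('p)" using Rep_padic_int_range[of x 1] by (auto simp: r_def)
  obtain k where k: "r = int k" using r'(1) by (metis nonneg_int_cases order_less_imp_le)
  have "Rep_padic_int (x - of_nat k) 1 = (r - r mod int CARD('p)) mod int CARD('p)"
    unfolding minus_padic_int.rep_eq Rep_padic_int_of_nat r_def[symmetric] k by simp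
  then have "?p ^ 1 dvd x - of_nat k" using r' unfolding of_nat_CARD_power_dvd_iff by simp
  then have x: "?p dvd x - of_int r" by (simp add: k)
  have "prime (int CARD('p))" using prime_card[where 'a = 'p] by simp
  moreover have "\<not> int CARD('p) dvd r" using r' by (simp add: zdvd_not_zless)
  ultimately have "coprime r (int CARD('p))" using prime_imp_coprime coprime_commute by blast
  then obtain u v where "u * r + v * int CARD('p) = 1" by (metis bezout_int coprime_imp_gcd_eq_1)
  then have "of_int (u * r + v * int CARD('p)) = (1 :: 'p padic_int)" by simp
  then have uv: "of_int u * of_int r = 1 - ?p * of_int v" by (simp add: eq_diff_eq mult.commute)
  obtain w where "x - of_int r = ?p * w" using x by auto
  then have "x = of_int r + ?p * w" by (simp add: algebra_simps)
  then have "x * of_int u = of_int u * of_int r + ?p * w * of_int u" by (simp add: algebra_simps)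
  then have "x * of_int u = 1 - ?p * (of_int v - w * of_int u)" by (simp only: uv) (simp add: algebra_simps)
  then have "x dvd 1 - ?p * (of_int v - w * of_int u)" by (metis dvd_triv_left)
  then show "x dvd 1" using padic_int_one_minus_p_unit by (rule dvd_trans)
qed

lemma of_nat_CARD_power_neq_0: "of_nat CARD('p) ^ n \<noteq> (0 :: 'p :: prime_card padic_int)"
proof
  assume "of_nat CARD('p) ^ n = (0 :: 'p padic_int)"
  then have "of_nat CARD('p) ^ Suc n dvd (of_nat (CARD('p) ^ n) :: 'p padic_int)" by simp
  then show False unfolding of_nat_CARD_power_dvd_iff Rep_padic_int_of_nat
    using CARD_gt_1[where 'p = 'p] by simp
qed

lemma padic_int_factor:
  fixes x :: "'p :: prime_card padic_int"
  assumes "x \<noteq> 0"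
  obtains n u where "x = of_nat CARD('p) ^ n * u" "u dvd 1"
proof -
  let ?p = "of_nat CARD('p) :: 'p padic_int"
  obtain m where m: "\<not> ?p ^ m dvd x" using assms padic_int_separated by blast
  define n where "n = (LEAST m. \<not> ?p ^ Suc m dvd x)"
  have ex: "\<exists>m. \<not> ?p ^ Suc m dvd x" using m by (cases m) auto
  then have n: "\<not> ?p ^ Suc n dvd x" unfolding n_def by (rule LeastI_ex)
  have "?p ^ n dvd x"
  proof (cases n)
    case (Suc k)
    then have "k < n" by simp
    then show ?thesis using not_less_Least[of k "\<lambda>m. \<not> ?p ^ Suc m dvd x"] Suc by (auto simp: n_def)
  qed simp
  then obtain u where u: "x = ?p ^ n * u" by auto
  have "\<not> ?p dvd u" using n u by (metis mult_dvd_mono dvd_refl power_Suc2)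
  then show ?thesis using that[OF u] padic_int_dvd_1_iff by blast
qed

instance padic_int :: (prime_card) idom
proof
  fix x y :: "'a padic_int"
  let ?p = "of_nat CARD('a) :: 'a padic_int"
  assume "x \<noteq> 0" "y \<noteq> 0"
  then obtain m u n v where x: "x = ?p ^ m * u" "u dvd 1" and y: "y = ?p ^ n * v" "v dvd 1"
    using padic_int_factor by metis
  obtain u' v' where uv: "u * u' = 1" "v * v' = 1" using x(2) y(2) by (metis dvdE)
  have "x * y * (u' * v') = ?p ^ (m + n) * ((u * u') * (v * v'))"
    unfolding x(1) y(1) power_add by (simp only: mult_ac)
  then have "x * y * (u' * v') = ?p ^ (m + n)" using uv by simp
  then show "x * y \<noteq> 0" using of_nat_CARD_power_neq_0 by (metis mult_zero_left)
qed

instance padic_int :: (prime_card) ring_char_0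
proof
  show "inj (of_nat :: nat \<Rightarrow> 'a padic_int)"
  proof (rule injI)
    fix m n :: nat
    assume eq: "of_nat m = (of_nat n :: 'a padic_int)"
    let ?k = "m + n"
    have "m < CARD('a) ^ ?k" "n < CARD('a) ^ ?k"
      using CARD_gt_1[where 'p = 'a] power_gt_expt[of "CARD('a)" ?k] by linarith+
    then have "int m < int CARD('a) ^ ?k" "int n < int CARD('a) ^ ?k"
      by (simp_all flip: of_nat_power)
    then show "m = n"
      using arg_cong[OF eq, of "\<lambda>x. Rep_padic_int x ?k"] by (simp add: Rep_padic_int_of_nat)
  qed
qed

lemma of_nat_CARD_dvd_of_nat_iff:
  "(of_nat CARD('p) :: 'p :: prime_card padic_int) dvd of_nat m \<longleftrightarrow> CARD('p) dvd m"
proof -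
  have "(of_nat CARD('p) :: 'p padic_int) ^ 1 dvd of_nat m \<longleftrightarrow> int m mod int CARD('p) = 0"
    unfolding of_nat_CARD_power_dvd_iff Rep_padic_int_of_nat by (simp only: power_one_right)
  then show ?thesis by (simp only: power_one_right int_dvd_int_iff[symmetric] dvd_eq_mod_eq_0)
qed

lemma of_nat_padic_int_unit:
  "\<not> CARD('p) dvd m \<Longrightarrow> (of_nat m :: 'p :: prime_card padic_int) dvd 1"
  by (simp only: padic_int_dvd_1_iff of_nat_CARD_dvd_of_nat_iff not_False_eq_True)

text \<open>\<open>exquo\<close> is a definite description, so uniqueness has to be shown as well;
  for a unit \<open>b\<close> it holds even if the ring has zero divisors.\<close>

lemma mult_exquo_unit:
  assumes "b dvd (1 :: 'a :: comm_ring_1)"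
  shows "b * exquo a b = a"
proof -
  obtain c where c: "1 = b * c" using assms by (rule dvdE)
  have "b * x = a \<longleftrightarrow> x = c * a" for x
  proof
    assume "b * x = a"
    then have "c * a = (b * c) * x" by (auto simp: mult_ac)
    then show "x = c * a" by (simp flip: c)
  next
    assume "x = c * a"
    then have "b * x = (b * c) * a" by (simp only: mult_ac)
    then show "b * x = a" by (simp flip: c)
  qed
  then have "\<exists>!x. b * x = a" by auto
  then show ?thesis unfolding exquo_def by (rule theI')
qed

lemma exquo_eqI:
  assumes "b \<noteq> 0" "b * x = (a :: 'a :: idom)"
  shows "exquo a b = x"
  unfolding exquo_def using assms by (intro the_equality) auto

lemma two_half:
  assumes "odd CARD('p :: prime_card)"
  shows "2 * (half :: 'p padic_int) = 1"
proof -
  have "CARD('p) \<noteq> 2" using assms by auto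
  then have "\<not> CARD('p) dvd 2" using primes_dvd_imp_eq[OF prime_card[where 'a = 'p] two_is_prime_nat] by blast
  then have "(2 :: 'p padic_int) dvd 1" using of_nat_padic_int_unit[of 2, where 'p = 'p] by simp
  then show ?thesis unfolding half_def by (rule mult_exquo_unit)
qed

section \<open>Power series\<close>

lemma fps_dvd_1_iff:
  fixes x :: "'a :: comm_ring_1 fps"
  shows "x dvd 1 \<longleftrightarrow> fps_nth x 0 dvd 1"
proof
  assume "x dvd 1"
  then obtain y where "1 = x * y" by (rule dvdE)
  then have "1 = fps_nth x 0 * fps_nth y 0" by (metis fps_mult_nth_0 fps_one_nth)
  then show "fps_nth x 0 dvd 1" by (rule dvdI)
next
  assume "fps_nth x 0 dvd 1"
  then obtain y where "1 = fps_nth x 0 * y" by (rule dvdE)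
  then have "x * fps_right_inverse x y = 1" by (intro fps_right_inverse) simp
  then show "x dvd 1" by (metis dvd_triv_left)
qed

lemma fps_nth_mult_sum: "fps_nth (x * y) n = (\<Sum>i\<le>n. fps_nth x i * fps_nth y (n - i))"
  by (simp add: fps_mult_nth atLeast0AtMost)

lemma fps_const_dvd_iff:
  fixes c :: "'a :: comm_ring_1"
  shows "fps_const c dvd x \<longleftrightarrow> (\<forall>n. c dvd fps_nth x n)"
proof
  assume "fps_const c dvd x"
  then show "\<forall>n. c dvd fps_nth x n" by (auto elim!: dvdE)
next
  assume "\<forall>n. c dvd fps_nth x n"
  then obtain y where "\<And>n. fps_nth x n = c * y n" unfolding dvd_def by metis
  then have "x = fps_const c * Abs_fps y" by (simp add: fps_eq_iff)
  then show "fps_const c dvd x" by simp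
qed

lemma fps_X_dvd_iff:
  fixes x :: "'a :: comm_ring_1 fps"
  shows "fps_X dvd x \<longleftrightarrow> fps_nth x 0 = 0"
proof
  assume "fps_nth x 0 = 0"
  then have "x = fps_X * fps_shift 1 x" by (simp add: fps_eq_iff)
  then show "fps_X dvd x" by (rule dvdI)
qed (auto elim!: dvdE)

lemma fps_nth_compose_X_power:
  "fps_nth (x oo fps_X ^ k) n = (if k dvd n then fps_nth x (n div k) else 0)" if "k \<noteq> 0"
    for x :: "'a :: comm_ring_1 fps"
proof -
  have "fps_nth (x oo fps_X ^ k) n = (\<Sum>i=0..n. if n = k * i then fps_nth x i else 0)"
    by (simp add: fps_compose_nth fps_X_power_nth if_distrib cong: if_cong flip: power_mult)
  also have "\<dots> = (\<Sum>i\<in>{i\<in>{0..n}. n = k * i}. fps_nth x i)"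
    by (rule sum.inter_filter[symmetric]) simp
  also have "{i\<in>{0..n}. n = k * i} = (if k dvd n then {n div k} else {})"
    using that by auto
  finally show ?thesis by simp
qed

lemma fps_nth_one_plus_X_power: "fps_nth ((1 + fps_X) ^ n) i = (of_nat (n choose i) :: 'a :: comm_ring_1)"
proof (induction n arbitrary: i)
  case (Suc n)
  show ?case by (cases i) (simp_all add: distrib_right Suc)
qed (auto simp: gr0_conv_Suc)

locale rhom =
  fixes h :: "'a :: comm_ring_1 \<Rightarrow> 'b :: comm_ring_1"
  assumes hom_add: "h (x + y) = h x + h y"
    and hom_mult: "h (x * y) = h x * h y"
    and hom_one: "h 1 = 1"
begin

lemma hom_zero: "h 0 = 0" using hom_add[of 0 0] by simp

lemma hom_uminus: "h (- x) = - h x"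
  using hom_add[of x "- x"] by (simp add: hom_zero eq_neg_iff_add_eq_0 add.commute)

lemma hom_diff: "h (x - y) = h x - h y"
  using hom_add[of x "- y"] by (simp add: hom_uminus)

lemma hom_power: "h (x ^ n) = h x ^ n"
  by (induction n) (simp_all add: hom_one hom_mult)

lemma hom_of_nat: "h (of_nat n) = of_nat n"
  by (induction n) (simp_all add: hom_one hom_add hom_zero)

lemma hom_numeral: "h (numeral n) = numeral n"
  using hom_of_nat[of "numeral n"] by simp

lemma hom_sum: "h (sum f A) = (\<Sum>x\<in>A. h (f x))"
  by (induction A rule: infinite_finite_induct) (simp_all add: hom_zero hom_add)

lemma hom_dvd: "x dvd y \<Longrightarrow> h x dvd h y"
  by (auto elim!: dvdE simp: hom_mult)

lemma hom_unit: "x dvd 1 \<Longrightarrow> h x dvd 1"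
  using hom_dvd[of x 1] by (simp add: hom_one)

lemmas hom_simps = hom_add hom_mult hom_one hom_zero hom_uminus hom_diff hom_power hom_of_nat
  hom_numeral

end

lemma rhom_compose: "rhom g \<Longrightarrow> rhom h \<Longrightarrow> rhom (\<lambda>x. g (h x))"
  by (simp add: rhom_def)

lemma rhom_fps_const: "rhom fps_const"
  by unfold_locales (simp_all add: fps_const_mult)

lemma rhom_fps_nth_0: "rhom (\<lambda>x. fps_nth x 0)"
  by unfold_locales simp_all

lemma fps_map_nth [simp]: "fps_nth (fps_map h x) n = h (fps_nth x n)"
  by (simp add: fps_map_def)

lemma rhom_fps_map:
  assumes "rhom h"
  shows "rhom (fps_map h)"
proof -
  interpret rhom h by fact
  show ?thesis
    by unfold_locales (auto simp: fps_eq_iff hom_simps fps_mult_nth hom_sum)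
qed

lemma rhom_fps_compose:
  assumes "fps_nth (c :: 'a :: idom fps) 0 = 0"
  shows "rhom (\<lambda>x. x oo c)"
  using assms by unfold_locales (simp_all add: fps_compose_add_distrib fps_compose_mult_distrib)

section \<open>The endomorphisms of the coefficient rings\<close>

lemma phi_R_0_aux: "fps_nth ((1 + fps_X) ^ n - 1 :: 'a :: comm_ring_1 fps) 0 = 0"
  by (simp add: fps_nth_power_0)

global_interpretation phi_R: rhom "phi_R :: 'p :: prime_card R \<Rightarrow> _"
  unfolding phi_R_def by (rule rhom_fps_compose[OF phi_R_0_aux])

lemma CARD_prime_neq_0: "CARD('p :: prime_card) \<noteq> 0"
  using CARD_gt_1[where 'p = 'p] by simp

global_interpretation phi_A: rhom "phi_A :: 'p :: prime_card R \<Rightarrow> _"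
  unfolding phi_A_def by (rule rhom_fps_compose) simp

global_interpretation phi_R': rhom "phi_R' :: 'p :: prime_card R' \<Rightarrow> _"
  unfolding phi_R'_def
  by (rule rhom_compose[OF rhom_fps_compose rhom_fps_map[OF phi_R.rhom_axioms]])
    simp

global_interpretation gamma_R': rhom "gamma_R' :: 'p :: prime_card R' \<Rightarrow> _"
  unfolding gamma_R'_def by (rule rhom_fps_compose) simp

global_interpretation incl_A: rhom "incl_A :: 'p :: prime_card R \<Rightarrow> _"
  unfolding incl_A_def by (rule rhom_fps_map[OF rhom_fps_const])

global_interpretation mod_q1: rhom "mod_q1 :: 'p :: prime_card R' \<Rightarrow> _"
  unfolding mod_q1_def by (rule rhom_fps_map[OF rhom_fps_nth_0])

lemma phi_R_const [simp]: "phi_R (fps_const c) = fps_const c"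
  by (simp add: phi_R_def)

lemma phi_R_X: "phi_R (fps_X :: 'p :: prime_card R) = (1 + fps_X) ^ CARD('p) - 1"
  unfolding phi_R_def by (rule fps_X_fps_compose_startby0[OF phi_R_0_aux])

lemma phi_R_q: "phi_R (1 + fps_X :: 'p :: prime_card R) = (1 + fps_X) ^ CARD('p)"
  by (simp add: phi_R.hom_add phi_R.hom_one phi_R_X)

lemma phi_R_nth_0 [simp]: "fps_nth (phi_R x) 0 = fps_nth x 0"
  by (simp add: phi_R_def)

lemma phi_A_nth:
  "fps_nth (phi_A (x :: 'p :: prime_card R)) n =
    (if CARD('p) dvd n then fps_nth x (n div CARD('p)) else 0)"
  unfolding phi_A_def by (rule fps_nth_compose_X_power[OF CARD_prime_neq_0])

lemma phi_R'_nth: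
  "fps_nth (phi_R' (x :: 'p :: prime_card R')) n =
    (if CARD('p) dvd n then phi_R (fps_nth x (n div CARD('p))) else 0)"
  unfolding phi_R'_def by (simp only: fps_nth_compose_X_power[OF CARD_prime_neq_0] fps_map_nth)

lemma phi_R'_const [simp]: "phi_R' (fps_const c) = fps_const (phi_R c)"
  by (auto simp: fps_eq_iff phi_R'_nth phi_R.hom_zero dvd_div_eq_0_iff)

lemma incl_A_nth [simp]: "fps_nth (incl_A x) n = fps_const (fps_nth x n)"
  by (simp add: incl_A_def)

lemma mod_q1_nth [simp]: "fps_nth (mod_q1 x) n = fps_nth (fps_nth x n) 0"
  by (simp add: mod_q1_def)

lemma mod_q1_const [simp]: "mod_q1 (fps_const c) = fps_const (fps_nth c 0)"
  by (simp add: fps_eq_iff)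

lemma mod_q1_X [simp]: "mod_q1 fps_X = fps_X"
  by (simp add: fps_eq_iff)

lemma mod_q1_incl_A [simp]: "mod_q1 (incl_A x) = x"
  by (simp add: fps_eq_iff)

lemma mod_q1_q1_R' [simp]: "mod_q1 q1_R' = 0"
  by (simp add: q1_R'_def)

lemma mod_q1_gamma_R' [simp]: "mod_q1 (gamma_R' x) = mod_q1 x"
  by (simp add: fps_eq_iff gamma_R'_nth fps_nth_power_0)

lemma mod_q1_phi_R' [simp]: "mod_q1 (phi_R' x) = phi_A (mod_q1 x)"
  by (simp add: fps_eq_iff phi_R'_nth phi_A_nth)

lemma phi_R'_incl_A: "phi_R' (incl_A x) = incl_A (phi_A x)"
  by (simp add: fps_eq_iff phi_R'_nth phi_A_nth)

lemma gamma_phi_R': "gamma_R' (phi_R' x) = phi_R' (gamma_R' (x :: 'p :: prime_card R'))"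
proof (rule fps_ext)
  fix n
  show "fps_nth (gamma_R' (phi_R' x)) n = fps_nth (phi_R' (gamma_R' x)) n"
  proof (cases "CARD('p) dvd n")
    case True
    then have "(1 + fps_X :: 'p R) ^ n = ((1 + fps_X) ^ CARD('p)) ^ (n div CARD('p))"
      by (simp flip: power_mult)
    then show ?thesis using True
      by (simp only: gamma_R'_nth phi_R'_nth if_True phi_R.hom_mult phi_R.hom_power phi_R_q)
  qed (simp add: gamma_R'_nth phi_R'_nth)
qed

lemma q1_R'_neq_0: "q1_R' \<noteq> (0 :: 'p :: prime_card R')"
  by (simp add: q1_R'_def)

lemma gamma_R'_q1 [simp]: "gamma_R' q1_R' = q1_R'"
  by (simp add: q1_R'_def gamma_R'_const)

lemma q1_R'_dvd_iff: "q1_R' dvd x \<longleftrightarrow> mod_q1 x = 0"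
  by (simp add: q1_R'_def fps_const_dvd_iff fps_X_dvd_iff fps_eq_iff)

text \<open>On coefficients \<open>d_q\<close> multiplies by \<open>[n + 1]_q\<close>, which becomes
  \<open>n + 1\<close> at \<open>q = 1\<close>.\<close>

lemma mod_q1_d_q: "mod_q1 (d_q x) = fps_deriv (mod_q1 x)"
proof (rule fps_ext)
  fix n
  have "fps_X * fps_nth (d_q x) n = fps_nth (q1_R' * fps_X * d_q x) (Suc n)"
    by (simp add: q1_R'_def mult.assoc)
  also have "\<dots> = ((1 + fps_X) ^ Suc n - 1) * fps_nth x (Suc n)"
    unfolding d_q_eq by (simp add: gamma_R'_nth left_diff_distrib)
  also have "(1 + fps_X) ^ Suc n - 1 = fps_X * (\<Sum>i<Suc n. (1 + fps_X :: 'a padic_int fps) ^ i)"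
    using power_diff_1_eq[of "1 + fps_X :: 'a padic_int fps" "Suc n"] by (simp del: sum.lessThan_Suc power_Suc)
  finally have "fps_nth (d_q x) n = (\<Sum>i<Suc n. (1 + fps_X) ^ i) * fps_nth x (Suc n)"
    by (simp add: mult.assoc del: sum.lessThan_Suc)
  then show "fps_nth (mod_q1 (d_q x)) n = fps_nth (fps_deriv (mod_q1 x)) n"
    by (simp add: fps_sum_nth fps_nth_power_0 del: sum.lessThan_Suc)
qed

section \<open>The q-integers\<close>

definition qnat :: "nat \<Rightarrow> 'p :: prime_card R"
  where "qnat n = (\<Sum>i<n. (1 + fps_X) ^ i)"

lemma X_qnat: "fps_X * qnat n = (1 + fps_X) ^ n - 1"
  using power_diff_1_eq[of "1 + fps_X :: 'a padic_int fps" n] by (simp add: qnat_def)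

lemma qnat_nth_0 [simp]: "fps_nth (qnat n) 0 = of_nat n"
  by (simp add: qnat_def fps_sum_nth fps_nth_power_0)

lemma qnat_neq_0: "n > 0 \<Longrightarrow> qnat n \<noteq> (0 :: 'p :: prime_card R)"
  using qnat_nth_0[of n, where 'a = 'p] by (metis fps_zero_nth of_nat_eq_0_iff neq0_conv)

lemma prod_diff_eq_fact_binomial:
  "(\<Prod>j<i. of_nat n - of_nat j) = (of_nat (fact i * (n choose i)) :: 'a :: comm_ring_1)"
proof (cases "i \<le> n")
  case True
  then have "fact i * (n choose i) = (\<Prod>j<i. n - j)"
  proof (induction i)
    case (Suc i)
    then have "Suc i * (n choose Suc i) = (n - i) * (n choose i)"
      by (simp only: binomial_absorption binomial_absorb_comp)
    then have "fact (Suc i) * (n choose Suc i) = (n - i) * (fact i * (n choose i))"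
      by (simp only: fact_Suc of_nat_id mult_ac)
    then show ?case using Suc by simp
  qed simp
  moreover have "(\<Prod>j<i. of_nat n - of_nat j) = (of_nat (\<Prod>j<i. n - j) :: 'a)"
    unfolding of_nat_prod using True by (intro prod.cong) auto
  ultimately show ?thesis by simp
next
  case False
  then have "(\<Prod>j<i. of_nat n - of_nat j) = (0 :: 'a)" by (intro prod_zero) auto
  then show ?thesis using False by (simp add: binomial_eq_0)
qed

lemma qpow_of_nat: "qpow (of_nat n) = (1 + fps_X :: 'p :: prime_card R) ^ n"
proof (rule fps_ext)
  fix i
  have "zbinom (of_nat n :: 'p padic_int) i = of_nat (n choose i)"
    unfolding zbinom_def by (rule exquo_eqI) (simp_all add: prod_diff_eq_fact_binomial)
  then show "fps_nth (qpow (of_nat n)) i = fps_nth ((1 + fps_X :: 'p R) ^ n) i"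
    by (simp add: qpow_def fps_nth_one_plus_X_power)
qed

lemma qint_eqI: "fps_X * x = qpow a - 1 \<Longrightarrow> qint a = x"
  unfolding qint_def by (rule exquo_eqI) simp_all

lemma qint_of_nat: "qint (of_nat n) = qnat n"
  by (rule qint_eqI) (simp add: X_qnat qpow_of_nat)

section \<open>The square root of q\<close>

text \<open>For \<open>n > 0\<close> the unknown \<open>x n\<close> enters the \<open>n\<close>-th
  sum only through \<open>i = 0\<close> and \<open>i = n\<close>, with total factor
  \<open>1 + s^n\<close>, so the equations are solved one after the other. \<open>s = 1\<close>
  gives ordinary square roots, \<open>s = sqrt_q\<close> the sequence \<open>qcoef\<close>.\<close>

lemma ex_twisted_sqrt:
  fixes s :: "'a :: comm_ring_1" and g :: "nat \<Rightarrow> 'a"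
  assumes unit: "\<And>n. 1 + s ^ n dvd 1" and g0: "g 0 = 1"
  shows "\<exists>x. x 0 = 1 \<and> (\<forall>n. (\<Sum>i\<le>n. s ^ (n - i) * x i * x (n - i)) = g n)"
proof -
  define P where "P f n r \<longleftrightarrow> (if n = 0 then r = 1 else
    (1 + s ^ n) * r + (\<Sum>i\<in>{1..<n}. s ^ (n - i) * f i * f (n - i)) = g n)"
    for f n and r :: 'a
  have "\<exists>x. \<forall>n. P x n (x n)"
  proof (rule dependent_wf_choice[OF wf_less])
    fix f g :: "nat \<Rightarrow> 'a" and n :: nat and r :: 'a
    assume "\<And>z. (z, n) \<in> {(x, y). x < y} \<Longrightarrow> f z = g z"
    then show "P f n r = P g n r" unfolding P_def by (auto intro!: arg_cong2[where f = "(=)"] sum.cong)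
  next
    fix n and f :: "nat \<Rightarrow> 'a"
    show "\<exists>r. P f n r"
      using mult_exquo_unit[OF unit[of n]] unfolding P_def by (metis diff_add_cancel)
  qed
  then obtain x where x: "\<And>n. P x n (x n)" by blast
  have x0: "x 0 = 1" using x[of 0] by (simp add: P_def)
  have "(\<Sum>i\<le>n. s ^ (n - i) * x i * x (n - i)) = g n" for n
  proof (cases n)
    case (Suc k)
    have "{..n} = insert 0 (insert n {1..<n})" using Suc by auto
    then have "(\<Sum>i\<le>n. s ^ (n - i) * x i * x (n - i))
        = (1 + s ^ n) * x n + (\<Sum>i\<in>{1..<n}. s ^ (n - i) * x i * x (n - i))"
      using Suc by (simp add: x0 algebra_simps)
    then show ?thesis using x[of n] Suc by (simp add: P_def)
  qed (simp add: x0 g0)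
  then show ?thesis using x0 by blast
qed

definition sqrt_q :: "'p :: prime_card R"
  where "sqrt_q = qpow half"

context
  assumes odd_p: "odd CARD('p :: prime_card)"
begin

lemma two_unit: "(2 :: 'p padic_int) dvd 1"
  using two_half[OF odd_p] by (metis dvd_triv_left)

text \<open>\<open>zbinom half\<close> is an exact quotient whose existence is not known beforehand.
  So a square root \<open>S\<close> of \<open>q\<close> is constructed first; its differential
  equation \<open>2 q S' = S\<close> gives its coefficients the recursion of the binomial
  coefficients, which identifies \<open>S\<close> with the binomial series.\<close>

lemma sqrt_q_square: "sqrt_q * sqrt_q = (1 + fps_X :: 'p R)"
  and sqrt_q_nth_0: "fps_nth (sqrt_q :: 'p R) 0 = 1"
proof -
  have "\<exists>x. x 0 = 1 \<and> (\<forall>n. (\<Sum>i\<le>n. 1 ^ (n - i) * x i * x (n - i)) = fps_nth (1 + fps_X :: 'p R) n)"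
    by (rule ex_twisted_sqrt) (simp_all add: two_unit)
  then obtain x :: "nat \<Rightarrow> 'p padic_int" where x: "x 0 = 1"
    "\<And>n. (\<Sum>i\<le>n. x i * x (n - i)) = fps_nth (1 + fps_X) n" by auto
  define S where "S = Abs_fps x"
  have SS: "S * S = 1 + fps_X" using x(2) by (simp add: fps_eq_iff fps_nth_mult_sum S_def)
  have "fps_deriv (S * S) = 1" unfolding SS by simp
  then have "2 * ((1 + fps_X) * fps_deriv S) = S * (S * fps_deriv S + S * fps_deriv S)"
    unfolding SS[symmetric] by (simp add: algebra_simps)
  also have "\<dots> = S * fps_deriv (S * S)" by (simp add: algebra_simps)
  finally have D: "2 * ((1 + fps_X) * fps_deriv S) = S" unfolding \<open>fps_deriv (S * S) = 1\<close> by simp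
  have rec: "of_nat (Suc n) * x (Suc n) = (half - of_nat n) * x n" for n
  proof -
    have nth: "fps_nth ((1 + fps_X) * fps_deriv S) n = of_nat (Suc n) * x (Suc n) + of_nat n * x n"
      by (cases n) (simp_all add: distrib_right S_def)
    have "2 * (of_nat (Suc n) * x (Suc n) + of_nat n * x n) = x n"
      unfolding nth[symmetric] using arg_cong[OF D, of "\<lambda>y. fps_nth y n"]
      by (simp add: fps_numeral_fps_const S_def)
    then have "half * 2 * (of_nat (Suc n) * x (Suc n) + of_nat n * x n) = half * x n"
      by (simp only: mult.assoc)
    moreover have "half * 2 = (1 :: 'p padic_int)" using two_half[OF odd_p] by (simp add: mult.commute)
    ultimately have "of_nat (Suc n) * x (Suc n) + of_nat n * x n = half * x n"
      by (simp only: mult_1_left)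
    then show ?thesis by (simp add: algebra_simps)
  qed
  have "of_nat (fact n) * x n = (\<Prod>j<n. half - of_nat j)" for n
  proof (induction n)
    case (Suc n)
    have "of_nat (fact (Suc n)) * x (Suc n) = of_nat (fact n) * (of_nat (Suc n) * x (Suc n))"
      by (simp only: fact_Suc of_nat_id of_nat_mult mult_ac)
    also have "\<dots> = (of_nat (fact n) * x n) * (half - of_nat n)" by (simp only: rec mult_ac)
    finally show ?case by (simp only: Suc prod.lessThan_Suc)
  qed (simp add: x)
  then have "zbinom half n = x n" for n
    unfolding zbinom_def by (intro exquo_eqI) simp_all
  then have sqrt: "sqrt_q = S" by (simp add: sqrt_q_def qpow_def S_def fps_eq_iff)
  show "sqrt_q * sqrt_q = (1 + fps_X :: 'p R)" unfolding sqrt by (rule SS)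
  show "fps_nth (sqrt_q :: 'p R) 0 = 1" unfolding sqrt by (simp add: S_def x(1))
qed

lemma X_qint_half: "fps_X * qint half = (sqrt_q :: 'p R) - 1"
proof -
  have "fps_X dvd (sqrt_q :: 'p R) - 1" by (simp add: fps_X_dvd_iff sqrt_q_nth_0)
  then obtain y where y: "(sqrt_q :: 'p R) - 1 = fps_X * y" by (rule dvdE)
  then have "qint half = y" by (intro qint_eqI) (simp add: sqrt_q_def)
  then show ?thesis using y by simp
qed

lemma sqrt_q_nth_1: "fps_nth (sqrt_q :: 'p R) 1 = half"
proof -
  have "2 * fps_nth (sqrt_q :: 'p R) 1 = 1"
    using arg_cong[OF sqrt_q_square, of "\<lambda>y. fps_nth y 1"] by (simp add: fps_mult_nth_1 sqrt_q_nth_0)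
  then have "half * 2 * fps_nth (sqrt_q :: 'p R) 1 = half" by (simp only: mult.assoc mult_1_right)
  moreover have "half * 2 = (1 :: 'p padic_int)" using two_half[OF odd_p] by (simp add: mult.commute)
  ultimately show ?thesis by (simp only: mult_1_left)
qed

end

section \<open>The q-hypergeometric series\<close>

definition fps_scale :: "'a :: comm_ring_1 \<Rightarrow> 'a fps \<Rightarrow> 'a fps"
  where "fps_scale t x = Abs_fps (\<lambda>n. t ^ n * fps_nth x n)"

lemma fps_scale_nth [simp]: "fps_nth (fps_scale t x) n = t ^ n * fps_nth x n"
  by (simp add: fps_scale_def)

lemma fps_scale_mult: "fps_scale t (x * y) = fps_scale t x * fps_scale t y"
proof (rule fps_ext)
  fix n
  have "t ^ n * (fps_nth x i * fps_nth y (n - i)) = (t ^ i * fps_nth x i) * (t ^ (n - i) * fps_nth y (n - i))"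
    if "i \<le> n" for i
    using that power_add[of t i "n - i"] by (simp add: mult_ac)
  then show "fps_nth (fps_scale t (x * y)) n = fps_nth (fps_scale t x * fps_scale t y) n"
    by (simp add: fps_nth_mult_sum sum_distrib_left)
qed

lemma gamma_R'_eq_scale: "gamma_R' = fps_scale (1 + fps_X)"
  by (simp add: fun_eq_iff fps_eq_iff gamma_R'_nth)

text \<open>
  \<open>\<Sum> qcoef n * \<lambda>^n\<close> is the series \<open>F\<close> with \<open>F(\<lambda>) F(q^(1/2) \<lambda>) = 1 / (1 - \<lambda>)\<close>. Solving this
  equation only divides by \<open>1 + q^(n/2)\<close>, so the coefficients are visibly integral, and it
  implies \<open>qcoef n = (\<Prod>i<n. [i + 1/2]_q / [i + 1]_q)\<close>.
\<close>

definition qcoef :: "nat \<Rightarrow> 'p :: prime_card R"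
  where "qcoef = (SOME x. x 0 = 1 \<and> (\<forall>n. (\<Sum>i\<le>n. sqrt_q ^ (n - i) * x i * x (n - i)) = 1))"

definition fq :: "'p :: prime_card R'"
  where "fq = Abs_fps (\<lambda>n. qcoef n ^ 2)"

lemma fq_nth [simp]: "fps_nth fq n = qcoef n ^ 2"
  by (simp add: fq_def)

lemma geometric_fps_scale: "(1 - fps_const t * fps_X) * fps_scale t (Abs_fps (\<lambda>_. 1 :: 'a :: comm_ring_1)) = 1"
proof (rule fps_ext)
  fix n
  show "fps_nth ((1 - fps_const t * fps_X) * fps_scale t (Abs_fps (\<lambda>_. 1))) n = fps_nth 1 n"
    by (cases n) (simp_all add: left_diff_distrib mult.assoc)
qed

context
  assumes odd_p: "odd CARD('p :: prime_card)"
begin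

lemma qcoef_0: "qcoef 0 = (1 :: 'p R)"
  and qcoef_sum: "(\<Sum>i\<le>n. sqrt_q ^ (n - i) * qcoef i * qcoef (n - i)) = (1 :: 'p R)"
proof -
  have "(1 + sqrt_q ^ n :: 'p R) dvd 1" for n
    by (simp add: fps_dvd_1_iff fps_nth_power_0 sqrt_q_nth_0[OF odd_p] two_unit[OF odd_p])
  then have "\<exists>x. x 0 = 1 \<and> (\<forall>n. (\<Sum>i\<le>n. sqrt_q ^ (n - i) * x i * x (n - i)) = (1 :: 'p R))"
    using ex_twisted_sqrt[of "sqrt_q :: 'p R" "\<lambda>_. 1"] by simp
  from someI_ex[OF this]
  show "qcoef 0 = (1 :: 'p R)"
    "(\<Sum>i\<le>n. sqrt_q ^ (n - i) * qcoef i * qcoef (n - i)) = (1 :: 'p R)"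
    unfolding qcoef_def by blast+
qed

text \<open>Let \<open>F\<close> be the generating series and \<open>s = sqrt_q\<close>. Then
  \<open>F(\<lambda>) F(s \<lambda>) = 1 / (1 - \<lambda>)\<close>, and its translate is
  \<open>F(s \<lambda>) F(q \<lambda>) = 1 / (1 - s \<lambda>)\<close>. Eliminating the common
  factor leaves \<open>(1 - \<lambda>) F(\<lambda>) = (1 - s \<lambda>) F(q \<lambda>)\<close>, and
  the claim compares coefficients.\<close>

lemma qcoef_Suc:
  "((1 + fps_X) ^ Suc n - 1) * qcoef (Suc n) = (sqrt_q * (1 + fps_X) ^ n - 1) * (qcoef n :: 'p R)"
proof -
  let ?s = "sqrt_q :: 'p R"
  define F where "F = Abs_fps (qcoef :: nat \<Rightarrow> 'p R)"
  define G where "G = Abs_fps (\<lambda>_. 1 :: 'p R)"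
  have 1: "F * fps_scale ?s F = G"
    using qcoef_sum by (simp add: fps_eq_iff fps_nth_mult_sum F_def G_def mult_ac)
  have ss: "fps_scale ?s (fps_scale ?s F) = fps_scale (1 + fps_X) F"
    by (simp add: fps_eq_iff sqrt_q_square[OF odd_p, symmetric] power_mult_distrib mult_ac)
  have "fps_scale ?s F * fps_scale (1 + fps_X) F = fps_scale ?s G"
    using arg_cong[OF 1, of "fps_scale ?s"] by (simp add: fps_scale_mult ss)
  then have 2: "(1 - fps_const ?s * fps_X) * (fps_scale ?s F * fps_scale (1 + fps_X) F) = 1"
    using geometric_fps_scale[of ?s] by (simp add: G_def)
  have "(1 - fps_X) * G = 1"
    using geometric_fps_scale[of "1 :: 'p R"] by (simp add: G_def fps_scale_def)
  then have 3: "(1 - fps_X) * (F * fps_scale ?s F) = 1" using 1 by simp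
  have "(1 - fps_X) * F = (1 - fps_X) * F * ((1 - fps_const ?s * fps_X) * (fps_scale ?s F * fps_scale (1 + fps_X) F))"
    using 2 by simp
  also have "\<dots> = ((1 - fps_X) * (F * fps_scale ?s F)) * ((1 - fps_const ?s * fps_X) * fps_scale (1 + fps_X) F)"
    by (simp only: mult_ac)
  finally have "(1 - fps_X) * F = (1 - fps_const ?s * fps_X) * fps_scale (1 + fps_X) F"
    unfolding 3 by simp
  from arg_cong[OF this, of "\<lambda>y. fps_nth y (Suc n)"] show ?thesis
    by (simp add: F_def left_diff_distrib mult.assoc algebra_simps)
qed

text \<open>The q-hypergeometric equation multiplied by \<open>(q - 1)^2 \<lambda>\<close>, with
  \<open>d_q\<close> expressed through \<gamma>. On coefficients it is the square of the recursion
  \<open>qcoef_Suc\<close>.\<close>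

lemma fq_equation:
  "(1 - fps_const (1 + fps_X) * fps_X) * gamma_R' (gamma_R' fq)
    - 2 * (1 - fps_const sqrt_q * fps_X) * gamma_R' fq + (1 - fps_X) * fq = (0 :: 'p R')"
proof (rule fps_ext)
  fix n
  let ?q = "1 + fps_X :: 'p R"
  define s where "s = (sqrt_q :: 'p R)"
  show "fps_nth ((1 - fps_const ?q * fps_X) * gamma_R' (gamma_R' fq)
    - 2 * (1 - fps_const sqrt_q * fps_X) * gamma_R' fq + (1 - fps_X) * fq) n = fps_nth (0 :: 'p R') n"
  proof (cases n)
    case 0
    show ?thesis
      by (simp add: 0 gamma_R'_nth fps_numeral_fps_const)
  next
    case (Suc m)
    have q: "?q = s * s" by (simp add: s_def sqrt_q_square[OF odd_p])
    have "((s * s) ^ Suc m - 1) * qcoef (Suc m) = (s * (s * s) ^ m - 1) * qcoef m"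
      using qcoef_Suc[of m] by (simp only: q s_def)
    then have "(((s * s) ^ Suc m - 1) * qcoef (Suc m)) ^ 2 = ((s * (s * s) ^ m - 1) * qcoef m) ^ 2" by simp
    then have "(s * s) ^ Suc m * ((s * s) ^ Suc m * qcoef (Suc m) ^ 2) - s * s * ((s * s) ^ m * ((s * s) ^ m * qcoef m ^ 2))
      - 2 * ((s * s) ^ Suc m * qcoef (Suc m) ^ 2 - s * ((s * s) ^ m * qcoef m ^ 2)) + (qcoef (Suc m) ^ 2 - qcoef m ^ 2) = 0"
      by (simp add: power2_eq_square algebra_simps)
    then show ?thesis
      by (simp add: Suc gamma_R'_nth fps_numeral_fps_const left_diff_distrib mult.assoc del: power_Suc flip: q s_def)
  qed
qed

lemma fq_unit: "(fq :: 'p R') dvd 1"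
  by (simp add: fps_dvd_1_iff qcoef_0)

text \<open>Dividing \<open>qcoef_Suc\<close> by \<open>q - 1\<close> gives
  \<open>[n + 1]_q c (n + 1) = [n + 1/2]_q c n\<close>, where \<open>[n + 1/2]_q\<close> appears as
  \<open>sqrt_q * qnat n + qint half\<close>. At \<open>q = 1\<close> this is the recursion of the
  classical coefficients.\<close>

lemma mod_q1_fq: "mod_q1 fq = (hyper :: 'p R)"
proof -
  define c where "c n = fps_nth (qcoef n :: 'p R) 0" for n
  have rec: "(of_nat n + 1) * c (Suc n) = (of_nat n + half) * c n" for n
  proof -
    have "fps_X * (qnat (Suc n) * qcoef (Suc n)) = ((1 + fps_X) ^ Suc n - 1) * (qcoef (Suc n) :: 'p R)"
      by (simp only: X_qnat mult.assoc[symmetric])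
    also have "\<dots> = (sqrt_q * (1 + fps_X) ^ n - 1) * qcoef n" by (rule qcoef_Suc)
    also have "sqrt_q * (1 + fps_X) ^ n - 1 = fps_X * (sqrt_q * qnat n + qint half :: 'p R)"
    proof -
      have "fps_X * (sqrt_q * qnat n + qint half :: 'p R) = sqrt_q * (fps_X * qnat n) + fps_X * qint half"
        by (simp only: distrib_left mult_ac)
      then show ?thesis unfolding X_qnat X_qint_half[OF odd_p] by (simp add: right_diff_distrib)
    qed
    finally have eq: "qnat (Suc n) * qcoef (Suc n) = (sqrt_q * qnat n + qint half) * (qcoef n :: 'p R)"
      by (simp add: mult.assoc)
    have half: "fps_nth (qint half :: 'p R) 0 = half"
      using arg_cong[OF X_qint_half[OF odd_p], of "\<lambda>y. fps_nth y 1"] sqrt_q_nth_1[OF odd_p] by simp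
    show ?thesis
      using arg_cong[OF eq, of "\<lambda>y. fps_nth y 0"] half
      by (simp add: c_def sqrt_q_nth_0[OF odd_p] add.commute)
  qed
  have "(\<Prod>i<n. of_nat i + 1) * c n = (\<Prod>i<n. of_nat i + half)" for n
  proof (induction n)
    case (Suc n)
    have "(\<Prod>i<Suc n. of_nat i + 1) * c (Suc n) = (\<Prod>i<n. of_nat i + 1) * ((of_nat n + 1) * c (Suc n))"
      by (simp only: prod.lessThan_Suc mult.assoc)
    also have "\<dots> = (\<Prod>i<n. of_nat i + 1) * c n * (of_nat n + half)" by (simp only: rec) (simp only: mult_ac)
    finally show ?case by (simp only: Suc prod.lessThan_Suc)
  qed (simp add: c_def qcoef_0)
  moreover have "(\<Prod>i<n. of_nat i + 1 :: 'p padic_int) \<noteq> 0" for n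
  proof -
    have "of_nat i + 1 \<noteq> (0 :: 'p padic_int)" for i
      using of_nat_neq_0[of i, where 'a = "'p padic_int"] by (simp add: add.commute)
    then show ?thesis by simp
  qed
  ultimately have "exquo (\<Prod>i<n. of_nat i + half) (\<Prod>i<n. of_nat i + 1) = c n" for n
    by (intro exquo_eqI)
  then show ?thesis by (simp add: hyper_def fps_eq_iff c_def fps_nth_power_0)
qed

end

section \<open>Congruences\<close>

definition cg :: "'a :: comm_ring_1 \<Rightarrow> 'a \<Rightarrow> 'a \<Rightarrow> bool"
  where "cg m a b \<longleftrightarrow> m dvd a - b"

lemma cg_refl [simp]: "cg m a a"
  by (simp add: cg_def)

lemma cg_sym: "cg m a b \<Longrightarrow> cg m b a"
  unfolding cg_def by (metis dvd_minus_iff minus_diff_eq)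

lemma cg_trans [trans]: "cg m a b \<Longrightarrow> cg m b c \<Longrightarrow> cg m a c"
  unfolding cg_def using dvd_add[of m "a - b" "b - c"] by simp

lemma cg_add: "cg m a b \<Longrightarrow> cg m c d \<Longrightarrow> cg m (a + c) (b + d)"
  unfolding cg_def using dvd_add[of m "a - b" "c - d"] by (simp add: algebra_simps)

lemma cg_diff: "cg m a b \<Longrightarrow> cg m c d \<Longrightarrow> cg m (a - c) (b - d)"
  unfolding cg_def using dvd_diff[of m "a - b" "c - d"] by (simp add: algebra_simps)

lemma cg_mult: "cg m a b \<Longrightarrow> cg m c d \<Longrightarrow> cg m (a * c) (b * d)"
  unfolding cg_def
proof -
  assume "m dvd a - b" "m dvd c - d"
  then have "m dvd (a - b) * c + b * (c - d)" by simp
  then show "m dvd a * c - b * d" by (simp add: algebra_simps)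
qed

lemma cg_power: "cg m a b \<Longrightarrow> cg m (a ^ n) (b ^ n)"
  by (induction n) (simp_all add: cg_mult)

lemma cg_sum: "(\<And>i. i \<in> A \<Longrightarrow> cg m (f i) (g i)) \<Longrightarrow> cg m (sum f A) (sum g A)"
  by (induction A rule: infinite_finite_induct) (simp_all add: cg_add)

lemma cg_0_iff: "cg m a 0 \<longleftrightarrow> m dvd a"
  by (simp add: cg_def)

lemma cg_iff_diff: "cg m a b \<longleftrightarrow> cg m (a - b) 0"
  by (simp add: cg_def)

lemma cg_fps_iff: "cg (fps_const m) x y \<longleftrightarrow> (\<forall>n. cg m (fps_nth x n) (fps_nth y n))"
  by (simp add: cg_def fps_const_dvd_iff)

definition cg_supported :: "'a :: comm_ring_1 \<Rightarrow> nat \<Rightarrow> (nat \<Rightarrow> 'a) \<Rightarrow> bool"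
  where "cg_supported m N x \<longleftrightarrow> (\<forall>n. \<not> N dvd n \<longrightarrow> cg m (x n) 0)"

lemma cg_sum_multiples:
  fixes N n :: nat
  assumes "\<And>k. k \<le> N * n \<Longrightarrow> \<not> N dvd k \<Longrightarrow> cg m (x k) 0" and "N > 0"
  shows "cg m (\<Sum>k\<le>N * n. x k) (\<Sum>i\<le>n. x (N * i))"
proof -
  have "cg m (\<Sum>k\<le>N * n. x k) (\<Sum>k\<le>N * n. if N dvd k then x k else 0)"
    using assms by (intro cg_sum) auto
  also have "(\<Sum>k\<le>N * n. if N dvd k then x k else 0) = (\<Sum>k\<in>{k\<in>{..N * n}. N dvd k}. x k)"
    by (rule sum.inter_filter[symmetric]) simp
  also have "{k\<in>{..N * n}. N dvd k} = (\<lambda>i. N * i) ` {..n}" using \<open>N > 0\<close> by auto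
  also have "(\<Sum>k\<in>(\<lambda>i. N * i) ` {..n}. x k) = (\<Sum>i\<le>n. x (N * i))"
    using \<open>N > 0\<close> by (subst sum.reindex) (auto simp: inj_on_def)
  finally show ?thesis .
qed

lemma cg_supported_mult:
  assumes "cg_supported m N (fps_nth x)" "cg_supported m N (fps_nth y)"
  shows "cg_supported m N (fps_nth (x * y))"
  unfolding cg_supported_def
proof (intro allI impI)
  fix n
  assume n: "\<not> N dvd n"
  have "cg m (fps_nth x i * fps_nth y (n - i)) 0" if "i \<le> n" for i
  proof (cases "N dvd i")
    case True
    then have "\<not> N dvd n - i" using n that by (metis dvd_add le_add_diff_inverse)
    then show ?thesis using assms(2) by (simp add: cg_supported_def cg_0_iff)
  qed (use assms(1) in \<open>simp add: cg_supported_def cg_0_iff\<close>)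
  then have "cg m (\<Sum>i\<le>n. fps_nth x i * fps_nth y (n - i)) (\<Sum>i\<le>n. 0)" by (intro cg_sum) simp
  then show "cg m (fps_nth (x * y) n) 0" by (simp add: fps_nth_mult_sum)
qed

text \<open>Atkin's operator \<open>U_N\<close>. Modulo \<open>m\<close> it is multiplicative as
  soon as one factor is a series in \<open>\<lambda>^N\<close>.\<close>

definition fps_section :: "nat \<Rightarrow> 'a fps \<Rightarrow> 'a fps"
  where "fps_section N x = Abs_fps (\<lambda>n. fps_nth x (N * n))"

lemma fps_section_nth [simp]: "fps_nth (fps_section N x) n = fps_nth x (N * n)"
  by (simp add: fps_section_def)

lemma fps_section_mult:
  assumes "cg_supported m N (fps_nth x)" "N > 0"
  shows "cg (fps_const m) (fps_section N (x * y)) (fps_section N x * fps_section N y)"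
  unfolding cg_fps_iff
proof
  fix n
  have "cg m (\<Sum>i\<le>N * n. fps_nth x i * fps_nth y (N * n - i))
      (\<Sum>i\<le>n. fps_nth x (N * i) * fps_nth y (N * n - N * i))"
    using assms by (intro cg_sum_multiples) (auto simp: cg_supported_def cg_0_iff)
  then show "cg m (fps_nth (fps_section N (x * y)) n) (fps_nth (fps_section N x * fps_section N y) n)"
    by (simp add: fps_nth_mult_sum diff_mult_distrib2)
qed

text \<open>The translates of \<open>{0..<N}\<close> by multiples of \<open>N\<close> are disjoint, so the product does not mix blocks.\<close>

lemma cg_supported_mult_short:
  assumes "cg_supported m N (fps_nth x)" "N > 0" and short: "\<And>k. k \<ge> N \<Longrightarrow> fps_nth y k = 0"
  shows "cg m (fps_nth (x * y) n) (fps_nth x (N * (n div N)) * fps_nth y (n mod N))"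
proof -
  have "cg m (fps_nth x i * fps_nth y (n - i))
      (if i = N * (n div N) then fps_nth x i * fps_nth y (n - i) else 0)" if "i \<le> n" for i
  proof (cases "N dvd i")
    case True
    then obtain k where k: "i = N * k" by auto
    show ?thesis
    proof (cases "k = n div N")
      case False
      have "k \<le> n div N" using that k \<open>N > 0\<close> by (simp add: less_eq_div_iff_mult_less_eq mult.commute)
      then have "Suc k \<le> n div N" using False by simp
      then have "N * Suc k \<le> N * (n div N)" using mult_le_mono2 by blast
      also have "\<dots> \<le> n" by simp
      finally have "n - i \<ge> N" using k by simp
      then show ?thesis using short by simp
    qed (simp add: k)
  next
    case False
    then have "cg m (fps_nth x i * fps_nth y (n - i)) 0"
      using assms(1) by (simp add: cg_supported_def cg_0_iff)
    then show ?thesis using False by auto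
  qed
  then have "cg m (\<Sum>i\<le>n. fps_nth x i * fps_nth y (n - i))
      (\<Sum>i\<le>n. if i = N * (n div N) then fps_nth x i * fps_nth y (n - i) else 0)"
    by (intro cg_sum) simp
  also have "(\<Sum>i\<le>n. if i = N * (n div N) then fps_nth x i * fps_nth y (n - i) else 0)
      = fps_nth x (N * (n div N)) * fps_nth y (n mod N)"
    by (simp add: sum.delta' minus_mult_div_eq_mod)
  finally show ?thesis by (simp add: fps_nth_mult_sum)
qed

section \<open>Cyclotomic factors of the q-integers\<close>

text \<open>The cyclotomic polynomial of order \<open>p^(j + 1)\<close>, evaluated at
  \<open>q = 1 + fps_X\<close>; note the shift between \<open>j\<close> and the exponent of the
  order.\<close>

definition cyc :: "nat \<Rightarrow> 'p :: prime_card R"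
  where "cyc j = (\<Sum>i<CARD('p). ((1 + fps_X) ^ (CARD('p) ^ j)) ^ i)"

lemma cyc_mult:
  "((1 + fps_X) ^ (CARD('p) ^ j) - 1) * cyc j = (1 + fps_X :: 'p :: prime_card R) ^ (CARD('p) ^ Suc j) - 1"
proof -
  have "(1 + fps_X :: 'p R) ^ (CARD('p) ^ Suc j) = ((1 + fps_X) ^ (CARD('p) ^ j)) ^ CARD('p)"
    by (simp only: power_Suc2 power_mult)
  then show ?thesis
    unfolding cyc_def using power_diff_1_eq[of "(1 + fps_X :: 'p R) ^ (CARD('p) ^ j)" "CARD('p)"]
    by (simp only:)
qed

lemma freshman_dream:
  assumes "prime p"
  shows "cg (of_nat p) ((a + b) ^ p) (a ^ p + b ^ p :: 'a :: comm_ring_1)"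
proof -
  have p: "p > 0" using assms by (simp add: prime_gt_0_nat)
  have "(of_nat p :: 'a) dvd of_nat (p choose k) * a ^ k * b ^ (p - k)" if "k \<in> {1..<p}" for k
  proof -
    have "p dvd p choose k" using that assms by (intro dvd_choose_prime) auto
    then obtain c where "p choose k = p * c" by (rule dvdE)
    then show ?thesis by (simp add: mult.assoc)
  qed
  then have "of_nat p dvd (\<Sum>k\<in>{1..<p}. of_nat (p choose k) * a ^ k * b ^ (p - k))" by (rule dvd_sum)
  moreover have "{..p} = insert 0 (insert p {1..<p})" using p by auto
  ultimately show ?thesis using p by (simp add: binomial_ring cg_def add.commute)
qed

lemma one_plus_X_power_CARD_power:
  "cg (of_nat CARD('p)) ((1 + fps_X :: 'p :: prime_card R) ^ (CARD('p) ^ j)) (1 + fps_X ^ (CARD('p) ^ j))"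
proof (induction j)
  case (Suc j)
  have "(1 + fps_X :: 'p R) ^ (CARD('p) ^ Suc j) = ((1 + fps_X) ^ (CARD('p) ^ j)) ^ CARD('p)"
    by (simp only: power_Suc2 power_mult)
  also have "cg (of_nat CARD('p)) \<dots> ((1 + fps_X ^ (CARD('p) ^ j)) ^ CARD('p))"
    by (rule cg_power[OF Suc])
  also have "cg (of_nat CARD('p)) ((1 + fps_X ^ (CARD('p) ^ j)) ^ CARD('p))
      (1 ^ CARD('p) + (fps_X ^ (CARD('p) ^ j) :: 'p R) ^ CARD('p))"
    by (rule freshman_dream[OF prime_card])
  also have "1 ^ CARD('p) + (fps_X ^ (CARD('p) ^ j) :: 'p R) ^ CARD('p) = 1 + fps_X ^ (CARD('p) ^ Suc j)"
    by (simp only: power_Suc2 power_mult power_one)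
  finally show ?case .
qed simp

lemma fps_X_power_cancel_dvd:
  assumes "of_nat m dvd fps_X ^ k * (x :: 'a :: comm_ring_1 fps)"
  shows "of_nat m dvd x"
proof -
  have "fps_const (of_nat m) dvd fps_X ^ k * x" using assms by (simp only: fps_of_nat)
  then have "of_nat m dvd fps_nth (fps_X ^ k * x) (n + k)" for n by (simp only: fps_const_dvd_iff)
  then have "of_nat m dvd fps_nth x n" for n by (simp add: fps_X_power_mult_nth)
  then have "fps_const (of_nat m) dvd x" by (simp only: fps_const_dvd_iff) simp
  then show ?thesis by (simp only: fps_of_nat)
qed

text \<open>\<open>cyc j\<close> divides \<open>q^(p^(j + 1)) - 1\<close>, which modulo
  \<open>p\<close> is a power of \<open>fps_X\<close>. Hence \<open>p\<close> can divide
  \<open>cyc j * x\<close> only if it divides \<open>x\<close>.\<close>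

lemma cyc_cancel_p:
  assumes "cg (cyc j) (of_nat CARD('p) * y) 0"
  shows "cg (cyc j) y (0 :: 'p :: prime_card R)"
proof -
  let ?p = "of_nat CARD('p) :: 'p R" and ?Q = "(1 + fps_X :: 'p R) ^ (CARD('p) ^ Suc j)"
  have p0: "?p \<noteq> 0" using CARD_prime_neq_0[where 'p = 'p] by (simp only: of_nat_eq_0_iff not_False_eq_True)
  obtain x where x: "?p * y = cyc j * x" using assms by (auto simp: cg_0_iff elim: dvdE)
  have "(?Q - 1) * x = ((1 + fps_X) ^ (CARD('p) ^ j) - 1) * (?p * y)"
    unfolding x cyc_mult[symmetric] by (simp only: mult.assoc)
  then have "?p dvd (?Q - 1) * x" by (simp only: dvd_mult dvd_triv_left)
  moreover have "cg ?p ((?Q - 1) * x) ((1 + fps_X ^ (CARD('p) ^ Suc j) - 1) * x)"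
    by (intro cg_mult cg_diff one_plus_X_power_CARD_power cg_refl)
  ultimately have "cg ?p ((1 + fps_X ^ (CARD('p) ^ Suc j) - 1) * x) 0"
    using cg_trans[OF cg_sym] by (simp only: cg_0_iff[symmetric])
  then have "?p dvd fps_X ^ (CARD('p) ^ Suc j) * x"
    by (simp only: cg_0_iff add_diff_cancel_left')
  then have "?p dvd x" by (rule fps_X_power_cancel_dvd)
  then obtain z where "x = ?p * z" by (rule dvdE)
  then have "?p * y = ?p * (cyc j * z)" using x by (simp only: mult_ac)
  then have "y = cyc j * z" using p0 by (simp only: mult_cancel_left) simp
  then show ?thesis by (simp add: cg_0_iff)
qed

lemma dvd_power_diff_1: "(a :: 'a :: comm_ring_1) - 1 dvd a ^ n - 1"
  using power_diff_1_eq[of a n] by simp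

text \<open>\<open>q^n - 1\<close> is \<open>q^(p^i) - 1\<close> times a series with constant term
  \<open>u\<close>, and \<open>u\<close> is a p-adic unit.\<close>

lemma q_power_minus_1_dvd_power:
  assumes "n = CARD('p) ^ i * u" "\<not> CARD('p) dvd u" "i \<le> j"
  shows "(1 + fps_X :: 'p :: prime_card R) ^ n - 1 dvd (1 + fps_X) ^ (CARD('p) ^ j) - 1"
proof -
  let ?z = "(1 + fps_X :: 'p R) ^ (CARD('p) ^ i)"
  define e where "e = (\<Sum>k<u. ?z ^ k)"
  have "fps_nth e 0 = of_nat u" by (simp add: e_def fps_sum_nth fps_nth_power_0)
  then have "e dvd 1" using of_nat_padic_int_unit[OF assms(2)] by (simp add: fps_dvd_1_iff)
  then obtain e' where e': "1 = e * e'" by (rule dvdE)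
  have "(1 + fps_X :: 'p R) ^ n - 1 = (?z - 1) * e"
    using power_diff_1_eq[of ?z u] by (simp add: assms(1) e_def power_mult)
  then have "((1 + fps_X :: 'p R) ^ n - 1) * e' = (?z - 1) * (e * e')" by (simp only: mult.assoc)
  then have "?z - 1 = ((1 + fps_X :: 'p R) ^ n - 1) * e'" by (simp flip: e')
  then have "(1 + fps_X :: 'p R) ^ n - 1 dvd ?z - 1" by (rule dvdI)
  also have "?z - 1 dvd ?z ^ (CARD('p) ^ (j - i)) - 1" by (rule dvd_power_diff_1)
  also have "?z ^ (CARD('p) ^ (j - i)) = (1 + fps_X) ^ (CARD('p) ^ j)"
    using assms(3) by (simp only: power_mult[symmetric] power_add[symmetric] le_add_diff_inverse)
  finally show ?thesis .
qed

lemma prime_power_decomp: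
  assumes "n > 0"
  obtains i u where "n = CARD('p :: prime_card) ^ i * u" "\<not> CARD('p) dvd u"
proof -
  have "\<not> is_unit CARD('p)" using prime_card[where 'a = 'p] not_prime_unit by blast
  then obtain u where "n = CARD('p) ^ multiplicity CARD('p) n * u" "\<not> CARD('p) dvd u"
    using multiplicity_decompose'[of n "CARD('p)"] assms by blast
  then show ?thesis by (rule that)
qed

text \<open>Under the hypothesis on \<open>n\<close>, \<open>q^n - 1\<close> divides
  \<open>q^(p^j) - 1\<close>, modulo which \<open>cyc j\<close> equals \<open>p\<close>. So
  \<open>p\<close> lies in the ideal generated by \<open>cyc j\<close> and \<open>q^n - 1\<close>,
  and it remains to cancel \<open>p\<close>.\<close>

lemma cyc_cancel:
  assumes "cg (cyc j) (((1 + fps_X) ^ n - 1) * y) 0" and n: "\<not> CARD('p) ^ Suc j dvd n"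
  shows "cg (cyc j) y (0 :: 'p :: prime_card R)"
proof -
  let ?z = "(1 + fps_X :: 'p R) ^ (CARD('p) ^ j)"
  have "n > 0" using n by (cases n) auto
  then obtain i u where iu: "n = CARD('p) ^ i * u" "\<not> CARD('p) dvd u" using prime_power_decomp[where 'p = 'p] by blast
  have "i \<le> j"
  proof (rule ccontr)
    assume "\<not> i \<le> j"
    then have "CARD('p) ^ Suc j dvd CARD('p) ^ i" by (intro le_imp_power_dvd) simp
    then show False using n iu(1) by (metis dvd_mult2)
  qed
  have "?z - 1 dvd (\<Sum>i<CARD('p). ?z ^ i - 1)" by (intro dvd_sum dvd_power_diff_1)
  then have "?z - 1 dvd cyc j - of_nat CARD('p)" by (simp add: cyc_def sum_subtractf)
  with q_power_minus_1_dvd_power[OF iu \<open>i \<le> j\<close>]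
  obtain w where w: "cyc j - of_nat CARD('p) = ((1 + fps_X :: 'p R) ^ n - 1) * w"
    using dvd_trans unfolding dvd_def by blast
  have "of_nat CARD('p) * y = cyc j * y - (cyc j - of_nat CARD('p)) * y" by (simp add: algebra_simps)
  also have "\<dots> = cyc j * y - w * (((1 + fps_X) ^ n - 1) * y)" unfolding w by (simp only: mult_ac)
  finally have eq: "of_nat CARD('p) * y = cyc j * y - w * (((1 + fps_X) ^ n - 1) * y)" .
  have "cyc j dvd of_nat CARD('p) * y" unfolding eq using assms(1) unfolding cg_0_iff
    by (intro dvd_diff[OF dvd_triv_left] dvd_mult[of _ "((1 + fps_X) ^ n - 1) * y"])
  then show ?thesis using cyc_cancel_p unfolding cg_0_iff by blast
qed

lemma cg_cyc_q_power: "cg (cyc j) ((1 + fps_X) ^ (CARD('p) ^ Suc j)) (1 :: 'p :: prime_card R)"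
  unfolding cg_def cyc_mult[symmetric] by simp

lemma cg_unit_cancel:
  assumes "cg m (u * y) 0" "u dvd 1"
  shows "cg m y 0"
proof -
  obtain v where v: "1 = u * v" using assms(2) by (rule dvdE)
  have "m dvd v * (u * y)" using assms(1) by (simp add: cg_0_iff)
  moreover have "v * (u * y) = (u * v) * y" by (simp only: mult_ac)
  ultimately show ?thesis by (simp add: cg_0_iff flip: v)
qed

lemma phi_R_cyc: "phi_R (cyc j) = (cyc (Suc j) :: 'p :: prime_card R)"
proof -
  have "((1 + fps_X :: 'p R) ^ CARD('p)) ^ (CARD('p) ^ j) = (1 + fps_X) ^ (CARD('p) ^ Suc j)"
    by (simp only: power_Suc power_mult)
  then show ?thesis
    by (simp only: cyc_def phi_R.hom_sum phi_R.hom_power phi_R_q)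
qed

text \<open>
  \<open>[p^k]_q\<close> is the product of \<open>cyc 0, \<dots>, cyc (k - 1)\<close>. These can be divided out one at a time, because
  \<open>q^(p^i) - 1\<close> is not a zero divisor modulo \<open>cyc i\<close>.
\<close>

lemma qnat_dvd:
  fixes x :: "'p :: prime_card R"
  assumes "n > 0" and cyc: "\<And>j. CARD('p) ^ Suc j dvd n \<Longrightarrow> cyc j dvd x"
  shows "qnat n dvd x"
proof -
  let ?P = "CARD('p)"
  obtain k u where ku: "n = ?P ^ k * u" "\<not> ?P dvd u"
    using prime_power_decomp[OF assms(1), where 'p = 'p] by blast
  have "qnat (?P ^ i) dvd x" if "i \<le> k" for i
    using that
  proof (induction i)
    case (Suc i)
    then obtain y where y: "x = qnat (?P ^ i) * y" by (auto elim: dvdE)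
    have "?P ^ Suc i dvd n" using Suc.prems ku(1) by (metis dvd_mult2 le_imp_power_dvd)
    then have "cyc i dvd fps_X * x" using cyc by simp
    then have "cg (cyc i) (((1 + fps_X) ^ (?P ^ i) - 1) * y) 0"
      unfolding y cg_0_iff X_qnat[symmetric] by (simp only: mult.assoc)
    moreover have "\<not> ?P ^ Suc i dvd ?P ^ i"
      using CARD_gt_1[where 'p = 'p] by (metis Suc_n_not_le_n power_dvd_imp_le)
    ultimately have "cyc i dvd y" unfolding cg_0_iff[symmetric] by (rule cyc_cancel)
    then obtain z where z: "y = cyc i * z" by (rule dvdE)
    have "fps_X * (qnat (?P ^ i) * cyc i) = fps_X * (qnat (?P ^ Suc i) :: 'p R)"
      unfolding X_qnat cyc_mult[symmetric] mult.assoc[symmetric] ..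
    then have "qnat (?P ^ Suc i) = qnat (?P ^ i) * (cyc i :: 'p R)" by simp
    then show ?case unfolding y z by (simp add: mult.assoc)
  qed (simp add: qnat_def)
  then have "qnat (?P ^ k) dvd x" by simp
  moreover have "qnat n dvd (qnat (?P ^ k) :: 'p R)"
  proof -
    obtain w where "(1 + fps_X :: 'p R) ^ (?P ^ k) - 1 = ((1 + fps_X) ^ n - 1) * w"
      using q_power_minus_1_dvd_power[OF ku order_refl] by (auto elim: dvdE)
    then have "fps_X * (qnat n * w) = fps_X * (qnat (?P ^ k) :: 'p R)"
      unfolding X_qnat mult.assoc[symmetric] ..
    then have "qnat (?P ^ k) = (qnat n * w :: 'p R)" by simp
    then show ?thesis by (rule dvdI)
  qed
  ultimately show ?thesis by (rule dvd_trans[rotated])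
qed

section \<open>The partial sums of the q-Wronskian\<close>

lemma rhom_fps_scale: "rhom (fps_scale t)"
proof
  show "fps_scale t (x + y) = fps_scale t x + fps_scale t y" for x y
    by (simp add: fps_eq_iff distrib_left)
  show "fps_scale t 1 = 1" by (auto simp: fps_eq_iff)
qed (rule fps_scale_mult)

global_interpretation fps_scale: rhom "fps_scale t" for t
  by (rule rhom_fps_scale)

lemma fps_scale_const [simp]: "fps_scale t (fps_const c) = fps_const c"
  by (auto simp: fps_eq_iff)

lemma fps_scale_X [simp]: "fps_scale t fps_X = fps_const t * fps_X"
  by (auto simp: fps_eq_iff fps_X_def)

lemma fps_scale_scale: "fps_scale s (fps_scale t x) = fps_scale (s * t) x"
  by (simp add: fps_eq_iff power_mult_distrib mult_ac)

lemma fps_scale_1 [simp]: "fps_scale 1 x = x"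
  by (simp add: fps_eq_iff)

definition gq :: "'p :: prime_card R'"
  where "gq = exquo 1 ((1 - fps_X) * fq * gamma_R' fq)"

text \<open>The recursion in \<open>k\<close> obtained from \<open>fq_equation\<close> at
  \<open>q^k \<lambda>\<close>, rescaled by the leading coefficients collected in
  \<open>Dq k\<close>; the rescaling is what squares the last coefficient. The initial values select
  the second solution, the one that vanishes at \<open>k = 0\<close>.\<close>

fun Bq :: "nat \<Rightarrow> 'p :: prime_card R'" where
  "Bq 0 = 0"
| "Bq (Suc 0) = 1"
| "Bq (Suc (Suc k)) = 2 * (1 - fps_const (sqrt_q * (1 + fps_X) ^ k) * fps_X) * Bq (Suc k)
    - (1 - fps_const ((1 + fps_X) ^ k) * fps_X) ^ 2 * Bq k"

definition Dq :: "nat \<Rightarrow> 'p :: prime_card R'"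
  where "Dq k = (\<Prod>i<k. 1 - fps_const ((1 + fps_X) ^ i) * fps_X)"

definition Sq :: "nat \<Rightarrow> 'p :: prime_card R'"
  where "Sq k = (\<Sum>i<k. fps_scale ((1 + fps_X) ^ i) gq)"

lemma fps_linear_mult_nth_Suc:
  "fps_nth ((1 - fps_const (c :: 'a :: comm_ring_1) * fps_X) * x) (Suc n) = fps_nth x (Suc n) - c * fps_nth x n"
  by (simp add: left_diff_distrib mult.assoc)

lemma fps_linear_mult_degree:
  assumes "\<And>n. n \<ge> k \<Longrightarrow> fps_nth x n = 0" "n \<ge> Suc k"
  shows "fps_nth ((1 - fps_const (c :: 'a :: comm_ring_1) * fps_X) * x) n = 0"
  using assms by (cases n) (simp_all only: fps_linear_mult_nth_Suc, simp_all)

lemma Bq_degree: "n \<ge> k \<Longrightarrow> fps_nth (Bq k :: 'p :: prime_card R') n = 0"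
proof (induction k arbitrary: n rule: Bq.induct)
  case (3 k)
  define l m where "l = (1 - fps_const (sqrt_q * (1 + fps_X) ^ k) * fps_X :: 'p R')"
    and "m = (1 - fps_const ((1 + fps_X) ^ k) * fps_X :: 'p R')"
  have "fps_nth (l * Bq (Suc k)) n = 0"
    unfolding l_def by (rule fps_linear_mult_degree[of "Suc k"]) (use 3 in auto)
  moreover have "fps_nth (m * Bq k) n = 0" if "n \<ge> Suc k" for n
    unfolding m_def by (rule fps_linear_mult_degree[of k]) (use 3 that in auto)
  then have "fps_nth (m * (m * Bq k)) n = 0"
    unfolding m_def by (rule fps_linear_mult_degree[of "Suc k"]) (use 3 in auto)
  ultimately show ?case
    unfolding Bq.simps l_def[symmetric] m_def[symmetric]
    by (simp add: fps_numeral_fps_const power2_eq_square mult.assoc)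
qed auto

lemma Bq_nth_0: "fps_nth (Bq k) 0 = of_nat k"
  by (induction k rule: Bq.induct) (simp_all add: fps_numeral_fps_const fps_nth_power_0 distrib_left)

lemma Dq_degree: "n > k \<Longrightarrow> fps_nth (Dq k :: 'p :: prime_card R') n = 0"
proof (induction k arbitrary: n)
  case (Suc k)
  have "fps_nth ((1 - fps_const ((1 + fps_X) ^ k) * fps_X) * (Dq k :: 'p R')) n = 0"
    by (rule fps_linear_mult_degree[of "Suc k"]) (use Suc in auto)
  then show ?case by (simp add: Dq_def mult.commute)
qed (simp add: Dq_def)

lemma Dq_nth_0: "fps_nth (Dq k) 0 = 1"
  by (induction k) (simp_all add: Dq_def)

context
  assumes odd_p: "odd CARD('p :: prime_card)"
begin

lemma gq_mult: "(1 - fps_X) * fq * gamma_R' fq * gq = (1 :: 'p R')"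
  unfolding gq_def
  by (rule mult_exquo_unit) (simp add: fps_dvd_1_iff gamma_R'_nth qcoef_0[OF odd_p])

lemma fps_scale_fq_neq_0: "fps_scale t fq \<noteq> (0 :: 'p R')"
proof -
  have "fps_nth (fps_scale t (fq :: 'p R')) 0 \<noteq> 0" by (simp add: qcoef_0[OF odd_p])
  then show ?thesis by (metis fps_zero_nth)
qed

text \<open>Reduction of order: both sides satisfy the recursion of \<open>Bq\<close>. Below,
  \<open>G i\<close> is the translation \<open>\<lambda> \<mapsto> q^i \<lambda>\<close>, and
  \<open>a\<close>, \<open>b\<close>, \<open>c\<close> are the coefficients of
  \<open>fq_equation\<close> translated by \<open>G k\<close>.\<close>

lemma Bq_eq: "Bq k = Dq k * fq * fps_scale ((1 + fps_X) ^ k) fq * (Sq k :: 'p R')"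
proof (induction k rule: Bq.induct)
  case 2
  show ?case using gq_mult by (simp add: Dq_def Sq_def gamma_R'_eq_scale mult_ac)
next
  case (3 k)
  define Q where "Q = (1 + fps_X :: 'p R)"
  define G where "G i = fps_scale (Q ^ i)" for i
  define D S a b c where "D = (Dq k :: 'p R')" and "S = (Sq k :: 'p R')"
    and "a = 1 - fps_const (Q ^ k) * fps_X" and "b = 1 - fps_const (Q ^ Suc k) * fps_X"
    and "c = 1 - fps_const (sqrt_q * Q ^ k) * fps_X"
  have G_gamma: "G i (gamma_R' x) = G (Suc i) x" for i x
    by (simp add: G_def gamma_R'_eq_scale fps_scale_scale Q_def mult.commute)
  have G_lin: "G k (1 - fps_const t * fps_X) = 1 - fps_const (t * Q ^ k) * fps_X" for t
    by (simp add: G_def fps_scale.hom_simps flip: mult.assoc)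
  have G_lin1: "G k (1 - fps_X) = a"
    using G_lin[of 1] by (simp add: a_def)
  have G2: "G k 2 = 2" by (simp only: G_def fps_scale.hom_numeral)
  note G_hom = fps_scale.hom_add[of "Q ^ k", folded G_def] fps_scale.hom_diff[of "Q ^ k", folded G_def]
    fps_scale.hom_mult[of "Q ^ k", folded G_def] fps_scale.hom_zero[of "Q ^ k", folded G_def]
    fps_scale.hom_one[of "Q ^ k", folded G_def]
  define l1 l2 l3 where "l1 = (1 - fps_const Q * fps_X)" and "l2 = (1 - fps_const sqrt_q * fps_X :: 'p R')"
    and "l3 = (1 - fps_X :: 'p R')"
  have G_l: "G k l1 = b" "G k l2 = c" "G k l3 = a"
    by (simp_all only: l1_def l2_def l3_def G_lin G_lin1 b_def c_def power_Suc)
  have "l1 * gamma_R' (gamma_R' fq) - 2 * l2 * gamma_R' fq + l3 * fq = 0"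
    unfolding l1_def l2_def l3_def Q_def by (rule fq_equation[OF odd_p])
  from arg_cong[OF this, of "G k"]
  have "b * G (Suc (Suc k)) fq - 2 * c * G (Suc k) fq + a * G k fq = 0"
    by (simp only: G_hom G_gamma G_l G2)
  then have E: "b * G (Suc (Suc k)) fq = 2 * c * G (Suc k) fq - a * G k fq" by (simp add: algebra_simps)
  have g0: "a * G k fq * G (Suc k) fq * G k gq = 1"
    using arg_cong[OF gq_mult[folded l3_def], of "G k"] by (simp only: G_hom G_gamma G_l)
  have GS: "G (Suc k) x = G 1 (G k x)" for x by (simp add: G_def fps_scale_scale)
  have "G 1 a = b" by (simp add: G_def a_def b_def fps_scale.hom_simps mult_ac)
  then have g1: "b * G (Suc k) fq * G (Suc (Suc k)) fq * G (Suc k) gq = 1"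
    using arg_cong[OF g0, of "G 1"]
    by (simp only: fps_scale.hom_mult[of "Q ^ 1", folded G_def] fps_scale.hom_one[of "Q ^ 1", folded G_def])
      (simp add: G_def fps_scale_scale)
  have D1: "Dq (Suc k) = D * a" "Dq (Suc (Suc k)) = D * a * b"
    by (simp_all add: Dq_def D_def a_def b_def Q_def)
  have S1: "Sq (Suc k) = S + G k gq" "Sq (Suc (Suc k)) = S + G k gq + G (Suc k) gq"
    by (simp_all add: Sq_def S_def G_def Q_def)
  have IH1: "Bq (Suc k) = D * a * fq * G (Suc k) fq * (S + G k gq)"
    and IH0: "Bq k = D * fq * G k fq * S"
    using 3 by (simp_all only: D1 S1 G_def Q_def D_def S_def)
  \<comment> \<open>The defining equation of \<open>gq\<close> translated by \<open>G k\<close> and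
    by \<open>G (Suc k)\<close>, with the common factor \<open>G (Suc k) fq\<close> cancelled. It
    makes the two new terms of the sum fit the recursion.\<close>
  have Z: "b * G (Suc (Suc k)) fq * G (Suc k) gq = a * G k fq * G k gq"
  proof -
    have "G (Suc k) fq * (b * G (Suc (Suc k)) fq * G (Suc k) gq) = G (Suc k) fq * (a * G k fq * G k gq)"
      using g0 g1 by (simp only: mult_ac)
    then show ?thesis using fps_scale_fq_neq_0[of "Q ^ Suc k"] by (simp only: mult_cancel_left G_def) simp
  qed
  have "D * a * b * fq * G (Suc (Suc k)) fq * (S + G k gq + G (Suc k) gq)
      = D * a * fq * ((b * G (Suc (Suc k)) fq) * (S + G k gq) + b * G (Suc (Suc k)) fq * G (Suc k) gq)"
    by (simp only: distrib_left distrib_right mult_ac)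
  also have "\<dots> = D * a * fq * ((2 * c * G (Suc k) fq - a * G k fq) * (S + G k gq) + a * G k fq * G k gq)"
    unfolding Z unfolding E ..
  also have "\<dots> = 2 * c * (D * a * fq * G (Suc k) fq * (S + G k gq)) - a ^ 2 * (D * fq * G k fq * S)"
    by (simp add: algebra_simps power2_eq_square)
  finally show ?case
    unfolding Bq.simps IH0 IH1 D1 S1 by (simp only: G_def Q_def a_def c_def)
qed (simp add: Sq_def)

end

section \<open>The q-Dwork congruence\<close>

context
  fixes j N d :: nat and P :: "'p :: prime_card R"
  assumes odd_p: "odd CARD('p)" and N: "N = CARD('p) ^ Suc j" and Nd: "N = 2 * d + 1" and P: "P = cyc j"
begin

section \<open>A q-Lucas theorem modulo \<open>cyc j\<close>\<close>

lemma N_pos: "N > 0" using Nd by simp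

lemma cancel_q: "cg P (((1 + fps_X) ^ n - 1) * y) 0 \<Longrightarrow> \<not> N dvd n \<Longrightarrow> cg P y 0"
  unfolding P N by (rule cyc_cancel)

lemma qN: "cg P ((1 + fps_X) ^ N) 1"
  unfolding P N by (rule cg_cyc_q_power)

lemma q_power_mod: "cg P ((1 + fps_X) ^ (N * m + r)) ((1 + fps_X) ^ r)"
  using cg_mult[OF cg_power[OF qN, of m] cg_refl, of "(1 + fps_X) ^ r"]
  by (simp only: power_add power_mult power_one mult_1_left)

text \<open>\<open>sqrt_q ^ N\<close> is a square root of 1 modulo \<open>P\<close>; the sign is
  decided by \<open>sqrt_q ^ N + 1\<close> having constant term 2, a unit.\<close>

lemma sN: "cg P (sqrt_q ^ N) 1"
proof -
  have "(1 + fps_X :: 'p R) ^ N = sqrt_q ^ N * sqrt_q ^ N"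
    by (simp only: sqrt_q_square[OF odd_p, symmetric] power_mult_distrib)
  then have "(sqrt_q ^ N + 1) * (sqrt_q ^ N - 1) = (1 + fps_X :: 'p R) ^ N - 1"
    by (simp add: algebra_simps)
  then have "cg P ((sqrt_q ^ N + 1) * (sqrt_q ^ N - 1)) 0" using qN by (simp add: cg_def)
  moreover have "(sqrt_q ^ N + 1 :: 'p R) dvd 1"
    by (simp add: fps_dvd_1_iff fps_nth_power_0 sqrt_q_nth_0[OF odd_p] two_unit[OF odd_p])
  ultimately show ?thesis using cg_unit_cancel cg_iff_diff by blast
qed

lemma s_q_power: "sqrt_q * (1 + fps_X) ^ k = (sqrt_q ^ (2 * k + 1) :: 'p R)"
proof -
  have "sqrt_q ^ (2 * k + 1) = (sqrt_q ^ 2) ^ k * (sqrt_q :: 'p R)"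
    by (simp only: power_add power_mult power_one_right)
  then show ?thesis unfolding power2_eq_square sqrt_q_square[OF odd_p] by (simp only: mult.commute)
qed

lemma cancel_c:
  assumes "cg P (((1 + fps_X) ^ Suc r - 1) * x) (((1 + fps_X) ^ Suc r - 1) * y)" "\<not> N dvd Suc r"
  shows "cg P x y"
proof -
  have "((1 + fps_X) ^ Suc r - 1) * x - ((1 + fps_X) ^ Suc r - 1) * y = ((1 + fps_X) ^ Suc r - 1) * (x - y)"
    by (rule right_diff_distrib[symmetric])
  then have "cg P (((1 + fps_X) ^ Suc r - 1) * (x - y)) 0"
    using assms(1) by (simp only: cg_def diff_0_right)
  then show ?thesis using cancel_q[OF _ assms(2)] cg_iff_diff by blast
qed

text \<open>Since \<open>q^N = 1\<close> modulo \<open>P\<close>, both sides obey the same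
  first-order recursion in \<open>r\<close>, and its leading factor \<open>q^(r + 1) - 1\<close> can
  be cancelled as long as \<open>r + 1 < N\<close>.\<close>

lemma qcoef_Lucas: "r < N \<Longrightarrow> cg P (qcoef (N * m + r)) (qcoef r * qcoef (N * m))"
proof (induction r)
  case 0
  show ?case by (simp add: qcoef_0[OF odd_p])
next
  case (Suc r)
  have "cg P (((1 + fps_X) ^ Suc r - 1) * qcoef (N * m + Suc r)) (((1 + fps_X) ^ (N * m + Suc r) - 1) * qcoef (N * m + Suc r))"
    by (intro cg_mult cg_diff cg_refl cg_sym[OF q_power_mod])
  also have "((1 + fps_X) ^ (N * m + Suc r) - 1) * qcoef (N * m + Suc r)
      = (sqrt_q * (1 + fps_X) ^ (N * m + r) - 1) * (qcoef (N * m + r) :: 'p R)"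
    using qcoef_Suc[OF odd_p, of "N * m + r"] by (simp only: add_Suc_right)
  also have "cg P \<dots> ((sqrt_q * (1 + fps_X) ^ r - 1) * (qcoef r * qcoef (N * m)))"
    using Suc by (intro cg_mult cg_diff cg_refl q_power_mod) simp_all
  also have "(sqrt_q * (1 + fps_X) ^ r - 1) * (qcoef r * qcoef (N * m))
      = ((1 + fps_X) ^ Suc r - 1) * (qcoef (Suc r) * qcoef (N * m) :: 'p R)"
    unfolding mult.assoc[symmetric] qcoef_Suc[OF odd_p] ..
  finally show ?case by (rule cancel_c) (use Suc.prems in \<open>auto dest: dvd_imp_le\<close>)
qed

text \<open>At \<open>r = d\<close> the numerator of the recursion is
  \<open>sqrt_q ^ (2 d + 1) - 1 = sqrt_q ^ N - 1\<close>, which is 0 modulo \<open>P\<close>. The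
  zero then propagates as far as index \<open>N - 1\<close>.\<close>

lemma qcoef_vanish: "d < r \<Longrightarrow> r < N \<Longrightarrow> cg P (qcoef r) 0"
proof (induction r)
  case (Suc r)
  have "cg P ((sqrt_q * (1 + fps_X) ^ r - 1) * qcoef r) 0"
  proof (cases "r = d")
    case True
    then have "cg P (sqrt_q * (1 + fps_X) ^ r) 1" using sN unfolding s_q_power Nd by simp
    then have "cg P ((sqrt_q * (1 + fps_X) ^ r - 1) * qcoef r) ((1 - 1) * qcoef r)"
      by (intro cg_mult cg_diff cg_refl)
    then show ?thesis by simp
  next
    case False
    then show ?thesis using Suc by (simp add: cg_0_iff)
  qed
  then have "cg P (((1 + fps_X) ^ Suc r - 1) * qcoef (Suc r)) 0"
    by (simp only: qcoef_Suc[OF odd_p])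
  then show ?case by (rule cancel_q) (use Suc.prems in \<open>auto dest: dvd_imp_le\<close>)
qed simp

text \<open>Before index \<open>d\<close> the numerators \<open>sqrt_q ^ (2 r + 1) - 1\<close>
  divide \<open>q^(2 r + 1) - 1\<close> with \<open>2 r + 1 < N\<close>, which is not a zero divisor
  modulo \<open>P\<close>.\<close>

lemma qcoef_cancel: "r \<le> d \<Longrightarrow> cg P (qcoef r * y) 0 \<Longrightarrow> cg P y 0"
proof (induction r)
  case (Suc r)
  let ?t = "sqrt_q ^ (2 * r + 1) :: 'p R"
  have "cg P (((1 + fps_X) ^ Suc r - 1) * (qcoef (Suc r) * y)) 0"
    using Suc.prems(2) by (simp only: cg_0_iff dvd_mult)
  then have "cg P ((?t - 1) * (qcoef r * y)) 0"
    unfolding mult.assoc[symmetric] qcoef_Suc[OF odd_p] s_q_power .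
  then have "cg P ((?t + 1) * ((?t - 1) * (qcoef r * y))) 0" by (simp only: cg_0_iff dvd_mult)
  moreover have "(?t + 1) * ((?t - 1) * z) = ((1 + fps_X) ^ (2 * r + 1) - 1) * z" for z
  proof -
    have "(?t + 1) * ((?t - 1) * z) = (?t * ?t - 1) * z" by (simp add: algebra_simps)
    then show ?thesis by (simp only: sqrt_q_square[OF odd_p, symmetric] power_mult_distrib)
  qed
  ultimately have "cg P (((1 + fps_X) ^ (2 * r + 1) - 1) * (qcoef r * y)) 0" by (simp only:)
  then have "cg P (qcoef r * y) 0"
    by (rule cancel_q) (use Suc.prems Nd in \<open>auto dest: dvd_imp_le\<close>)
  then show ?case using Suc by simp
qed (simp add: qcoef_0[OF odd_p])

text \<open>In \<open>qcoef_sum\<close> at index \<open>N m\<close> all terms of index prime to the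
  step \<open>N\<close>, that is not divisible by it, vanish modulo \<open>P\<close>, and the
  remaining powers of \<open>sqrt_q\<close> become 1. This leaves the same convolution identity as
  at \<open>q = 1\<close>, which determines the sequence because 2 is invertible.\<close>

lemma qcoef_section: "cg P (qcoef (N * m)) (fps_const (fps_nth (qcoef m) 0))"
proof (induction m rule: less_induct)
  case (less m)
  define x where "x i = (fps_const (fps_nth (qcoef i) 0) :: 'p R)" for i
  show ?case
  proof (cases "m = 0")
    case False
    define A where "A = {1..<m}"
    have split: "{..m} = insert 0 (insert m A)" "finite A" "0 \<notin> insert m A" "m \<notin> A"
      using False by (auto simp: A_def)
    have x1: "(\<Sum>i\<le>m. x i * x (m - i)) = 1"
      using arg_cong[OF qcoef_sum[OF odd_p, of m], of "\<lambda>y. fps_const (fps_nth y 0)"]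
      by (simp add: fps_sum_nth fps_nth_power_0 sqrt_q_nth_0[OF odd_p] x_def rhom.hom_sum[OF rhom_fps_const])
    have "cg P (\<Sum>k\<le>N * m. sqrt_q ^ (N * m - k) * qcoef k * qcoef (N * m - k))
        (\<Sum>i\<le>m. sqrt_q ^ (N * m - N * i) * qcoef (N * i) * qcoef (N * m - N * i))"
    proof (rule cg_sum_multiples[OF _ N_pos])
      fix k
      assume k: "k \<le> N * m" "\<not> N dvd k"
      define i r where "i = k div N" and "r = k mod N"
      have kir: "k = N * i + r" by (simp add: i_def r_def)
      have r: "0 < r" "r < N" using k(2) N_pos by (auto simp: r_def dvd_eq_mod_eq_0)
      have "i < m"
      proof (rule ccontr)
        assume "\<not> i < m"
        then have "N * m \<le> N * i" by simp
        then show False using k(1) kir r by linarith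
      qed
      then obtain i' where i': "m = i + Suc i'" using less_imp_Suc_add by auto
      have k': "N * m - k = N * i' + (N - r)" using r by (simp add: kir i' algebra_simps)
      \<comment> \<open>The indices have residues \<open>r\<close> and \<open>N - r\<close>, with
        sum \<open>2 d + 1\<close>, so one of them exceeds \<open>d\<close> and
        \<open>qcoef_vanish\<close> applies.\<close>
      have "cg P (qcoef k * qcoef (N * m - k)) 0"
      proof (cases "d < r")
        case True
        have "cg P (qcoef k) (qcoef r * qcoef (N * i))" unfolding kir by (rule qcoef_Lucas[OF r(2)])
        also have "cg P \<dots> 0" using qcoef_vanish[OF True r(2)] by (simp add: cg_0_iff)
        finally show ?thesis by (simp add: cg_0_iff)
      next
        case False
        then have r': "d < N - r" "N - r < N" using r Nd by auto
        have "cg P (qcoef (N * m - k)) (qcoef (N - r) * qcoef (N * i'))" unfolding k' by (rule qcoef_Lucas[OF r'(2)])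
        also have "cg P \<dots> 0" using qcoef_vanish[OF r'] by (simp add: cg_0_iff)
        finally show ?thesis by (simp add: cg_0_iff)
      qed
      then show "cg P (sqrt_q ^ (N * m - k) * qcoef k * qcoef (N * m - k)) 0"
        by (simp add: cg_0_iff mult.assoc)
    qed
    then have 1: "cg P 1 (\<Sum>i\<le>m. sqrt_q ^ (N * m - N * i) * qcoef (N * i) * qcoef (N * m - N * i))"
      unfolding qcoef_sum[OF odd_p] .
    have 2: "cg P (\<Sum>i\<le>m. sqrt_q ^ (N * m - N * i) * qcoef (N * i) * qcoef (N * m - N * i))
        (\<Sum>i\<le>m. 1 * qcoef (N * i) * qcoef (N * m - N * i))"
    proof (intro cg_sum cg_mult cg_refl)
      fix i
      have "cg P (sqrt_q ^ (N * (m - i))) (1 ^ (m - i))" unfolding power_mult by (rule cg_power[OF sN])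
      then show "cg P (sqrt_q ^ (N * m - N * i)) 1" by (simp add: diff_mult_distrib2)
    qed
    define y where "y i = (qcoef (N * i) :: 'p R)" for i
    have 3: "(\<Sum>i\<le>m. 1 * qcoef (N * i) * qcoef (N * m - N * i)) = (\<Sum>i\<le>m. y i * y (m - i))"
      by (simp add: y_def diff_mult_distrib2)
    have 4: "(\<Sum>i\<le>m. y i * y (m - i)) = 2 * y m + (\<Sum>i\<in>A. y i * y (m - i))"
      unfolding split(1) using split(2-) by (simp add: y_def qcoef_0[OF odd_p])
    have 5: "(\<Sum>i\<le>m. x i * x (m - i)) = 2 * x m + (\<Sum>i\<in>A. x i * x (m - i))"
      unfolding split(1) using split(2-) by (simp add: x_def qcoef_0[OF odd_p])
    have 6: "cg P (\<Sum>i\<in>A. x i * x (m - i)) (\<Sum>i\<in>A. y i * y (m - i))"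
      unfolding x_def y_def by (intro cg_sum cg_mult cg_sym[OF less]) (auto simp: A_def)
    have "cg P (2 * x m + (\<Sum>i\<in>A. x i * x (m - i))) (2 * y m + (\<Sum>i\<in>A. y i * y (m - i)))"
      unfolding 5[symmetric] x1 using cg_trans[OF 1 2] unfolding 3 4 .
    from cg_diff[OF this 6] have "cg P (2 * x m) (2 * y m)" by simp
    then have "cg P (2 * y m) (2 * x m)" by (rule cg_sym)
    then have "cg P (2 * (qcoef (N * m) - x m)) 0" by (simp add: cg_def right_diff_distrib y_def)
    moreover have "(2 :: 'p R) dvd 1"
      using two_unit[OF odd_p] by (simp add: fps_dvd_1_iff fps_numeral_fps_const)
    ultimately have "cg P (qcoef (N * m) - x m) 0" by (rule cg_unit_cancel)
    then show ?thesis using cg_iff_diff unfolding x_def by blast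
  qed (simp add: qcoef_0[OF odd_p])
qed

section \<open>Factorization of \<open>fq\<close> modulo \<open>cyc j\<close>\<close>

definition EN :: "'p R'"
  where "EN = Abs_fps (\<lambda>n. if N dvd n then fps_const (fps_nth hyper (n div N)) else 0)"

definition hN :: "'p R'"
  where "hN = Abs_fps (\<lambda>r. if r \<le> d then qcoef r ^ 2 else 0)"

lemma EN_supported: "cg_supported P N (fps_nth EN)"
  by (simp add: cg_supported_def EN_def)

lemma EN_section: "fps_section N EN = incl_A hyper"
  using N_pos by (simp add: fps_eq_iff EN_def)

lemma hN_short: "k \<ge> N \<Longrightarrow> fps_nth hN k = 0"
  using Nd by (simp add: hN_def)

lemma hyper_nth: "fps_nth (hyper :: 'p R) n = fps_nth (qcoef n) 0 ^ 2"
  unfolding mod_q1_fq[OF odd_p, symmetric] by (simp add: fps_nth_power_0)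

text \<open>\<open>qcoef_Lucas\<close> separates the quotient of the index by \<open>N\<close> from
  its remainder, \<open>qcoef_section\<close> identifies the part depending on the quotient, and
  \<open>qcoef_vanish\<close> allows the other part to be cut off at degree
  \<open>d\<close>.\<close>

lemma fq_mod: "cg (fps_const P) fq (EN * hN)"
  unfolding cg_fps_iff
proof
  fix n
  define m r where "m = n div N" and "r = n mod N"
  have n: "n = N * m + r" and r: "r < N" using N_pos by (simp_all add: m_def r_def)
  have "cg P (fps_nth (EN * hN) n) (fps_nth EN (N * m) * fps_nth hN r)"
    unfolding m_def r_def by (rule cg_supported_mult_short[OF EN_supported N_pos hN_short])
  also have "fps_nth EN (N * m) = fps_const (fps_nth (qcoef m) 0) ^ 2"
    using N_pos by (simp add: EN_def hyper_nth fps_const_power)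
  also have "cg P (fps_const (fps_nth (qcoef m) 0) ^ 2 * fps_nth hN r) (qcoef (N * m) ^ 2 * qcoef r ^ 2)"
  proof (rule cg_mult)
    show "cg P (fps_const (fps_nth (qcoef m) 0) ^ 2) (qcoef (N * m) ^ 2)"
      by (rule cg_power[OF cg_sym[OF qcoef_section]])
    show "cg P (fps_nth hN r) (qcoef r ^ 2)"
    proof (cases "r \<le> d")
      case False
      then have "cg P (qcoef r) 0" using qcoef_vanish r by simp
      then have "cg P (qcoef r ^ 2) (0 ^ 2)" by (rule cg_power)
      then show ?thesis using False by (simp add: hN_def cg_sym)
    qed (simp add: hN_def)
  qed
  also have "qcoef (N * m) ^ 2 * qcoef r ^ 2 = ((qcoef r * qcoef (N * m)) ^ 2 :: 'p R)"
    by (simp add: power_mult_distrib)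
  also have "cg P \<dots> (qcoef n ^ 2)" unfolding n by (rule cg_power[OF cg_sym[OF qcoef_Lucas[OF r]]])
  finally show "cg P (fps_nth fq n) (fps_nth (EN * hN) n)" by (simp add: cg_sym)
qed

lemma fps_scale_qN: "cg (fps_const P) (fps_scale ((1 + fps_X) ^ N) x) x"
  unfolding cg_fps_iff
proof
  fix n
  have "cg P (((1 + fps_X) ^ N) ^ n * fps_nth x n) (1 ^ n * fps_nth x n)"
    by (intro cg_mult cg_power qN cg_refl)
  then show "cg P (fps_nth (fps_scale ((1 + fps_X) ^ N) x) n) (fps_nth x n)" by simp
qed

section \<open>Sums and products over the \<open>N\<close> translates, by orthogonality of roots of
  unity\<close>

lemma sum_q_power: "\<not> N dvd n \<Longrightarrow> cg P (\<Sum>i<N. ((1 + fps_X) ^ i) ^ n) 0"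
proof -
  assume n: "\<not> N dvd n"
  have "(\<Sum>i<N. ((1 + fps_X) ^ i) ^ n) = (\<Sum>i<N. ((1 + fps_X :: 'p R) ^ n) ^ i)"
    by (simp only: power_mult[symmetric] mult.commute)
  then have "((1 + fps_X) ^ n - 1) * (\<Sum>i<N. ((1 + fps_X) ^ i) ^ n) = ((1 + fps_X :: 'p R) ^ N) ^ n - 1"
    using power_diff_1_eq[of "(1 + fps_X :: 'p R) ^ n" N]
    by (simp only: power_mult[symmetric] mult.commute)
  moreover have "cg P (((1 + fps_X) ^ N) ^ n) (1 ^ n)" by (rule cg_power[OF qN])
  ultimately have "cg P (((1 + fps_X) ^ n - 1) * (\<Sum>i<N. ((1 + fps_X) ^ i) ^ n)) 0"
    by (simp only: cg_def power_one diff_0_right)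
  then show ?thesis using n by (rule cancel_q)
qed

lemma Sq_nth: "fps_nth (Sq N) n = (\<Sum>i<N. ((1 + fps_X) ^ i) ^ n) * fps_nth (gq :: 'p R') n"
  by (simp only: Sq_def fps_sum_nth fps_scale_nth sum_distrib_right)

lemma Sq_supported: "cg_supported P N (fps_nth (Sq N))"
  unfolding cg_supported_def Sq_nth using sum_q_power by (simp add: cg_0_iff)

lemma Sq_section: "cg (fps_const P) (fps_section N (Sq N)) (of_nat N * fps_section N gq)"
  unfolding cg_fps_iff
proof
  fix n
  have "cg P (\<Sum>i<N. ((1 + fps_X) ^ i) ^ (N * n)) (\<Sum>i<N. 1)"
  proof (rule cg_sum)
    fix i
    have "cg P (((1 + fps_X) ^ N) ^ (i * n)) (1 ^ (i * n))" by (rule cg_power[OF qN])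
    then show "cg P (((1 + fps_X) ^ i) ^ (N * n)) 1" by (simp only: power_mult[symmetric] power_one mult_ac)
  qed
  then have "cg P (fps_nth (Sq N) (N * n)) (of_nat N * fps_nth gq (N * n))"
    unfolding Sq_nth by (intro cg_mult cg_refl) simp
  then show "cg P (fps_nth (fps_section N (Sq N)) n) (fps_nth (of_nat N * fps_section N gq) n)"
    by (simp add: fps_of_nat[symmetric])
qed

text \<open>Modulo \<open>P\<close> this is the factorization of \<open>1 - \<lambda>^N\<close> over
  the \<open>N\<close>-th roots of unity. The translation by \<open>q\<close> permutes the factors,
  which leaves only exponents divisible by \<open>N\<close>; the coefficient of
  \<open>\<lambda>^N\<close> is found from the root \<open>\<lambda> = 1\<close>.\<close>

lemma Dq_supported: "cg_supported P N (fps_nth (Dq N))"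
  and Dq_section: "cg (fps_const P) (fps_section N (Dq N)) (1 - fps_X)"
proof -
  let ?D = "Dq N :: 'p R'" and ?Q = "1 + fps_X :: 'p R"
  have "fps_scale ?Q ?D = (\<Prod>i<N. 1 - fps_const (?Q ^ Suc i) * fps_X)"
    unfolding Dq_def
    by (induction N) (simp_all add: fps_scale.hom_simps mult_ac)
  then have "(1 - fps_X) * fps_scale ?Q ?D = (\<Prod>i<Suc N. 1 - fps_const (?Q ^ i) * fps_X)"
    by (simp only: prod.lessThan_Suc_shift) simp
  then have eq: "(1 - fps_X) * fps_scale ?Q ?D = ?D * (1 - fps_const (?Q ^ N) * fps_X)"
    by (simp add: Dq_def)
  have shift: "cg P (?Q ^ n * fps_nth ?D n) (fps_nth ?D n)" for n
  proof (induction n)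
    case (Suc n)
    have "?Q ^ Suc n * fps_nth ?D (Suc n) - ?Q ^ n * fps_nth ?D n = fps_nth ?D (Suc n) - ?Q ^ N * fps_nth ?D n"
      using arg_cong[OF eq, of "\<lambda>y. fps_nth y (Suc n)"]
      by (simp add: left_diff_distrib right_diff_distrib mult.assoc[symmetric] mult.commute[of _ "fps_const _"] mult.commute[of "fps_nth ?D n"])
    then have "?Q ^ Suc n * fps_nth ?D (Suc n) = fps_nth ?D (Suc n) - ?Q ^ N * fps_nth ?D n + ?Q ^ n * fps_nth ?D n"
      by (simp add: algebra_simps)
    also have "cg P \<dots> (fps_nth ?D (Suc n) - 1 * fps_nth ?D n + fps_nth ?D n)"
      by (intro cg_add cg_diff cg_mult cg_refl qN Suc)
    finally show ?case by simp
  qed simp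
  show supp: "cg_supported P N (fps_nth ?D)"
    unfolding cg_supported_def
  proof (intro allI impI)
    fix n assume n: "\<not> N dvd n"
    have "cg P ((?Q ^ n - 1) * fps_nth ?D n) 0"
      using shift[of n] by (simp add: cg_def left_diff_distrib)
    then show "cg P (fps_nth ?D n) 0" using n by (rule cancel_q)
  qed
  obtain E where E: "?D = (1 - fps_X) * E" "fps_nth E N = 0"
  proof
    let ?E = "\<Prod>i<N - 1. 1 - fps_const (?Q ^ Suc i) * fps_X"
    have "N = Suc (N - 1)" using N_pos by simp
    then have "?D = (\<Prod>i<Suc (N - 1). 1 - fps_const (?Q ^ i) * fps_X)" unfolding Dq_def by simp
    then show "?D = (1 - fps_X) * ?E" by (simp only: prod.lessThan_Suc_shift) simp
    have "fps_nth (\<Prod>i<k. 1 - fps_const (?Q ^ Suc i) * fps_X) n = 0" if "n > k" for n k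
      using that
    proof (induction k arbitrary: n)
      case (Suc k)
      have "fps_nth ((1 - fps_const (?Q ^ Suc k) * fps_X) * (\<Prod>i<k. 1 - fps_const (?Q ^ Suc i) * fps_X)) n = 0"
        by (rule fps_linear_mult_degree[of "Suc k"]) (use Suc in auto)
      then show ?case by (simp only: prod.lessThan_Suc mult.commute)
    qed simp
    then show "fps_nth ?E N = 0" using N_pos by simp
  qed
  \<comment> \<open>Division by \<open>1 - \<lambda>\<close> turns coefficients into partial sums.
    As \<open>E\<close> has degree below \<open>N\<close>, the coefficients of \<open>?D\<close> up
    to \<open>N\<close> add up to 0, which expresses that \<open>\<lambda> = 1\<close> is a
    root.\<close>
  have "fps_nth E n = (\<Sum>i\<le>n. fps_nth ?D i)" for n
  proof (induction n)
    case (Suc n)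
    have "fps_nth ?D (Suc n) = fps_nth E (Suc n) - fps_nth E n" unfolding E(1) by (simp add: left_diff_distrib)
    then show ?case using Suc by simp
  qed (simp add: E(1))
  then have "(\<Sum>i\<le>N * 1. fps_nth ?D i) = 0" using E(2) by simp
  moreover have "cg P (\<Sum>i\<le>N * 1. fps_nth ?D i) (\<Sum>i\<le>1. fps_nth ?D (N * i))"
    using supp by (intro cg_sum_multiples N_pos) (auto simp: cg_supported_def)
  ultimately have "cg P 0 (1 + fps_nth ?D N)" by (simp add: Dq_nth_0)
  from cg_diff[OF cg_sym[OF this] cg_refl, of 1] have DN: "cg P (fps_nth ?D N) (- 1)" by simp
  show "cg (fps_const P) (fps_section N ?D) (1 - fps_X)"
    unfolding cg_fps_iff
  proof
    fix n :: nat
    consider "n = 0" | "n = 1" | "n > 1" by (cases "n = 0"; cases "n = 1") auto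
    then show "cg P (fps_nth (fps_section N ?D) n) (fps_nth (1 - fps_X) n)"
    proof cases
      case 3
      then have "N * n > N" using N_pos by simp
      then have "fps_nth ?D (N * n) = 0" by (rule Dq_degree)
      then show ?thesis using 3 by (simp add: fps_X_def)
    qed (use DN in \<open>simp_all add: Dq_nth_0\<close>)
  qed
qed

text \<open>
  Call the product \<open>U\<close>. Modulo \<open>cyc j\<close> it is a series in \<open>\<lambda>^N\<close>, while \<open>U * hN^2\<close> is the polynomial
  \<open>Bq N\<close> of degree less than \<open>N\<close>. Since \<open>hN^2\<close> has degree exactly \<open>N - 1\<close>, the series \<open>U\<close> is constant.
\<close>

lemma telescope: "cg (fps_const P) (Dq N * Sq N * (EN * EN)) (of_nat N)"
proof -
  define U where "U = Dq N * Sq N * (EN * EN)"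
  define K where "K = hN * hN"
  have U: "cg_supported P N (fps_nth U)"
    unfolding U_def by (intro cg_supported_mult Dq_supported Sq_supported EN_supported)
  have hd: "fps_nth hN i = 0" if "i > d" for i using that by (simp add: hN_def)
  have K_short: "fps_nth K k = 0" if "k \<ge> N" for k
    unfolding K_def fps_nth_mult_sum
  proof (rule sum.neutral, rule ballI)
    fix i assume "i \<in> {..k}"
    then have "i > d \<or> k - i > d" using that Nd by auto
    then show "fps_nth hN i * fps_nth hN (k - i) = 0" using hd by auto
  qed
  have K0: "fps_nth K 0 = 1" by (simp add: K_def hN_def qcoef_0[OF odd_p])
  have Kd: "fps_nth K (2 * d) = qcoef d ^ 2 * qcoef d ^ 2"
  proof -
    have "fps_nth K (2 * d) = (\<Sum>i\<le>2 * d. if i = d then qcoef d ^ 2 * qcoef d ^ 2 else 0)"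
      unfolding K_def fps_nth_mult_sum by (intro sum.cong) (auto simp: hN_def)
    then show ?thesis by (simp add: sum.delta)
  qed
  have "cg (fps_const P) (Bq N) (Dq N * (EN * hN) * (EN * hN) * Sq N)"
    unfolding Bq_eq[OF odd_p]
    by (intro cg_mult cg_refl fq_mod cg_trans[OF fps_scale_qN fq_mod])
  also have "Dq N * (EN * hN) * (EN * hN) * Sq N = U * K" by (simp only: U_def K_def mult_ac)
  finally have BUK: "cg P (fps_nth (Bq N) n) (fps_nth (U * K) n)" for n by (simp only: cg_fps_iff)
  have BU: "cg P (fps_nth (Bq N) n) (fps_nth U (N * (n div N)) * fps_nth K (n mod N))" for n
    using BUK[of n] cg_supported_mult_short[OF U N_pos K_short] by (rule cg_trans)
  show ?thesis
    unfolding cg_fps_iff U_def[symmetric]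
  proof
    fix n
    have N_nth: "fps_nth (of_nat N :: 'p R') n = (if n = 0 then of_nat N else 0)"
      by (simp add: fps_of_nat[symmetric])
    show "cg P (fps_nth U n) (fps_nth (of_nat N) n)"
    proof (cases "N dvd n \<and> n \<noteq> 0")
      case True
      then obtain m where m: "n = N * m" "m > 0" by auto
      let ?n = "N * m + 2 * d"
      have "2 * d < N" using Nd by simp
      then have n: "?n div N = m" "?n mod N = 2 * d" using N_pos by simp_all
      have "?n \<ge> N" using m by (simp add: trans_le_add1)
      then have "cg P 0 (fps_nth U n * (qcoef d ^ 2 * qcoef d ^ 2))"
        using BU[of ?n, unfolded n Kd Bq_degree[OF \<open>?n \<ge> N\<close>]] by (simp only: m(1))
      from cg_sym[OF this] have "cg P (qcoef d * (qcoef d * (qcoef d * (qcoef d * fps_nth U n)))) 0"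
        by (simp only: power2_eq_square mult_ac)
      then have "cg P (fps_nth U n) 0" using qcoef_cancel[OF order_refl] by blast
      then show ?thesis using True N_nth by simp
    next
      case False
      then consider "n = 0" | "\<not> N dvd n" by blast
      then show ?thesis
      proof cases
        case 1
        then show ?thesis using BU[of 0] by (simp add: K0 Bq_nth_0 N_nth cg_sym)
      next
        case 2
        then have "n \<noteq> 0" by (intro notI) simp
        then show ?thesis using U 2 N_nth by (simp add: cg_supported_def)
      qed
    qed
  qed
qed

section \<open>The coefficients of \<open>gq\<close> at multiples of \<open>N\<close>\<close>

lemma cancel_N: "cg P (of_nat N * y) 0 \<Longrightarrow> cg P y 0"
proof -
  have "cg P (of_nat (CARD('p) ^ i) * y) 0 \<Longrightarrow> cg P y 0" for i
    by (induction i) (auto simp: mult.assoc P intro: cyc_cancel_p)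
  then show "cg P (of_nat N * y) 0 \<Longrightarrow> cg P y 0" unfolding N .
qed

text \<open>Applying \<open>fps_section N\<close> to \<open>telescope\<close> gives
  \<open>N (1 - \<lambda>) h^2 G = N\<close> modulo \<open>P\<close>, where \<open>h\<close> is
  \<open>hyper\<close> and \<open>G\<close> the section of \<open>gq\<close>. After cancelling
  \<open>N\<close> this is the equation defining \<open>gq\<close> at \<open>q = 1\<close>, whose
  solution is unique.\<close>

lemma gq_section: "cg (fps_const P) (fps_section N gq) (incl_A (mod_q1 gq))"
proof -
  let ?h = "incl_A hyper :: 'p R'" and ?G = "fps_section N gq"
  have "cg (fps_const P) (fps_section N (Dq N * (Sq N * (EN * EN)))) ((1 - fps_X) * (of_nat N * ?G * (?h * ?h)))"
  proof -
    have "cg (fps_const P) (fps_section N (Dq N * (Sq N * (EN * EN)))) (fps_section N (Dq N) * fps_section N (Sq N * (EN * EN)))"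
      by (rule fps_section_mult[OF Dq_supported N_pos])
    also have "cg (fps_const P) \<dots> ((1 - fps_X) * (fps_section N (Sq N) * fps_section N (EN * EN)))"
      by (intro cg_mult Dq_section fps_section_mult[OF Sq_supported N_pos])
    also have "cg (fps_const P) \<dots> ((1 - fps_X) * (of_nat N * ?G * (?h * ?h)))"
      using fps_section_mult[OF EN_supported N_pos, of EN] unfolding EN_section
      by (intro cg_mult cg_refl Sq_section)
    finally show ?thesis .
  qed
  moreover have "cg (fps_const P) (fps_section N (Dq N * (Sq N * (EN * EN)))) (of_nat N)"
    unfolding cg_fps_iff
  proof
    fix n
    have "fps_nth (of_nat N) (N * n) = fps_nth (of_nat N :: 'p R') n"
      using N_pos by (simp add: fps_of_nat[symmetric])
    moreover have "cg P (fps_nth (Dq N * (Sq N * (EN * EN))) (N * n)) (fps_nth (of_nat N) (N * n))"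
      using telescope by (simp only: mult.assoc cg_fps_iff)
    ultimately show "cg P (fps_nth (fps_section N (Dq N * (Sq N * (EN * EN)))) n) (fps_nth (of_nat N) n)"
      by (simp only: fps_section_nth)
  qed
  ultimately have "cg (fps_const P) ((1 - fps_X) * (of_nat N * ?G * (?h * ?h))) (of_nat N)"
    using cg_trans[OF cg_sym] by blast
  moreover have "(1 - fps_X) * (of_nat N * ?G * (?h * ?h)) - of_nat N = of_nat N * ((1 - fps_X) * ?h * ?h * ?G - 1)"
    unfolding right_diff_distrib[of "of_nat N"] mult_1_right by (simp only: mult_ac)
  ultimately have "cg (fps_const P) (of_nat N * ((1 - fps_X) * ?h * ?h * ?G - 1)) 0"
    by (simp only: cg_def diff_0_right)
  then have "cg P (fps_nth ((1 - fps_X) * ?h * ?h * ?G - 1) n) 0" for n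
    unfolding cg_fps_iff using cancel_N by (simp only: fps_of_nat[symmetric] fps_mult_left_const_nth fps_zero_nth)
  then have 1: "cg (fps_const P) ((1 - fps_X) * ?h * ?h * ?G) 1"
    unfolding cg_iff_diff[of _ _ 1] cg_fps_iff by (simp only: fps_zero_nth simp_thms)
  have "mod_q1 ((1 - fps_X) * fq * gamma_R' fq * gq) = (1 - fps_X) * hyper * hyper * (mod_q1 gq :: 'p R)"
    by (simp add: mod_q1.hom_simps mod_q1_fq[OF odd_p])
  then have "(1 - fps_X) * hyper * hyper * mod_q1 gq = (1 :: 'p R)"
    unfolding gq_mult[OF odd_p] mod_q1.hom_one ..
  moreover have "incl_A (1 - fps_X :: 'p R) = 1 - fps_X"
    by (auto simp: fps_eq_iff fps_X_def)
  then have "(1 - fps_X) * ?h * ?h * incl_A (mod_q1 gq) = incl_A ((1 - fps_X) * hyper * hyper * mod_q1 gq)"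
    by (simp only: incl_A.hom_mult)
  ultimately have "(1 - fps_X) * ?h * ?h * incl_A (mod_q1 gq) = 1"
    by (simp only: incl_A.hom_one)
  then have "?G = ((1 - fps_X) * ?h * ?h * incl_A (mod_q1 gq)) * ?G" by simp
  also have "\<dots> = ((1 - fps_X) * ?h * ?h * ?G) * incl_A (mod_q1 gq)" by (simp only: mult_ac)
  also have "cg (fps_const P) \<dots> (1 * incl_A (mod_q1 gq))" by (intro cg_mult 1 cg_refl)
  finally show ?thesis by simp
qed

end

text \<open>\<open>phi_R\<close> sends \<open>cyc i\<close> to \<open>cyc (Suc i)\<close> and fixes
  p-adic constants. So \<open>gq_section\<close> one level down, at index \<open>n / p\<close>, and
  \<open>gq_section\<close> at level \<open>j\<close>, at index \<open>n\<close>, give congruences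
  with the same constant \<open>c\<close>.\<close>

lemma cyc_dvd_gq:
  assumes odd_p: "odd CARD('p :: prime_card)" and "CARD('p) ^ Suc j dvd n"
  shows "cyc j dvd fps_nth (phi_R' gq - gq :: 'p R') n"
proof -
  obtain m where m: "n = CARD('p) ^ Suc j * m" using assms(2) by (rule dvdE)
  define c where "c = fps_const (fps_nth (fps_nth (gq :: 'p R') m) 0)"
  have sec: "cg (cyc i) (fps_nth (gq :: 'p R') (CARD('p) ^ Suc i * m)) c" for i
  proof -
    have "odd (CARD('p) ^ Suc i)" using odd_p by simp
    then obtain d where d: "CARD('p) ^ Suc i = 2 * d + 1" by (rule oddE)
    show ?thesis using gq_section[OF odd_p refl d refl] by (simp add: cg_fps_iff c_def)
  qed
  have "cg (cyc j) (phi_R (fps_nth (gq :: 'p R') (CARD('p) ^ j * m))) c"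
  proof (cases j)
    case 0
    \<comment> \<open>There is no lower level for \<open>j = 0\<close>. Instead, the difference is
      divisible by \<open>q - 1\<close>, whose image \<open>q^p - 1\<close> is a multiple of
      \<open>cyc 0\<close>.\<close>
    have "fps_X dvd fps_nth gq m - c" by (simp add: fps_X_dvd_iff c_def)
    then have "phi_R fps_X dvd phi_R (fps_nth gq m - c)" by (rule phi_R.hom_dvd)
    moreover have "phi_R c = c" by (simp add: c_def)
    moreover have "cyc 0 dvd (phi_R fps_X :: 'p R)"
      using cyc_mult[of 0, where 'p = 'p] by (simp only: phi_R_X power_0 power_one_right power_Suc mult_1_right) (metis dvd_triv_right)
    ultimately show ?thesis using 0 by (simp add: cg_def phi_R.hom_diff) (metis dvd_trans)
  next
    case (Suc i)
    have "phi_R (cyc i) dvd phi_R (fps_nth gq (CARD('p) ^ j * m) - c)"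
      using sec[of i] unfolding Suc cg_def by (rule phi_R.hom_dvd)
    then show ?thesis by (simp add: phi_R_cyc cg_def phi_R.hom_diff Suc c_def)
  qed
  moreover have "fps_nth (phi_R' gq) n = phi_R (fps_nth (gq :: 'p R') (CARD('p) ^ j * m))"
    using CARD_prime_neq_0[where 'p = 'p] by (simp add: phi_R'_nth m mult.assoc)
  ultimately show ?thesis
    using cg_trans[OF _ cg_sym[OF sec[of j]]] unfolding m by (simp add: cg_def)
qed

lemma qnat_dvd_gq:
  assumes "odd CARD('p :: prime_card)" "n > 0"
  shows "qnat n dvd fps_nth (phi_R' gq - gq :: 'p R') n"
  using assms by (intro qnat_dvd cyc_dvd_gq)

text \<open>\<open>\<gamma> - 1\<close> multiplies the coefficient of \<open>\<lambda>^n\<close> by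
  \<open>q^n - 1 = (q - 1) [n]_q\<close>. It kills constants, so \<open>b0\<close> can be
  prescribed.\<close>

lemma ex_q_primitive:
  assumes "fps_nth y 0 = 0" "\<And>n. n > 0 \<Longrightarrow> qnat n dvd fps_nth (y :: 'p :: prime_card R') n"
  shows "\<exists>b. fps_nth b 0 = b0 \<and> gamma_R' b - b = q1_R' * y"
proof -
  have "\<exists>c. n > 0 \<longrightarrow> fps_nth y n = qnat n * c" for n using assms(2)[of n] by (auto elim: dvdE)
  then obtain c where c: "\<And>n. n > 0 \<Longrightarrow> fps_nth y n = qnat n * c n" by metis
  define b where "b = Abs_fps (\<lambda>n. if n = 0 then b0 else c n)"
  have "gamma_R' b - b = q1_R' * y"
  proof (rule fps_ext)
    fix n
    show "fps_nth (gamma_R' b - b) n = fps_nth (q1_R' * y) n"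
    proof (cases "n = 0")
      case False
      then have "fps_nth (q1_R' * y) n = ((1 + fps_X) ^ n - 1) * c n"
        by (simp only: q1_R'_def fps_mult_left_const_nth c X_qnat[symmetric] mult.assoc neq0_conv)
      then show ?thesis using False by (simp add: gamma_R'_nth b_def left_diff_distrib)
    qed (simp add: gamma_R'_nth assms(1) q1_R'_def)
  qed
  then show ?thesis by (intro exI[of _ b]) (simp add: b_def)
qed

section \<open>A basis adapted to the action\<close>

text \<open>A horizontal vector with \<open>e2\<close>-coordinate \<open>fq\<close> has coordinate
  \<open>d_q fq\<close> along \<open>e1 = \<lambda> (1 - \<lambda>) e1'\<close>; this is its
  coordinate along \<open>e1'\<close>.\<close>

definition f1q :: "'p :: prime_card R'"
  where "f1q = fps_X * (1 - fps_X) * d_q fq"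

definition vM :: "'p :: prime_card R' ^ 2"
  where "vM = f1q *s e1' + fq *s e2"

definition wM :: "'p :: prime_card R' ^ 2"
  where "wM = exquo 1 fq *s e1'"

lemma e1'_nth [simp]: "e1' $ 1 = 1" "e1' $ 2 = 0"
  by (simp_all add: e1'_def axis_def)

lemma e2_nth [simp]: "e2 $ 1 = 0" "e2 $ 2 = 1"
  by (simp_all add: e2_def axis_def)

lemma vM_nth: "vM $ 1 = f1q" "vM $ 2 = fq"
  by (simp_all add: vM_def)

lemma wM_nth: "wM $ 1 = exquo 1 fq" "wM $ 2 = 0"
  by (simp_all add: wM_def)

lemma nabla_M'_nth:
  fixes m :: "'p :: prime_card R' ^ 2"
  shows "nabla_M' m $ 1 = fps_X * d_q (m $ 1) - fps_const (qint half) ^ 2 * fps_X * gamma_R' (m $ 2)"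
    and "nabla_M' m $ 2 = fps_X * d_q (m $ 2) - exquo 1 (1 - fps_X) * gamma_R' (m $ 1)
      + fps_const (qint half) ^ 2 * q1_R' * fps_X * exquo 1 (1 - fps_X) * gamma_R' (m $ 2)"
proof -
  define k where "k = (fps_const (qint half) ^ 2 :: 'p R')"
  show "nabla_M' m $ 1 = fps_X * d_q (m $ 1) - fps_const (qint half) ^ 2 * fps_X * gamma_R' (m $ 2)"
    and "nabla_M' m $ 2 = fps_X * d_q (m $ 2) - exquo 1 (1 - fps_X) * gamma_R' (m $ 1)
      + fps_const (qint half) ^ 2 * q1_R' * fps_X * exquo 1 (1 - fps_X) * gamma_R' (m $ 2)"
    unfolding nabla_M'_def nabla_e1'_def nabla_e2_def k_def[symmetric]
    by (simp_all add: algebra_simps)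
qed

lemma one_minus_X_unit: "(1 - fps_X :: 'a :: comm_ring_1 fps) dvd 1"
  by (simp add: fps_dvd_1_iff)

lemma one_minus_X_neq_0: "(1 - fps_X :: 'a :: comm_ring_1 fps) \<noteq> 0"
proof
  assume "(1 - fps_X :: 'a fps) = 0"
  then have "fps_nth (1 - fps_X :: 'a fps) 0 = 0" by simp
  then show False by simp
qed

context
  assumes odd_p: "odd CARD('p :: prime_card)"
begin

lemma q1_kappa: "q1_R' * fps_const (qint half) = fps_const (sqrt_q :: 'p R) - 1"
  unfolding q1_R'_def fps_const_mult X_qint_half[OF odd_p] by (simp flip: fps_const_sub)

lemma q1_f1q: "q1_R' * f1q = (1 - fps_X) * (gamma_R' fq - fq :: 'p R')"
proof -
  have "q1_R' * f1q = (1 - fps_X) * (q1_R' * fps_X * d_q (fq :: 'p R'))"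
    by (simp only: f1q_def mult_ac)
  then show ?thesis unfolding d_q_eq .
qed

lemma gamma_one_minus_X: "gamma_R' (1 - fps_X) = 1 - fps_const (1 + fps_X) * (fps_X :: 'p R')"
  by (simp add: gamma_R'_eq_scale fps_scale.hom_simps)

text \<open>The q-hypergeometric equation as a first-order relation: multiplied by
  \<open>q - 1\<close>, the two sides differ by the left side of \<open>fq_equation\<close>.\<close>

lemma gamma_f1q:
  "gamma_R' f1q - f1q = q1_R' * fps_const (qint half) ^ 2 * fps_X * (gamma_R' fq :: 'p R')"
proof -
  define k where "k = (fps_const (qint half) :: 'p R')"
  define s where "s = (fps_const sqrt_q :: 'p R')"
  define F0 F1 F2 where "F0 = (fq :: 'p R')" and "F1 = gamma_R' F0" and "F2 = gamma_R' F1"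
  have ss: "fps_const (1 + fps_X) = s * s" unfolding s_def fps_const_mult sqrt_q_square[OF odd_p] ..
  have eq: "(1 - s * s * fps_X) * F2 - 2 * (1 - s * fps_X) * F1 + (1 - fps_X) * F0 = 0"
    using fq_equation[OF odd_p] by (simp only: F0_def F1_def F2_def ss s_def)
  have "gamma_R' (q1_R' * f1q) = q1_R' * gamma_R' (f1q :: 'p R')"
    by (simp only: gamma_R'.hom_mult gamma_R'_q1)
  also have "gamma_R' (q1_R' * f1q) = gamma_R' (1 - fps_X) * gamma_R' (F1 - F0)"
    unfolding q1_f1q gamma_R'.hom_mult F1_def F0_def ..
  finally have g: "q1_R' * gamma_R' f1q = (1 - s * s * fps_X) * (F2 - F1)"
    unfolding gamma_one_minus_X ss by (simp only: gamma_R'.hom_diff F1_def F2_def)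
  have "q1_R' * (gamma_R' f1q - f1q) = (1 - s * s * fps_X) * (F2 - F1) - (1 - fps_X) * (F1 - F0)"
    unfolding right_diff_distrib[of q1_R'] g q1_f1q F0_def F1_def ..
  also have "\<dots> = ((1 - s * s * fps_X) * F2 - 2 * (1 - s * fps_X) * F1 + (1 - fps_X) * F0) + (s - 1) * (s - 1) * fps_X * F1"
    by (simp add: algebra_simps)
  also have "\<dots> = (q1_R' * k) * (q1_R' * k) * fps_X * F1"
    unfolding eq unfolding k_def q1_kappa s_def by simp
  also have "\<dots> = q1_R' * (q1_R' * k ^ 2 * fps_X * F1)" by (simp only: power2_eq_square mult_ac)
  finally have "gamma_R' f1q - f1q = q1_R' * k ^ 2 * fps_X * F1"
    using q1_R'_neq_0[where 'p = 'p] by (simp only: mult_cancel_left) simp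
  then show ?thesis unfolding k_def F1_def F0_def .
qed

lemma nabla_vM: "nabla_M' vM = (0 :: 'p R' ^ 2)"
proof -
  let ?u = "exquo 1 (1 - fps_X) :: 'p R'"
  define k where "k = (fps_const (qint half) :: 'p R')"
  define F0 F1 where "F0 = (fq :: 'p R')" and "F1 = gamma_R' F0"
  have u: "(1 - fps_X) * ?u = 1" by (rule mult_exquo_unit[OF one_minus_X_unit])
  have "q1_R' * (fps_X * d_q f1q - k ^ 2 * fps_X * F1) = q1_R' * fps_X * d_q f1q - q1_R' * k ^ 2 * fps_X * F1"
    by (simp only: right_diff_distrib mult.assoc)
  also have "\<dots> = 0" unfolding d_q_eq gamma_f1q k_def F1_def F0_def by simp
  finally have 1: "fps_X * d_q f1q - k ^ 2 * fps_X * F1 = 0"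
    using q1_R'_neq_0[where 'p = 'p] by (simp only: mult_eq_0_iff) simp
  define Z where "Z = fps_X * d_q F0 - ?u * gamma_R' f1q + k ^ 2 * q1_R' * fps_X * ?u * F1"
  have "q1_R' * L * Z = L * (q1_R' * fps_X * d_q F0) - (L * ?u) * (q1_R' * gamma_R' f1q)
      + (L * ?u) * (q1_R' * (q1_R' * k ^ 2 * fps_X * F1))" for L
    unfolding Z_def distrib_left right_diff_distrib by (simp only: mult_ac)
  then have "q1_R' * (1 - fps_X) * Z = (1 - fps_X) * (q1_R' * fps_X * d_q F0) - ((1 - fps_X) * ?u) * (q1_R' * gamma_R' f1q)
      + ((1 - fps_X) * ?u) * (q1_R' * (q1_R' * k ^ 2 * fps_X * F1))" .
  also have "\<dots> = (1 - fps_X) * (F1 - F0) - q1_R' * gamma_R' f1q + q1_R' * (gamma_R' f1q - f1q)"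
    unfolding u d_q_eq F1_def F0_def k_def gamma_f1q by simp
  also have "\<dots> = (1 - fps_X) * (F1 - F0) - q1_R' * f1q" by (simp add: algebra_simps)
  also have "\<dots> = 0" unfolding q1_f1q F1_def F0_def by simp
  finally have "Z = 0" using q1_R'_neq_0[where 'p = 'p] one_minus_X_neq_0 by (simp only: mult_eq_0_iff) simp
  then show ?thesis using 1
    by (simp add: vec_eq_iff forall_2 nabla_M'_nth vM_def Z_def k_def F1_def F0_def)
qed

lemma fq_inverse: "fq * exquo 1 fq = (1 :: 'p R')"
  by (rule mult_exquo_unit[OF fq_unit[OF odd_p]])

lemma gamma_fq_inverse: "gamma_R' fq * gamma_R' (exquo 1 fq) = (1 :: 'p R')"
  unfolding gamma_R'.hom_mult[symmetric] fq_inverse gamma_R'.hom_one ..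

text \<open>The \<open>e2\<close>-coordinate of the left side is
  \<open>- \<gamma>(1 / f) / (1 - \<lambda>)\<close>, which equals \<open>- g f\<close> by the
  choice of \<open>gq\<close>. The \<open>e1'\<close>-coordinate reduces to the difference
  \<open>\<gamma>(1 / f) - 1 / f\<close>, expressed through \<open>q1_f1q\<close>.\<close>

lemma nabla_wM: "nabla_M' wM = - gq *s (vM :: 'p R' ^ 2)"
proof -
  let ?u = "exquo 1 (1 - fps_X) :: 'p R'"
  define w where "w = (exquo 1 fq :: 'p R')"
  define F0 F1 where "F0 = (fq :: 'p R')" and "F1 = gamma_R' F0"
  define w' where "w' = gamma_R' w"
  have u: "(1 - fps_X) * ?u = 1" by (rule mult_exquo_unit[OF one_minus_X_unit])
  have w: "F0 * w = 1" "F1 * w' = 1"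
    using fq_inverse gamma_fq_inverse by (simp_all add: F0_def F1_def w_def w'_def)
  have g: "(1 - fps_X) * F0 * F1 * gq = 1" using gq_mult[OF odd_p] by (simp add: F0_def F1_def)
  have "?u * w' = ((1 - fps_X) * F0 * F1 * gq) * (?u * w')" unfolding g by simp
  also have "\<dots> = gq * F0 * ((1 - fps_X) * ?u) * (F1 * w')" by (simp only: mult_ac)
  finally have 2: "?u * w' = gq * F0" unfolding u w by simp
  have 3: "q1_R' * (fps_X * d_q w) = w' - w"
    unfolding mult.assoc[symmetric] d_q_eq w'_def ..
  have "q1_R' * (gq * f1q) = gq * ((1 - fps_X) * (F1 - F0))"
    using q1_f1q by (simp add: F1_def F0_def mult.left_commute)
  also have "\<dots> = gq * ((1 - fps_X) * (F1 - F0)) * ((F0 * w) * (F1 * w'))" unfolding w by simp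
  also have "\<dots> = ((1 - fps_X) * F0 * F1 * gq) * ((F1 * w') * w - (F0 * w) * w')"
    by (simp add: algebra_simps)
  also have "\<dots> = w - w'" unfolding g w by simp
  finally have "q1_R' * (fps_X * d_q w) = q1_R' * (- gq * f1q)" unfolding 3 by simp
  then have "fps_X * d_q w = - gq * f1q" using q1_R'_neq_0[where 'p = 'p] by (simp only: mult_cancel_left) simp
  moreover have "d_q 0 = (0 :: 'p R')" using d_q_const[of 0] by simp
  ultimately show ?thesis using 2
    by (simp add: vec_eq_iff forall_2 nabla_M'_nth vM_def wM_def w_def w'_def F0_def gamma_R'.hom_zero)
qed

lemma e1'_eq: "e1' = fq *s (wM :: 'p R' ^ 2)"
  using fq_inverse by (simp add: vec_eq_iff forall_2 wM_nth)

end

section \<open>Modules of rank two\<close>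

definition det2 :: "'r :: comm_ring_1 ^ 2 \<Rightarrow> 'r ^ 2 \<Rightarrow> 'r"
  where "det2 x y = x $ 1 * y $ 2 - x $ 2 * y $ 1"

lemma det2_simps:
  "det2 (x + y) z = det2 x z + det2 y z" "det2 x (y + z) = det2 x y + det2 x z"
  "det2 (a *s x) z = a * det2 x z" "det2 x (a *s z) = a * det2 x z"
  "det2 x (y - z) = det2 x y - det2 x z" "det2 (x - y) z = det2 x z - det2 y z"
  "det2 x x = 0"
  by (simp_all add: det2_def algebra_simps)

lemma det2_swap: "det2 y x = - det2 x y"
  by (simp add: det2_def algebra_simps)

lemma det2_cramer:
  fixes m :: "'r :: comm_ring_1 ^ 2"
  shows "det2 x y *s m = det2 m y *s x + det2 x m *s y"
  by (simp add: vec_eq_iff forall_2 det2_def algebra_simps)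

lemma is_basis_2I:
  fixes f :: "2 \<Rightarrow> 'r :: comm_ring_1 ^ 2"
  assumes "det2 (f 1) (f 2) dvd 1"
  shows "is_basis f"
proof -
  obtain d where "1 = det2 (f 1) (f 2) * d" using assms by (rule dvdE)
  then have d: "d * det2 (f 1) (f 2) = 1" by (metis mult.commute)
  have "\<exists>!c. m = (\<Sum>\<nu>\<in>UNIV. c \<nu> *s f \<nu>)" for m
  proof
    let ?c = "\<lambda>\<nu> :: 2. if \<nu> = 1 then d * det2 m (f 2) else d * det2 (f 1) m"
    have "m = d *s (det2 (f 1) (f 2) *s m)" by (simp add: vec_eq_iff d flip: mult.assoc)
    also have "\<dots> = d *s (det2 m (f 2) *s f 1 + det2 (f 1) m *s f 2)"
      by (rule arg_cong[OF det2_cramer])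
    also have "\<dots> = (d * det2 m (f 2)) *s f 1 + (d * det2 (f 1) m) *s f 2"
      by (simp add: vec_eq_iff distrib_left mult.assoc)
    also have "\<dots> = (\<Sum>\<nu>\<in>UNIV. ?c \<nu> *s f \<nu>)" by (simp add: sum_2)
    finally show "m = (\<Sum>\<nu>\<in>UNIV. ?c \<nu> *s f \<nu>)" .
  next
    fix c assume m: "m = (\<Sum>\<nu>\<in>UNIV. c \<nu> *s f \<nu>)"
    then have "det2 m (f 2) = c 1 * det2 (f 1) (f 2)" "det2 (f 1) m = c 2 * det2 (f 1) (f 2)"
      by (simp_all add: sum_2 det2_simps)
    then have "d * det2 m (f 2) = c 1 * (d * det2 (f 1) (f 2))" "d * det2 (f 1) m = c 2 * (d * det2 (f 1) (f 2))"
      by (simp_all only: mult_ac)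
    then show "c = (\<lambda>\<nu> :: 2. if \<nu> = 1 then d * det2 m (f 2) else d * det2 (f 1) m)"
      by (simp add: fun_eq_iff forall_2 d)
  qed
  then show ?thesis by (simp add: is_basis_def)
qed

lemma semilinear_add: "semilinear s f \<Longrightarrow> f (x + y) = f x + f y"
  by (simp add: semilinear_def)

lemma semilinear_scale: "semilinear s f \<Longrightarrow> f (a *s x) = s a *s f x"
  by (simp add: semilinear_def)

lemma semilinear_diff:
  assumes "semilinear s f"
  shows "f (x - y) = f x - f y"
  using semilinear_add[OF assms, of "x - y" y] by (simp add: algebra_simps)

lemma span_vec_base: "x \<in> A \<Longrightarrow> x \<in> module.span ((*s) :: 'r :: comm_ring_1 \<Rightarrow> _) A"
  by (rule module.span_base[OF module_vec])

lemma span_vec_add: "x \<in> module.span (*s) A \<Longrightarrow> y \<in> module.span (*s) A \<Longrightarrow>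
    x + y \<in> module.span ((*s) :: 'r :: comm_ring_1 \<Rightarrow> _) A"
  by (rule module.span_add[OF module_vec])

lemma span_vec_scale: "x \<in> module.span (*s) A \<Longrightarrow> a *s x \<in> module.span ((*s) :: 'r :: comm_ring_1 \<Rightarrow> _) A"
  by (rule module.span_scale[OF module_vec])

lemma span_vec_eq_UNIV_2:
  fixes x y :: "'r :: comm_ring_1 ^ 2"
  assumes "x \<in> module.span (*s) A" "y \<in> module.span (*s) A" "det2 x y dvd 1"
  shows "module.span (*s) A = UNIV"
proof -
  obtain d where "1 = det2 x y * d" using assms(3) by (rule dvdE)
  then have d: "d * det2 x y = 1" by (metis mult.commute)
  have "m \<in> module.span (*s) A" for m
  proof -
    have "d *s (det2 x y *s m) \<in> module.span (*s) A"
      by (subst det2_cramer) (intro span_vec_scale span_vec_add assms)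
    moreover have "d *s (det2 x y *s m) = m" by (simp add: vec_eq_iff d flip: mult.assoc)
    ultimately show ?thesis by simp
  qed
  then show ?thesis by auto
qed

lemma adic_nbhd_image:
  fixes f :: "('r :: comm_ring_1) ^ 'n \<Rightarrow> 'r ^ 'n"
  assumes add: "\<And>x y. f (x + y) = f x + f y"
    and scale: "\<And>i j x. f ((prm Q ^ i * qm1 Q ^ j) *s x) = (prm Q ^ i * qm1 Q ^ j) *s f x"
  shows "f ` adic_nbhd Q k \<subseteq> adic_nbhd Q k"
proof -
  have f0: "f 0 = 0" using add[of 0 0] by simp
  have "f x \<in> adic_nbhd Q k" if "x \<in> adic_nbhd Q k" for x
    using that unfolding adic_nbhd_def
  proof (rule module.span_induct_alt[OF module_vec])
    show "f 0 \<in> module.span (*s) {(prm Q ^ i * qm1 Q ^ j) *s m |i j m. i + j = k}"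
      by (simp add: f0 module.span_zero[OF module_vec])
  next
    fix c and x y :: "'r ^ 'n"
    assume x: "x \<in> {(prm Q ^ i * qm1 Q ^ j) *s m |i j m. i + j = k}"
      and y: "f y \<in> module.span (*s) {(prm Q ^ i * qm1 Q ^ j) *s m |i j m. i + j = k}"
    obtain i j m where x: "x = (prm Q ^ i * qm1 Q ^ j) *s m" "i + j = k" using x by auto
    \<comment> \<open>\<open>f\<close> is additive but is assumed to commute only with the scalars
      \<open>p^i (q - 1)^j\<close>, so the arbitrary scalar \<open>c\<close> is moved into the
      vector first.\<close>
    have "c *s x = (prm Q ^ i * qm1 Q ^ j) *s (c *s m)"
      by (simp add: x vec_eq_iff mult_ac)
    then have "f (c *s x) = (prm Q ^ i * qm1 Q ^ j) *s f (c *s m)" by (simp only: scale)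
    then have "f (c *s x) \<in> module.span (*s) {(prm Q ^ i * qm1 Q ^ j) *s m |i j m. i + j = k}"
      using x(2) by (intro span_vec_base) auto
    then show "f (c *s x + y) \<in> module.span (*s) {(prm Q ^ i * qm1 Q ^ j) *s m |i j m. i + j = k}"
      unfolding add using y by (rule span_vec_add)
  qed
  then show ?thesis by auto
qed

lemma adic_continuous_additive:
  assumes "\<And>x y. f (x + y) = f x + f y"
    and "\<And>i j x. f ((prm Q ^ i * qm1 Q ^ j) *s x) = (prm Q ^ i * qm1 Q ^ j) *s f x"
  shows "adic_continuous Q f"
  unfolding adic_continuous_def using adic_nbhd_image[of f Q] assms by blast

section \<open>The action on the module\<close>

lemma ring_R'_simps [simp]: "prm (ring_R' :: 'p :: prime_card R' qring) = of_nat CARD('p)" "qm1 ring_R' = q1_R'"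
  "pq (ring_R' :: 'p :: prime_card R' qring) = fps_const (qnat CARD('p))"
  "phi ring_R' = phi_R'" "gam ring_R' = gamma_R'"
  by (simp_all add: ring_R'_def qint_of_nat)

definition actM :: "'p :: prime_card R' ^ 2 \<Rightarrow> 'p R' ^ 2"
  where "actM m = m + q1_R' *s nabla_M' m"

lemma actM_semilinear: "semilinear gamma_R' (actM :: 'p :: prime_card R' ^ 2 \<Rightarrow> _)"
proof -
  have add: "nabla_M' (x + y) = nabla_M' x + nabla_M' y"
    and scale: "nabla_M' (a *s x) = (fps_X * d_q a) *s x + gamma_R' a *s nabla_M' x"
    for a and x y :: "'p R' ^ 2"
    using q_connection_nabla_M' unfolding q_connection_def by blast+
  have "actM (a *s x) = gamma_R' a *s actM x" for a and x :: "'p R' ^ 2"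
  proof -
    have "actM (a *s x) = a *s x + (q1_R' * fps_X * d_q a) *s x + gamma_R' a *s (q1_R' *s nabla_M' x)"
      unfolding actM_def scale by (simp add: vec_eq_iff algebra_simps)
    then show ?thesis unfolding d_q_eq by (simp add: actM_def vec_eq_iff algebra_simps)
  qed
  moreover have "actM (x + y) = actM x + actM y" for x y :: "'p R' ^ 2"
    unfolding actM_def add by (simp add: vec_eq_iff algebra_simps)
  ultimately show ?thesis unfolding semilinear_def by blast
qed

lemmas actM_add = semilinear_add[OF actM_semilinear]
  and actM_scale = semilinear_scale[OF actM_semilinear]

definition gamma_inv :: "'p :: prime_card R' \<Rightarrow> 'p R'"
  where "gamma_inv = fps_scale (exquo 1 (1 + fps_X))"

lemma gamma_inv [simp]: "gamma_R' (gamma_inv x) = x" "gamma_inv (gamma_R' x) = (x :: 'p :: prime_card R')"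
proof -
  have "(1 + fps_X) * exquo 1 (1 + fps_X) = (1 :: 'p R)"
    by (rule mult_exquo_unit) (simp add: fps_dvd_1_iff)
  then show "gamma_R' (gamma_inv x) = x" "gamma_inv (gamma_R' x) = x"
    by (simp_all add: gamma_inv_def gamma_R'_eq_scale fps_scale_scale mult.commute)
qed

context
  assumes odd_p: "odd CARD('p :: prime_card)"
begin

lemma det2_wM_vM: "det2 wM (vM :: 'p R' ^ 2) = 1"
  using fq_inverse[OF odd_p] by (simp add: det2_def vM_nth wM_nth mult.commute)

text \<open>Cramer's rule: the basis has determinant 1, so its coordinate functions are themselves
  determinants. All maps on \<open>M'\<close> below are written in these coordinates.\<close>

lemma decomp_wv: "m = det2 m vM *s wM + det2 wM m *s (vM :: 'p R' ^ 2)"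
  using det2_cramer[of wM vM m] by (simp add: det2_wM_vM)

lemma decomp_wv_unique:
  "det2 (a *s wM + b *s vM) vM = (a :: 'p R')"
  "det2 wM (a *s wM + b *s vM) = (b :: 'p R')"
  by (simp_all add: det2_simps det2_wM_vM)

lemma actM_vM: "actM vM = (vM :: 'p R' ^ 2)"
  by (simp add: actM_def nabla_vM[OF odd_p])

lemma actM_wM: "actM wM = wM - (q1_R' * gq) *s (vM :: 'p R' ^ 2)"
  by (simp add: actM_def nabla_wM[OF odd_p] vec_eq_iff)

lemma actM_wv: "actM (a *s wM + b *s vM) = gamma_R' a *s wM + (gamma_R' b - q1_R' * gq * gamma_R' a) *s (vM :: 'p R' ^ 2)"
  by (simp add: actM_add actM_scale actM_vM actM_wM vec_eq_iff algebra_simps)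

text \<open>In the basis \<open>wM\<close>, \<open>vM\<close> the action is unipotent triangular up
  to applying \<gamma>. The formula solves \<open>actM_wv\<close> for the first coordinate and then
  for the second.\<close>

definition actM_inv :: "'p R' ^ 2 \<Rightarrow> 'p R' ^ 2"
  where "actM_inv m = gamma_inv (det2 m vM) *s wM + gamma_inv (det2 wM m + q1_R' * gq * det2 m vM) *s vM"

lemma actM_actM_inv: "actM (actM_inv m) = m"
  by (subst (3) decomp_wv) (simp add: actM_inv_def actM_wv)

lemma actM_inv_actM: "actM_inv (actM m) = m"
proof -
  have "actM m = gamma_R' (det2 m vM) *s wM + (gamma_R' (det2 wM m) - q1_R' * gq * gamma_R' (det2 m vM)) *s vM"
    by (subst (1) decomp_wv) (rule actM_wv)
  then have "actM_inv (actM m) = det2 m vM *s wM + det2 wM m *s vM"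
    unfolding actM_inv_def by (simp add: decomp_wv_unique)
  then show ?thesis using decomp_wv[of m] by simp
qed

lemma bij_actM: "bij (actM :: 'p R' ^ 2 \<Rightarrow> _)"
  by (rule bij_betw_byWitness[of _ actM_inv]) (auto simp: actM_actM_inv actM_inv_actM)

lemma inv_actM: "inv actM = actM_inv"
  by (rule inv_equality) (auto simp: actM_actM_inv actM_inv_actM)

lemma adic_continuous_actM: "adic_continuous ring_R' (actM :: 'p R' ^ 2 \<Rightarrow> _)"
  and adic_continuous_inv_actM: "adic_continuous ring_R' (inv actM :: 'p R' ^ 2 \<Rightarrow> _)"
proof -
  have c: "gamma_R' (of_nat CARD('p) ^ i * q1_R' ^ j) = (of_nat CARD('p) ^ i * q1_R' ^ j :: 'p R')" for i j
    by (simp add: gamma_R'.hom_mult gamma_R'.hom_power gamma_R'.hom_of_nat)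
  show "adic_continuous ring_R' (actM :: 'p R' ^ 2 \<Rightarrow> _)"
    by (rule adic_continuous_additive) (simp_all only: actM_add actM_scale ring_R'_simps c)
  have scale: "actM_inv (c *s x) = c *s actM_inv x" if "gamma_R' c = c" for c x
  proof -
    have "actM_inv (c *s actM (actM_inv x)) = actM_inv (actM (c *s actM_inv x))"
      by (simp add: actM_scale that)
    then show ?thesis by (simp only: actM_actM_inv actM_inv_actM)
  qed
  have add: "actM_inv (x + y) = actM_inv x + actM_inv y" for x y
    using actM_inv_actM[of "actM_inv x + actM_inv y"] by (simp add: actM_add actM_actM_inv)
  show "adic_continuous ring_R' (inv actM :: 'p R' ^ 2 \<Rightarrow> _)"
    unfolding inv_actM by (rule adic_continuous_additive) (simp_all only: add scale ring_R'_simps c)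
qed

end

lemma fil_M'_1: "fil (obj_M' f) 1 = {m. q1_R' dvd m $ 2}"
proof -
  have "m \<in> {a *s e1' + (q1_R' * b) *s e2 |a b. True} \<longleftrightarrow> q1_R' dvd m $ 2" for m :: "'p :: prime_card R' ^ 2"
  proof
    assume "q1_R' dvd m $ 2"
    then obtain b where "m $ 2 = q1_R' * b" by (rule dvdE)
    then have "m = m $ 1 *s e1' + (q1_R' * b) *s e2" by (simp add: vec_eq_iff forall_2)
    then show "m \<in> {a *s e1' + (q1_R' * b) *s e2 |a b. True}" by blast
  qed auto
  then show ?thesis by (auto simp: obj_M'_def)
qed

lemma fil_M'_0: "fil (obj_M' f) 0 = UNIV"
  by (simp add: obj_M'_def)

lemma act_M': "act (obj_M' f) = actM" and frob_M': "frob (obj_M' f) = f"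
  by (simp_all add: obj_M'_def actM_def fun_eq_iff)

lemma adapted_filtration_M':
  fixes f :: "'p :: prime_card R' ^ 2 \<Rightarrow> _"
  shows "adapted_filtration (fil_q ring_R') (fil (obj_M' f))"
  unfolding adapted_filtration_def
proof (intro conjI exI)
  let ?e = "\<lambda>\<nu> :: 2. if \<nu> = 1 then e1' else e2 :: 'p R' ^ 2"
  let ?\<rho> = "\<lambda>\<nu> :: 2. if \<nu> = 1 then 1 else 0 :: nat"
  show "is_basis ?e" by (rule is_basis_2I) (simp add: det2_def)
  show "\<forall>\<nu>. ?\<rho> \<nu> \<in> {0, 1}" by simp
  show "fil (obj_M' f) 1 \<subseteq> fil (obj_M' f) 0" by (simp add: fil_M'_0)
  have F: "fil_q ring_R' 0 = UNIV" "fil_q ring_R' (- 1) = UNIV" "fil_q ring_R' 1 = {x. q1_R' dvd x}"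
    by (auto simp: fil_q_def elim: dvdE)
  have m: "m = m $ 1 *s e1' + m $ 2 *s e2" for m :: "'p R' ^ 2"
    by (simp add: vec_eq_iff forall_2)
  show "\<forall>r\<in>{0, 1}. fil (obj_M' f) r =
      {\<Sum>\<nu>\<in>UNIV. c \<nu> *s ?e \<nu> |c. \<forall>\<nu>. c \<nu> \<in> fil_q ring_R' (int r - int (?\<rho> \<nu>))}"
  proof
    fix r :: nat assume "r \<in> {0, 1}"
    have *: "(\<exists>c. m = (\<Sum>\<nu>\<in>UNIV. c \<nu> *s ?e \<nu>) \<and> (\<forall>\<nu>. c \<nu> \<in> A \<nu>)) \<longleftrightarrow> m $ 1 \<in> A 1 \<and> m $ 2 \<in> A 2"
      for A and m :: "'p R' ^ 2"
    proof
      assume "m $ 1 \<in> A 1 \<and> m $ 2 \<in> A 2"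
      then show "\<exists>c. m = (\<Sum>\<nu>\<in>UNIV. c \<nu> *s ?e \<nu>) \<and> (\<forall>\<nu>. c \<nu> \<in> A \<nu>)"
        using m[of m] by (intro exI[of _ "\<lambda>\<nu>. m $ \<nu>"]) (simp add: sum_2 forall_2)
    qed (auto simp: sum_2)
    show "fil (obj_M' f) r = {\<Sum>\<nu>\<in>UNIV. c \<nu> *s ?e \<nu> |c. \<forall>\<nu>. c \<nu> \<in> fil_q ring_R' (int r - int (?\<rho> \<nu>))}"
      unfolding set_eq_iff mem_Collect_eq *
      using \<open>r \<in> {0, 1}\<close> by (auto simp: fil_M'_0 fil_M'_1[simplified] F)
  qed
qed

section \<open>Frobenius on the module\<close>

abbreviation pq_R' :: "'p :: prime_card R'"
  where "pq_R' \<equiv> fps_const (qnat CARD('p))"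

lemma phi_R'_q1: "phi_R' q1_R' = q1_R' * (pq_R' :: 'p :: prime_card R')"
  by (simp add: q1_R'_def phi_R_X X_qnat fps_const_mult)

lemma gamma_pq [simp]: "gamma_R' pq_R' = pq_R'"
  by (rule gamma_R'_const)

definition phiM ::
    "'p :: prime_card R' \<Rightarrow> 'p R' \<Rightarrow> 'p R' ^ 2 \<Rightarrow> 'p R' ^ 2"
  where "phiM e b m = phi_R' (det2 m vM) *s (pq_R' *s (e *s wM + b *s vM)) + phi_R' (det2 wM m) *s (e *s vM)"

lemma semilinear_phiM: "semilinear phi_R' (phiM e b)"
  by (simp add: semilinear_def phiM_def det2_simps phi_R'.hom_add phi_R'.hom_mult vec_eq_iff algebra_simps)

lemmas phiM_add = semilinear_add[OF semilinear_phiM]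
  and phiM_scale = semilinear_scale[OF semilinear_phiM]

context
  fixes e b :: "'p :: prime_card R'"
  assumes odd_p: "odd CARD('p)" and e: "e = 1 \<or> e = - 1"
    and b: "gamma_R' b - b = q1_R' * (e * (gq - phi_R' gq))"
begin

lemma e_simps: "e * e = 1" "phi_R' e = e" "gamma_R' e = e"
  using e by (auto simp: phi_R'.hom_simps gamma_R'.hom_simps)

lemma phiM_vM: "phiM e b vM = e *s vM"
  using det2_wM_vM[OF odd_p] by (simp add: phiM_def det2_simps phi_R'.hom_simps)

lemma phiM_wM: "phiM e b wM = pq_R' *s (e *s wM + b *s vM)"
  using det2_wM_vM[OF odd_p] by (simp add: phiM_def det2_simps phi_R'.hom_simps)

lemma phiM_e1': "phiM e b e1' = pq_R' *s (phi_R' fq *s (e *s wM + b *s vM))"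
proof -
  have "phiM e b e1' = phi_R' fq *s phiM e b wM" by (subst e1'_eq[OF odd_p]) (rule phiM_scale)
  then show ?thesis unfolding phiM_wM by (simp add: vec_eq_iff mult.left_commute)
qed

text \<open>As \<open>e2 = - f1q w + (1 / f) v\<close>, the image of \<open>e2\<close> is a multiple
  of \<open>e w + b v\<close> plus \<open>\<phi>(1 / f) e v\<close>. Only the last term contributes,
  with \<open>\<phi>(f) \<phi>(1 / f) e^2 = 1\<close>.\<close>

lemma det2_phiM: "det2 (phi_R' fq *s (e *s wM + b *s vM)) (phiM e b e2) = 1"
proof -
  let ?x = "e *s wM + b *s vM"
  have unit: "phi_R' fq * phi_R' (exquo 1 fq) = (1 :: 'p R')"
    unfolding phi_R'.hom_mult[symmetric] fq_inverse[OF odd_p] phi_R'.hom_one ..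
  have "det2 wM e2 = (exquo 1 fq :: 'p R')" by (simp add: det2_def wM_nth)
  moreover have "det2 ?x (phiM e b e2) = phi_R' (det2 wM e2) * (e * det2 ?x vM)"
    unfolding phiM_def by (simp only: det2_simps(2,4,7) mult_zero_right add_0_left)
  moreover have "det2 ?x vM = e" by (rule decomp_wv_unique(1)[OF odd_p])
  ultimately have "det2 (phi_R' fq *s ?x) (phiM e b e2) = phi_R' fq * (phi_R' (exquo 1 fq) * (e * e))"
    by (simp only: det2_simps(3))
  then show ?thesis by (simp only: e_simps(1) mult_1_right unit)
qed

lemma phiM_basis:
  "\<exists>f :: 2 \<Rightarrow> 'p R' ^ 2. is_basis f \<and>
    phiM e b e1' = fps_const (qint (of_nat CARD('p))) *s f 1 \<and> phiM e b e2 = f 2"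
proof (intro exI conjI)
  let ?f = "\<lambda>\<nu> :: 2. if \<nu> = 1 then phi_R' fq *s (e *s wM + b *s vM) else phiM e b e2"
  show "is_basis ?f" by (rule is_basis_2I) (simp add: det2_phiM)
  show "phiM e b e1' = fps_const (qint (of_nat CARD('p))) *s ?f 1" by (simp add: phiM_e1' qint_of_nat)
qed simp

lemma actM_phiM: "actM (phiM e b m) = phiM e b (actM m)"
proof -
  have v: "actM (phiM e b vM) = phiM e b (actM vM)"
    by (simp add: phiM_vM actM_vM[OF odd_p] actM_scale e_simps)
  have "actM (phiM e b wM) = pq_R' *s (e *s (wM - (q1_R' * gq) *s vM) + gamma_R' b *s vM)"
    unfolding phiM_wM actM_scale actM_add actM_vM[OF odd_p] actM_wM[OF odd_p] e_simps gamma_pq ..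
  also have "gamma_R' b = b + q1_R' * (e * (gq - phi_R' gq))" using b by (simp add: algebra_simps)
  also have "pq_R' *s (e *s (wM - (q1_R' * gq) *s vM) + (b + q1_R' * (e * (gq - phi_R' gq))) *s vM)
      = phiM e b wM - phi_R' (q1_R' * gq) *s phiM e b vM"
    unfolding phiM_wM phiM_vM phi_R'.hom_mult phi_R'_q1 by (simp add: vec_eq_iff algebra_simps)
  also have "\<dots> = phiM e b (actM wM)"
    unfolding actM_wM[OF odd_p] semilinear_diff[OF semilinear_phiM] phiM_scale ..
  finally have w: "actM (phiM e b wM) = phiM e b (actM wM)" .
  have "actM (phiM e b (x *s wM + y *s vM)) = phiM e b (actM (x *s wM + y *s vM))" for x y
    unfolding phiM_add phiM_scale actM_add actM_scale v w gamma_phi_R' ..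
  then show ?thesis using decomp_wv[OF odd_p, of m] by metis
qed

lemma MF_M': "MF ring_R' (obj_M' (phiM e b))"
  unfolding MF_def act_M' frob_M' ring_R'_simps
proof (intro conjI)
  show "adapted_filtration (fil_q ring_R') (fil (obj_M' (phiM e b)))" by (rule adapted_filtration_M')
  show "semilinear gamma_R' (actM :: 'p R' ^ 2 \<Rightarrow> _)" by (rule actM_semilinear)
  show "bij (actM :: 'p R' ^ 2 \<Rightarrow> _)" by (rule bij_actM[OF odd_p])
  show "adic_continuous ring_R' (actM :: 'p R' ^ 2 \<Rightarrow> _)" by (rule adic_continuous_actM[OF odd_p])
  show "adic_continuous ring_R' (inv actM :: 'p R' ^ 2 \<Rightarrow> _)" by (rule adic_continuous_inv_actM[OF odd_p])
  show "actM \<circ> phiM e b = phiM e b \<circ> actM" by (simp add: fun_eq_iff actM_phiM)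
  show "\<forall>x :: 'p R' ^ 2. actM x - x \<in> range ((*s) q1_R')" by (simp add: actM_def)
  show "\<forall>r\<in>{0, 1}. actM ` fil (obj_M' (phiM e b)) r = fil (obj_M' (phiM e b)) r"
  proof
    fix r :: nat assume "r \<in> {0, 1}"
    moreover have "actM ` UNIV = (UNIV :: ('p R' ^ 2) set)" using bij_actM[OF odd_p] by (simp add: bij_is_surj)
    moreover have "actM ` {m :: 'p R' ^ 2. q1_R' dvd m $ 2} = {m. q1_R' dvd m $ 2}"
    proof -
      have dvd: "q1_R' dvd actM m $ 2 \<longleftrightarrow> q1_R' dvd m $ 2" for m :: "'p R' ^ 2"
        by (simp add: actM_def dvd_add_left_iff)
      show ?thesis
      proof (intro equalityI subsetI)
        fix m :: "'p R' ^ 2"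
        assume m: "m \<in> {m. q1_R' dvd m $ 2}"
        obtain n where n: "m = actM n" using bij_actM[OF odd_p] by (metis bij_pointE)
        then have "q1_R' dvd n $ 2" using m dvd by simp
        then show "m \<in> actM ` {m. q1_R' dvd m $ 2}" using n by blast
      qed (auto simp: dvd)
    qed
    ultimately show "actM ` fil (obj_M' (phiM e b)) r = fil (obj_M' (phiM e b)) r"
      using fil_M'_0[of "phiM e b"] fil_M'_1[of "phiM e b"] by auto
  qed
  show "strong_frobenius phi_R' pq_R' (fil (obj_M' (phiM e b))) (phiM e b)"
    unfolding strong_frobenius_def
  proof (intro conjI)
    show "semilinear phi_R' (phiM e b)" by (rule semilinear_phiM)
    have "phiM e b m \<in> range ((*s) pq_R')" if m: "q1_R' dvd m $ 2" for m
    proof -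
      obtain c where c: "m $ 2 = q1_R' * c" using m by (rule dvdE)
      have "m = m $ 1 *s e1' + (q1_R' * c) *s e2" by (simp add: vec_eq_iff forall_2 c)
      then have "phiM e b m = phi_R' (m $ 1) *s phiM e b e1' + phi_R' (q1_R' * c) *s phiM e b e2"
        by (metis phiM_add phiM_scale)
      \<comment> \<open>On the part \<open>(q - 1) c e2\<close> of \<open>Fil^1\<close>, the factor
        \<open>[p]_q\<close> comes from the scalar:
        \<open>\<phi>(q - 1) = (q - 1) [p]_q\<close>.\<close>
      also have "\<dots> = pq_R' *s (phi_R' (m $ 1) *s (phi_R' fq *s (e *s wM + b *s vM)) + (q1_R' * phi_R' c) *s phiM e b e2)"
        unfolding phiM_e1' phi_R'.hom_mult phi_R'_q1 by (simp add: vec_eq_iff algebra_simps)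
      finally show ?thesis by (rule range_eqI)
    qed
    then show "\<forall>r\<in>{0, 1}. phiM e b ` fil (obj_M' (phiM e b)) r \<subseteq> range ((*s) (pq_R' ^ r))"
      using fil_M'_0[of "phiM e b"] fil_M'_1[of "phiM e b"] by auto
    let ?A = "\<Union>r\<in>{0, 1}. {y. pq_R' ^ r *s y \<in> phiM e b ` fil (obj_M' (phiM e b)) r}"
    have "phi_R' fq *s (e *s wM + b *s vM) \<in> ?A"
    proof -
      have "pq_R' ^ 1 *s (phi_R' fq *s (e *s wM + b *s vM)) \<in> phiM e b ` fil (obj_M' (phiM e b)) 1"
        unfolding power_one_right phiM_e1'[symmetric] by (rule imageI) (simp add: fil_M'_1[simplified])
      then show ?thesis by blast
    qed
    moreover have "phiM e b e2 \<in> ?A"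
    proof -
      have "pq_R' ^ 0 *s phiM e b e2 \<in> phiM e b ` fil (obj_M' (phiM e b)) 0"
        by (simp add: fil_M'_0)
      then show ?thesis by blast
    qed
    ultimately show "module.span (*s) ?A = UNIV"
      by (rule span_vec_eq_UNIV_2[OF span_vec_base span_vec_base]) (simp only: det2_phiM dvd_refl)
  qed
qed

end

section \<open>Completeness of the coefficient ring\<close>

text \<open>\<open>in_adic k x\<close> says that \<open>x\<close> lies in the \<open>k\<close>-th power of the ideal \<open>(p, q - 1)\<close>.\<close>

definition in_adic_R :: "nat \<Rightarrow> 'p :: prime_card R \<Rightarrow> bool"
  where "in_adic_R k x \<longleftrightarrow> (\<forall>j. of_nat CARD('p) ^ (k - j) dvd fps_nth x j)"

definition in_adic :: "nat \<Rightarrow> 'p :: prime_card R' \<Rightarrow> bool"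
  where "in_adic k x \<longleftrightarrow> (\<forall>i. in_adic_R k (fps_nth x i))"

lemma in_adic_R_sum: "(\<And>i. i \<in> A \<Longrightarrow> in_adic_R k (f i)) \<Longrightarrow> in_adic_R k (sum f A)"
  by (simp add: in_adic_R_def fps_sum_nth dvd_sum)

lemma in_adic_R_mult:
  assumes "in_adic_R k x" "in_adic_R l y"
  shows "in_adic_R (k + l) (x * y :: 'p :: prime_card R)"
  unfolding in_adic_R_def fps_nth_mult_sum
proof (intro allI dvd_sum)
  fix i j :: nat assume "i \<in> {..j}"
  have "of_nat CARD('p) ^ (k - i + (l - (j - i))) dvd fps_nth x i * fps_nth y (j - i)"
    unfolding power_add using assms by (intro mult_dvd_mono) (simp_all add: in_adic_R_def)
  moreover have "(of_nat CARD('p) :: 'p padic_int) ^ (k + l - j) dvd of_nat CARD('p) ^ (k - i + (l - (j - i)))"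
    using \<open>i \<in> {..j}\<close> by (intro le_imp_power_dvd) auto
  ultimately show "of_nat CARD('p) ^ (k + l - j) dvd fps_nth x i * fps_nth y (j - i)"
    using dvd_trans by blast
qed

lemma in_adic_0: "in_adic 0 x"
  by (simp add: in_adic_def in_adic_R_def)

lemma in_adic_add: "in_adic k x \<Longrightarrow> in_adic k y \<Longrightarrow> in_adic k (x + y)"
  by (simp add: in_adic_def in_adic_R_def)

lemma in_adic_diff: "in_adic k x \<Longrightarrow> in_adic k y \<Longrightarrow> in_adic k (x - y)"
  by (simp add: in_adic_def in_adic_R_def)

lemma in_adic_mult: "in_adic k x \<Longrightarrow> in_adic l y \<Longrightarrow> in_adic (k + l) (x * y)"
  unfolding in_adic_def fps_nth_mult_sum by (auto intro!: in_adic_R_sum in_adic_R_mult)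

lemma in_adic_mult_right: "in_adic k y \<Longrightarrow> in_adic k (x * y)"
  using in_adic_mult[OF in_adic_0, of k y x] by simp

lemma in_adic_Suc: "in_adic (Suc k) x \<Longrightarrow> in_adic k x"
  unfolding in_adic_def in_adic_R_def
  by (meson diff_le_mono dvd_trans le_SucI le_imp_power_dvd order_refl)

lemma in_adic_separated:
  assumes "\<And>k. in_adic k x"
  shows "x = (0 :: 'p :: prime_card R')"
proof (rule fps_ext, rule fps_ext)
  fix i j
  have "fps_nth (fps_nth x i) j = 0"
  proof (rule padic_int_separated)
    fix k
    show "of_nat CARD('p) ^ k dvd fps_nth (fps_nth x i) j"
      using assms[of "k + j"] unfolding in_adic_def in_adic_R_def by (metis add_diff_cancel_right')
  qed
  then show "fps_nth (fps_nth x i) j = fps_nth (fps_nth 0 i) j" by simp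
qed

lemma in_adic_complete:
  fixes x :: "nat \<Rightarrow> 'p :: prime_card R'"
  assumes "\<And>n. in_adic n (x (Suc n) - x n)"
  shows "\<exists>y. \<forall>n. in_adic n (y - x n)"
proof -
  \<comment> \<open>The coefficient of \<open>(q - 1)^j\<close> in \<open>x n\<close> is controlled
    only modulo \<open>p^(n - j)\<close>, so its limit is taken along
    \<open>x (n + j)\<close>.\<close>
  have ex: "\<exists>y. \<forall>n. of_nat CARD('p) ^ n dvd y - fps_nth (fps_nth (x (n + j)) i) j" for i j
  proof -
    have "of_nat CARD('p) ^ n dvd fps_nth (fps_nth (x (Suc n + j)) i) j - fps_nth (fps_nth (x (n + j)) i) j" for n
    proof -
      have "of_nat CARD('p) ^ (n + j - j) dvd fps_nth (fps_nth (x (Suc (n + j)) - x (n + j)) i) j"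
        using assms[of "n + j"] unfolding in_adic_def in_adic_R_def by blast
      then show ?thesis by simp
    qed
    from padic_int_complete[of "\<lambda>n. fps_nth (fps_nth (x (n + j)) i) j", OF this] show ?thesis by blast
  qed
  define y where "y i j = (SOME y. \<forall>n. of_nat CARD('p) ^ n dvd y - fps_nth (fps_nth (x (n + j)) i) j)" for i j
  have y: "of_nat CARD('p) ^ n dvd y i j - fps_nth (fps_nth (x (n + j)) i) j" for i j n
    using someI_ex[OF ex[of j i]] unfolding y_def by blast
  have "in_adic n (Abs_fps (\<lambda>i. Abs_fps (y i)) - x n)" for n
    unfolding in_adic_def in_adic_R_def
  proof (intro allI)
    fix i j
    show "of_nat CARD('p) ^ (n - j) dvd fps_nth (fps_nth (Abs_fps (\<lambda>i. Abs_fps (y i)) - x n) i) j"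
    proof (cases "j \<le> n")
      case True
      then show ?thesis using y[of "n - j" i j] by simp
    qed simp
  qed
  then show ?thesis by blast
qed

text \<open>\<open>\<phi>(q - 1)\<close> has no constant term, so the coefficient \<open>j\<close>
  of an image involves only coefficients \<open>i \<le> j\<close>, which are divisible by at least
  as high a power of \<open>p\<close>.\<close>

lemma in_adic_phi: "in_adic k x \<Longrightarrow> in_adic k (phi_R' (x :: 'p :: prime_card R'))"
proof -
  have "in_adic_R k (phi_R c)" if "in_adic_R k c" for c :: "'p R"
    unfolding in_adic_R_def phi_R_def fps_compose_nth
  proof (intro allI dvd_sum dvd_mult2)
    fix i j :: nat assume "i \<in> {0..j}"
    then have "(of_nat CARD('p) :: 'p padic_int) ^ (k - j) dvd of_nat CARD('p) ^ (k - i)"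
      by (intro le_imp_power_dvd) auto
    then show "of_nat CARD('p) ^ (k - j) dvd fps_nth c i"
      using that unfolding in_adic_R_def by (metis dvd_trans)
  qed
  moreover have "in_adic_R k (0 :: 'p R)" by (simp add: in_adic_R_def)
  ultimately show "in_adic k x \<Longrightarrow> in_adic k (phi_R' x)"
    by (simp add: in_adic_def phi_R'_nth)
qed

lemma in_adic_pq: "in_adic 1 (pq_R' :: 'p :: prime_card R')"
  unfolding in_adic_def
proof
  fix i
  have "of_nat CARD('p) ^ (1 - j) dvd fps_nth (qnat CARD('p) :: 'p R) j" for j
    by (cases j) simp_all
  then show "in_adic_R 1 (fps_nth (pq_R' :: 'p R') i)"
    by (cases i) (simp_all add: in_adic_R_def del: One_nat_def)
qed

definition in_adic_vec :: "nat \<Rightarrow> 'p :: prime_card R' ^ 2 \<Rightarrow> bool"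
  where "in_adic_vec k x \<longleftrightarrow> in_adic k (x $ 1) \<and> in_adic k (x $ 2)"

lemma in_adic_vec_semilinear:
  fixes F :: "'p :: prime_card R' ^ 2 \<Rightarrow> 'p R' ^ 2"
  assumes F: "semilinear phi_R' F" and "in_adic_vec k x"
  shows "in_adic_vec k (F x)"
proof -
  have "x = x $ 1 *s e1' + x $ 2 *s e2" by (simp add: vec_eq_iff forall_2)
  then have "F x = phi_R' (x $ 1) *s F e1' + phi_R' (x $ 2) *s F e2"
    by (metis semilinear_add[OF F] semilinear_scale[OF F])
  then show ?thesis using assms(2)
    by (simp add: in_adic_vec_def in_adic_add in_adic_mult_right in_adic_phi mult.commute[of "phi_R' _"])
qed

lemma in_adic_vec_scale: "in_adic 1 c \<Longrightarrow> in_adic_vec k x \<Longrightarrow> in_adic_vec (Suc k) (c *s x)"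
  using in_adic_mult[of 1 c k] by (simp add: in_adic_vec_def)

text \<open>\<open>F\<close> preserves the adic order and multiplication by \<open>c\<close> raises
  it, so a fixed point has infinite order.\<close>

lemma semilinear_fixpoint_unique:
  fixes F :: "'p :: prime_card R' ^ 2 \<Rightarrow> 'p R' ^ 2"
  assumes F: "semilinear phi_R' F" and c: "in_adic 1 c" and x: "x = c *s F x"
  shows "x = 0"
proof -
  have "in_adic_vec k x" for k
  proof (induction k)
    case (Suc k)
    show ?case by (subst x) (rule in_adic_vec_scale[OF c in_adic_vec_semilinear[OF F Suc]])
  qed (simp add: in_adic_vec_def in_adic_0)
  then show ?thesis unfolding in_adic_vec_def using in_adic_separated by (auto simp: vec_eq_iff forall_2)
qed

text \<open>Successive approximation from 0: each step gains one adic order, and the coordinates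
  converge by completeness.\<close>

lemma semilinear_fixpoint_exists:
  fixes F :: "'p :: prime_card R' ^ 2 \<Rightarrow> 'p R' ^ 2"
  assumes F: "semilinear phi_R' F" and c: "in_adic 1 c"
  shows "\<exists>x. x = y + c *s F x"
proof -
  define s where "s n = ((\<lambda>x. y + c *s F x) ^^ n) 0" for n
  have s_Suc: "s (Suc n) = y + c *s F (s n)" for n by (simp add: s_def)
  have F_step: "in_adic_vec (Suc n) (c *s F u - c *s F v)" if "in_adic_vec n (u - v)" for n u v
  proof -
    have "c *s F u - c *s F v = c *s F (u - v)"
      by (simp add: semilinear_diff[OF F] vec_eq_iff right_diff_distrib)
    then show ?thesis using in_adic_vec_scale[OF c in_adic_vec_semilinear[OF F that]] by simp
  qed
  have step: "in_adic_vec n (s (Suc n) - s n)" for n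
  proof (induction n)
    case (Suc n)
    have "s (Suc (Suc n)) - s (Suc n) = c *s F (s (Suc n)) - c *s F (s n)" by (simp only: s_Suc[of "Suc n"] s_Suc[of n]) simp
    then show ?case using F_step[OF Suc] by simp
  qed (simp add: in_adic_vec_def in_adic_0)
  have "\<exists>l. \<forall>n. in_adic n (l - s n $ i)" if "i = 1 \<or> i = 2" for i
    using step that by (intro in_adic_complete) (auto simp: in_adic_vec_def)
  then obtain l1 l2 where l: "\<And>n. in_adic n (l1 - s n $ 1)" "\<And>n. in_adic n (l2 - s n $ 2)" by metis
  define x where "x = l1 *s e1' + l2 *s e2"
  have x: "in_adic_vec n (x - s n)" for n using l by (simp add: in_adic_vec_def x_def)
  have "in_adic_vec n (x - (y + c *s F x))" for n
  proof -
    have eq: "x - (y + c *s F x) = (x - s (Suc n)) - (c *s F x - c *s F (s n))" by (simp add: s_Suc)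
    show ?thesis unfolding eq
      using x[of "Suc n"] F_step[OF x[of n]] by (simp add: in_adic_vec_def in_adic_diff in_adic_Suc)
  qed
  then have "x - (y + c *s F x) = 0"
    unfolding in_adic_vec_def using in_adic_separated[of "(x - (y + c *s F x)) $ 1"] in_adic_separated[of "(x - (y + c *s F x)) $ 2"]
    by (simp only: vec_eq_iff forall_2 zero_index)
  then have "x = y + c *s F x" by (simp only: right_minus_eq)
  then show ?thesis by (rule exI)
qed

section \<open>Reduction modulo the square of q - 1\<close>

lemma abs_R'_mod_eq_iff: "abs_R'_mod x = abs_R'_mod y \<longleftrightarrow> q1_R' ^ 2 dvd x - y"
  by (rule R'_mod.abs_eq_iff)

lemma abs_rep_R'_mod [simp]: "abs_R'_mod (rep_R'_mod x) = x"
  using Quotient_R'_mod unfolding Quotient_def by blast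

lemma rhom_abs_R'_mod: "rhom abs_R'_mod"
  by unfold_locales (simp_all add: plus_R'_mod.abs_eq times_R'_mod.abs_eq one_R'_mod_def)

global_interpretation abs_R'_mod: rhom "abs_R'_mod :: 'p :: prime_card R' \<Rightarrow> _"
  by (rule rhom_abs_R'_mod)

abbreviation vmod :: "'p :: prime_card R' ^ 'n \<Rightarrow> 'p R'_mod ^ 'n"
  where "vmod \<equiv> vec_map abs_R'_mod"

lemma vec_map_nth [simp]: "vec_map f x $ i = f (x $ i)"
  by (simp add: vec_map_def)

lemma vmod_add: "vmod (x + y) = vmod x + vmod y"
  by (simp add: vec_eq_iff abs_R'_mod.hom_add)

lemma vmod_scale: "vmod (a *s x) = abs_R'_mod a *s vmod x"
  by (simp add: vec_eq_iff abs_R'_mod.hom_mult)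

lemma vmod_rep [simp]: "vmod (vec_map rep_R'_mod y) = y"
  by (simp add: vec_eq_iff)

lemma vmod_eq_iff: "vmod x = vmod y \<longleftrightarrow> (\<exists>z. x = y + q1_R' ^ 2 *s z)"
proof
  assume "vmod x = vmod y"
  then have "q1_R' ^ 2 dvd x $ i - y $ i" for i
    by (simp add: vec_eq_iff abs_R'_mod_eq_iff)
  then have "\<forall>i. \<exists>z. x $ i - y $ i = q1_R' ^ 2 * z" by (simp add: dvd_def)
  then obtain z where "\<And>i. x $ i - y $ i = q1_R' ^ 2 * z i" by metis
  then have "x = y + q1_R' ^ 2 *s (\<chi> i. z i)" by (simp add: vec_eq_iff algebra_simps)
  then show "\<exists>z. x = y + q1_R' ^ 2 *s z" by blast
next
  assume "\<exists>z. x = y + q1_R' ^ 2 *s z"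
  then show "vmod x = vmod y" by (auto simp: vec_eq_iff abs_R'_mod_eq_iff)
qed

lemma vmod_semilinear:
  fixes F :: "'p :: prime_card R' ^ 'n \<Rightarrow> 'p R' ^ 'n"
  assumes F: "semilinear s F" and s: "q1_R' ^ 2 dvd s (q1_R' ^ 2)" and "vmod x = vmod y"
  shows "vmod (F x) = vmod (F y)"
proof -
  obtain z where "x = y + q1_R' ^ 2 *s z" using assms(3) vmod_eq_iff by blast
  then have "F x = F y + s (q1_R' ^ 2) *s F z" by (simp add: semilinear_add[OF F] semilinear_scale[OF F])
  moreover obtain r where "s (q1_R' ^ 2) = q1_R' ^ 2 * r" using s by (rule dvdE)
  ultimately have "F x = F y + q1_R' ^ 2 *s (r *s F z)" by (simp add: vec_eq_iff mult.assoc)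
  then show ?thesis using vmod_eq_iff by blast
qed

lemma q1_square_dvd: "q1_R' ^ 2 dvd phi_R' (q1_R' ^ 2)" "q1_R' ^ 2 dvd gamma_R' (q1_R' ^ 2)"
  by (simp_all add: phi_R'.hom_power phi_R'_q1 power_mult_distrib gamma_R'.hom_power)

lemma reduce_mf_simps:
  assumes "MF ring_R' X"
  shows "frob (reduce_mf X) (vmod x) = vmod (frob X x)" "act (reduce_mf X) (vmod x) = vmod (act X x)"
    "fil (reduce_mf X) r = vmod ` fil X r"
proof -
  have F: "semilinear phi_R' (frob X)" and A: "semilinear gamma_R' (act X)"
    using assms by (simp_all add: MF_def strong_frobenius_def)
  have rep: "vmod (vec_map rep_R'_mod (vmod x)) = vmod x" by (rule vmod_rep)
  show "frob (reduce_mf X) (vmod x) = vmod (frob X x)"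
    using vmod_semilinear[OF F q1_square_dvd(1) rep] by (simp add: reduce_mf_def)
  show "act (reduce_mf X) (vmod x) = vmod (act X x)"
    using vmod_semilinear[OF A q1_square_dvd(2) rep] by (simp add: reduce_mf_def)
  show "fil (reduce_mf X) r = vmod ` fil X r" by (simp add: reduce_mf_def)
qed

section \<open>Lifting isomorphisms from the reduction\<close>

lemma adapted_filtration_q:
  fixes G :: "nat \<Rightarrow> ('r :: comm_ring_1 ^ 'n) set"
  assumes "adapted_filtration (fil_q Q) G"
  shows "G 0 = UNIV" and "x \<in> G 1 \<Longrightarrow> y \<in> G 1 \<Longrightarrow> x + y \<in> G 1"
    and "x \<in> G 1 \<Longrightarrow> a *s x \<in> G 1" and "qm1 Q *s x \<in> G 1"
proof -
  from assms obtain e and \<rho> :: "'n \<Rightarrow> nat" where basis: "is_basis e" and \<rho>: "\<And>\<nu>. \<rho> \<nu> \<in> {0, 1}"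
    and G: "\<And>r. r \<in> {0, 1} \<Longrightarrow> G r = {\<Sum>\<nu>\<in>UNIV. c \<nu> *s e \<nu> | c. \<forall>\<nu>. c \<nu> \<in> fil_q Q (int r - int (\<rho> \<nu>))}"
    unfolding adapted_filtration_def by blast
  define F where "F = fil_q Q"
  have F_neg: "F i = UNIV" if "i \<le> 0" for i using that by (auto simp: F_def fil_q_def)
  have F_add: "u + v \<in> F i" if "u \<in> F i" "v \<in> F i" for u v i
    using that by (auto simp: F_def fil_q_def simp flip: distrib_left)
  have F_scale: "u * v \<in> F i" if v: "v \<in> F i" for u v i
  proof -
    obtain w where "v = qm1 Q ^ nat i * w" using v by (auto simp: F_def fil_q_def)
    then have "u * v = qm1 Q ^ nat i * (u * w)" by (simp add: mult.left_commute)
    then show ?thesis unfolding F_def fil_q_def by (rule range_eqI)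
  qed
  have F_1: "qm1 Q * v \<in> F i" if "i \<le> 1" for v i
  proof (cases "i \<le> 0")
    case False
    then have "i = 1" using that by simp
    then show ?thesis by (simp add: F_def fil_q_def)
  qed (simp add: F_neg)
  have span: "\<exists>c. x = (\<Sum>\<nu>\<in>UNIV. c \<nu> *s e \<nu>)" for x
    using basis unfolding is_basis_def by (metis ex1_implies_ex)
  have G0: "G 0 = {\<Sum>\<nu>\<in>UNIV. c \<nu> *s e \<nu> | c. \<forall>\<nu>. c \<nu> \<in> F (0 - int (\<rho> \<nu>))}"
    and G1: "G 1 = {\<Sum>\<nu>\<in>UNIV. c \<nu> *s e \<nu> | c. \<forall>\<nu>. c \<nu> \<in> F (1 - int (\<rho> \<nu>))}"
    using G[of 0] G[of 1] by (simp_all add: F_def)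
  show "G 0 = UNIV" unfolding G0 using span by (auto simp: F_neg)
  show "x + y \<in> G 1" if xy: "x \<in> G 1" "y \<in> G 1"
  proof -
    obtain c d where "x = (\<Sum>\<nu>\<in>UNIV. c \<nu> *s e \<nu>)" "y = (\<Sum>\<nu>\<in>UNIV. d \<nu> *s e \<nu>)"
      and cd: "\<And>\<nu>. c \<nu> \<in> F (1 - int (\<rho> \<nu>))" "\<And>\<nu>. d \<nu> \<in> F (1 - int (\<rho> \<nu>))"
      using xy unfolding G1 by blast
    then have "x + y = (\<Sum>\<nu>\<in>UNIV. (c \<nu> + d \<nu>) *s e \<nu>)"
      by (simp add: vec_eq_iff sum.distrib distrib_right)
    moreover have "\<forall>\<nu>. c \<nu> + d \<nu> \<in> F (1 - int (\<rho> \<nu>))" using cd F_add by blast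
    ultimately show ?thesis unfolding G1 by (intro CollectI exI[of _ "\<lambda>\<nu>. c \<nu> + d \<nu>"]) simp
  qed
  show "a *s x \<in> G 1" if x: "x \<in> G 1"
  proof -
    obtain c where "x = (\<Sum>\<nu>\<in>UNIV. c \<nu> *s e \<nu>)" and c: "\<And>\<nu>. c \<nu> \<in> F (1 - int (\<rho> \<nu>))"
      using x unfolding G1 by blast
    then have "a *s x = (\<Sum>\<nu>\<in>UNIV. (a * c \<nu>) *s e \<nu>)"
      by (simp add: vec_eq_iff sum_distrib_left mult.assoc)
    moreover have "\<forall>\<nu>. a * c \<nu> \<in> F (1 - int (\<rho> \<nu>))" using c F_scale by blast
    ultimately show ?thesis unfolding G1 by (intro CollectI exI[of _ "\<lambda>\<nu>. a * c \<nu>"]) simp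
  qed
  show "qm1 Q *s x \<in> G 1"
  proof -
    obtain c where "x = (\<Sum>\<nu>\<in>UNIV. c \<nu> *s e \<nu>)" using span by blast
    then have "qm1 Q *s x = (\<Sum>\<nu>\<in>UNIV. (qm1 Q * c \<nu>) *s e \<nu>)"
      by (simp add: vec_eq_iff sum_distrib_left mult.assoc)
    moreover have "\<forall>\<nu>. qm1 Q * c \<nu> \<in> F (1 - int (\<rho> \<nu>))" using F_1 by simp
    ultimately show ?thesis unfolding G1 by (intro CollectI exI[of _ "\<lambda>\<nu>. qm1 Q * c \<nu>"]) simp
  qed
qed

lemma module_hom_vecI:
  fixes f :: "'r :: comm_ring_1 ^ 'n \<Rightarrow> 'r ^ 'm"
  assumes "\<And>x y. f (x + y) = f x + f y" "\<And>a x. f (a *s x) = a *s f x"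
  shows "module_hom (*s) (*s) f"
  using assms by (intro module_hom.intro module_vec) (simp add: module_hom_axioms_def)

lemma vec_scale_power2: "c ^ 2 *s x = c *s (c *s x)" for c :: "'r :: comm_ring_1"
  by (simp add: vec_eq_iff power2_eq_square mult.assoc)

text \<open>\<open>[p]_q\<close> reduces to \<open>p\<close> modulo \<open>q - 1\<close>, hence is
  not a zero divisor there; cancelling one factor \<open>q - 1\<close> at a time extends this to the
  square.\<close>

lemma q1_sq_dvd_cancel:
  assumes "q1_R' ^ 2 dvd pq_R' * (x :: 'p :: prime_card R')"
  shows "q1_R' ^ 2 dvd x"
proof -
  have cancel: "q1_R' dvd y" if "q1_R' dvd pq_R' * y" for y :: "'p R'"
  proof -
    have "mod_q1 (pq_R' * y) = 0" using that q1_R'_dvd_iff by blast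
    then have "fps_const (of_nat CARD('p)) * mod_q1 y = 0" by (simp add: mod_q1.hom_mult)
    moreover have "fps_const (of_nat CARD('p)) \<noteq> (0 :: 'p R)"
      using CARD_prime_neq_0[where 'p = 'p] by simp
    ultimately have "mod_q1 y = 0" by (simp only: mult_eq_0_iff) simp
    then show ?thesis using q1_R'_dvd_iff by blast
  qed
  obtain k where "pq_R' * x = q1_R' ^ 2 * k" using assms by (rule dvdE)
  then have k: "pq_R' * x = q1_R' * (q1_R' * k)" by (simp only: power2_eq_square mult.assoc)
  then have "q1_R' dvd pq_R' * x" by (rule dvdI)
  then have "q1_R' dvd x" by (rule cancel)
  then obtain y where y: "x = q1_R' * y" by (rule dvdE)
  have "q1_R' * (pq_R' * y) = q1_R' * (q1_R' * k)" using k by (simp only: y mult_ac)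
  then have "pq_R' * y = q1_R' * k" using q1_R'_neq_0[where 'p = 'p] by (simp only: mult_cancel_left) simp
  then have "q1_R' dvd pq_R' * y" by (rule dvdI)
  then have "q1_R' dvd y" by (rule cancel)
  then show ?thesis unfolding y power2_eq_square by (intro mult_dvd_mono dvd_refl)
qed

context
  fixes e b :: "'p :: prime_card R'" and X :: "('p R', 2) mf_obj"
    and g :: "'p R'_mod ^ 2 \<Rightarrow> 'p R'_mod ^ 2"
  assumes odd_p: "odd CARD('p)" and e: "e = 1 \<or> e = - 1"
    and b: "gamma_R' b - b = q1_R' * (e * (gq - phi_R' gq))"
    and X: "MF ring_R' X"
    and g: "mf_iso (reduce_mf (obj_M' (phiM e b))) (reduce_mf X) g"
begin

lemma X_frob: "semilinear phi_R' (frob X)" and X_act: "semilinear gamma_R' (act X)"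
  and X_fil1: "x \<in> fil X 1 \<Longrightarrow> \<exists>y. frob X x = pq_R' *s y"
  and X_comm: "act X (frob X x) = frob X (act X x)"
  and X_adapted: "adapted_filtration (fil_q ring_R') (fil X)"
proof -
  show "semilinear phi_R' (frob X)" "semilinear gamma_R' (act X)" "adapted_filtration (fil_q ring_R') (fil X)"
    using X by (simp_all add: MF_def strong_frobenius_def)
  have "act X \<circ> frob X = frob X \<circ> act X" using X by (simp add: MF_def)
  then show "act X (frob X x) = frob X (act X x)" by (simp add: fun_eq_iff)
  have "frob X ` fil X 1 \<subseteq> range (\<lambda>y. pq_R' ^ 1 *s y)"
    using X unfolding MF_def strong_frobenius_def ring_R'_simps by blast
  then show "x \<in> fil X 1 \<Longrightarrow> \<exists>y. frob X x = pq_R' *s y" by auto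
qed

lemmas fil_X = adapted_filtration_q[OF X_adapted, unfolded ring_R'_simps]

lemma g_props: "bij g" "g (u + v) = g u + g v" "g (a *s u) = a *s g u"
  "g (vmod (phiM e b m)) = frob (reduce_mf X) (g (vmod m))"
  "g (vmod (actM m)) = act (reduce_mf X) (g (vmod m))"
  "m \<in> fil (obj_M' (phiM e b)) 1 \<Longrightarrow> \<exists>n\<in>fil X 1. vmod n = g (vmod m)"
  "x \<in> fil X 1 \<Longrightarrow> \<exists>m\<in>fil (obj_M' (phiM e b)) 1. g (vmod m) = vmod x"
proof -
  note M = reduce_mf_simps[OF MF_M'[OF odd_p e b], unfolded frob_M' act_M'] and XX = reduce_mf_simps[OF X]
  have lin: "module_hom (*s) (*s) g" and fil: "g ` fil (reduce_mf (obj_M' (phiM e b))) 1 \<subseteq> fil (reduce_mf X) 1"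
    and fil': "inv g ` fil (reduce_mf X) 1 \<subseteq> fil (reduce_mf (obj_M' (phiM e b))) 1"
    and comm: "g \<circ> frob (reduce_mf (obj_M' (phiM e b))) = frob (reduce_mf X) \<circ> g"
      "g \<circ> act (reduce_mf (obj_M' (phiM e b))) = act (reduce_mf X) \<circ> g" and bij: "bij g"
    using g unfolding mf_iso_def filmod_hom_def by simp_all
  show "bij g" by fact
  show "g (u + v) = g u + g v" "g (a *s u) = a *s g u"
    using lin by (simp_all add: module_hom.add module_hom.scale)
  show "g (vmod (phiM e b m)) = frob (reduce_mf X) (g (vmod m))"
    using fun_cong[OF comm(1), of "vmod m"] by (simp add: M)
  show "g (vmod (actM m)) = act (reduce_mf X) (g (vmod m))"
    using fun_cong[OF comm(2), of "vmod m"] by (simp add: M)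
  show "\<exists>n\<in>fil X 1. vmod n = g (vmod m)" if "m \<in> fil (obj_M' (phiM e b)) 1"
  proof -
    have "g (vmod m) \<in> vmod ` fil X 1" using fil that unfolding M XX by blast
    then show ?thesis by auto
  qed
  show "\<exists>m\<in>fil (obj_M' (phiM e b)) 1. g (vmod m) = vmod x" if "x \<in> fil X 1"
  proof -
    have "inv g (vmod x) \<in> vmod ` fil (obj_M' (phiM e b)) 1" using fil' that unfolding M XX by blast
    then obtain m where "m \<in> fil (obj_M' (phiM e b)) 1" "inv g (vmod x) = vmod m" by auto
    moreover from this have "g (vmod m) = vmod x" using bij by (metis bij_is_surj surj_f_inv_f)
    ultimately show ?thesis by blast
  qed
qed

lemma vmod_frob: "vmod n = g (vmod m) \<Longrightarrow> vmod (frob X n) = g (vmod (phiM e b m))"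
  using reduce_mf_simps(1)[OF X, of n] g_props(4)[of m] by simp

lemma vmod_act: "vmod n = g (vmod m) \<Longrightarrow> vmod (act X n) = g (vmod (actM m))"
  using reduce_mf_simps(2)[OF X, of n] g_props(5)[of m] by simp

lemma g_linear: "vmod n = g (vmod m) \<Longrightarrow> vmod n' = g (vmod m') \<Longrightarrow> vmod (x *s n + y *s n') = g (vmod (x *s m + y *s m'))"
  by (simp add: vmod_add vmod_scale g_props)

lemma frob_q1_sq: "frob X (q1_R' ^ 2 *s x) = q1_R' ^ 2 *s (pq_R' ^ 2 *s frob X x)"
  unfolding semilinear_scale[OF X_frob] phi_R'.hom_power phi_R'_q1 by (simp add: vec_eq_iff power_mult_distrib)

lemma q1_sq_cancel: "q1_R' ^ 2 *s x = q1_R' ^ 2 *s y \<Longrightarrow> x = (y :: 'p R' ^ 2)"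
  using q1_R'_neq_0[where 'p = 'p] by (simp add: vec_eq_iff)

lemma pq_neq_0: "(pq_R' :: 'p R') \<noteq> 0"
  using qnat_neq_0[of "CARD('p)", where 'p = 'p] CARD_prime_neq_0[where 'p = 'p] by simp

lemma pq_cancel: "pq_R' *s x = pq_R' *s y \<Longrightarrow> x = (y :: 'p R' ^ 2)"
  using pq_neq_0 by (simp add: vec_eq_iff)

lemma in_adic_pq_mult: "in_adic 1 (c * pq_R' :: 'p R')"
  by (rule in_adic_mult_right[OF in_adic_pq])

lemma ee: "e * e = 1"
  using e by auto

text \<open>Any lift \<open>V0\<close> satisfies \<open>F V0 = e V0 + (q - 1)^2 z\<close>, with
  \<open>F\<close> the Frobenius of \<open>X\<close>. Correcting it by \<open>(q - 1)^2 x\<close>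
  requires \<open>e x = z + [p]_q^2 F x\<close>, a contracting equation. The failure of the result
  to be fixed by \<gamma> then solves the homogeneous equation, hence is 0.\<close>

lemma lift_vM:
  "\<exists>V. vmod V = g (vmod vM) \<and> frob X V = e *s V \<and> act X V = V"
proof -
  define V0 where "V0 = vec_map rep_R'_mod (g (vmod vM))"
  have V0: "vmod V0 = g (vmod vM)" by (simp add: V0_def)
  have "vmod (frob X V0) = vmod (e *s V0)"
    using vmod_frob[OF V0] V0 by (simp add: phiM_vM[OF odd_p e b] vmod_scale g_props)
  then obtain z where z: "frob X V0 = e *s V0 + q1_R' ^ 2 *s z" using vmod_eq_iff by blast
  have "in_adic 1 (e * pq_R' * pq_R' :: 'p R')" by (rule in_adic_pq_mult)
  then obtain x where x: "x = e *s z + (e * pq_R' * pq_R') *s frob X x"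
    using semilinear_fixpoint_exists[OF X_frob] by blast
  define V where "V = V0 + q1_R' ^ 2 *s x"
  have V: "vmod V = g (vmod vM)" using V0 vmod_eq_iff[of V V0] by (auto simp: V_def)
  have "e *s x = e *s (e *s z + (e * pq_R' * pq_R') *s frob X x)" using x by (rule arg_cong)
  also have "\<dots> = (e * e) *s z + (e * e) *s (pq_R' ^ 2 *s frob X x)"
    by (simp add: vec_eq_iff algebra_simps power2_eq_square)
  finally have ex: "e *s x = z + pq_R' ^ 2 *s frob X x" unfolding ee by simp
  have "frob X V = e *s V0 + q1_R' ^ 2 *s (z + pq_R' ^ 2 *s frob X x)"
    unfolding V_def semilinear_add[OF X_frob] frob_q1_sq z by (simp add: vec_eq_iff distrib_left)
  also have "\<dots> = e *s V" unfolding ex[symmetric] V_def by (simp add: vec_eq_iff algebra_simps)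
  finally have frobV: "frob X V = e *s V" .
  have "vmod (act X V) = vmod V" using vmod_act[OF V] V by (simp add: actM_vM[OF odd_p])
  then obtain y where y: "act X V = V + q1_R' ^ 2 *s y" using vmod_eq_iff by blast
  have "frob X (act X V) = e *s act X V"
    unfolding X_comm[symmetric] frobV semilinear_scale[OF X_act] e_simps(3)[OF odd_p e b] ..
  then have "q1_R' ^ 2 *s (pq_R' ^ 2 *s frob X y) = q1_R' ^ 2 *s (e *s y)"
    unfolding y semilinear_add[OF X_frob] frob_q1_sq frobV by (simp add: vec_eq_iff algebra_simps)
  then have "pq_R' ^ 2 *s frob X y = e *s y" by (rule q1_sq_cancel)
  then have "e *s (pq_R' ^ 2 *s frob X y) = (e * e) *s y" by (simp add: vec_eq_iff mult.assoc)
  then have "y = (e * pq_R' * pq_R') *s frob X y"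
    unfolding ee by (simp add: vec_eq_iff power2_eq_square mult.assoc)
  then have "y = 0" using semilinear_fixpoint_unique[OF X_frob in_adic_pq_mult] by blast
  then show ?thesis using V frobV y by (intro exI[of _ V]) simp
qed

text \<open>The argument for \<open>V\<close>, with Frobenius divided by \<open>[p]_q\<close>. The
  lift is taken in \<open>Fil^1\<close> so that the division is possible; of the two factors
  \<open>[p]_q\<close> produced by \<open>\<phi>((q - 1)^2)\<close> one survives it, which keeps the
  equation for the correction contracting.\<close>

lemma lift_wM:
  assumes V: "vmod V = g (vmod vM)" "frob X V = e *s V" "act X V = V"
  shows "\<exists>W. vmod W = g (vmod wM) \<and> W \<in> fil X 1 \<and> frob X W = pq_R' *s (e *s W + b *s V)
    \<and> act X W = W - (q1_R' * gq) *s V"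
proof -
  have "wM \<in> fil (obj_M' (phiM e b)) 1" unfolding fil_M'_1 by (simp add: wM_nth)
  then obtain W0 where W0: "W0 \<in> fil X 1" "vmod W0 = g (vmod wM)" using g_props(6) by blast
  obtain y where y: "frob X W0 = pq_R' *s y" using X_fil1[OF W0(1)] by blast
  have "vmod (frob X W0) = g (vmod (pq_R' *s (e *s wM + b *s vM)))"
    using vmod_frob[OF W0(2)] unfolding phiM_wM[OF odd_p e b] .
  also have "\<dots> = vmod (pq_R' *s (e *s W0 + b *s V))"
    unfolding vmod_scale[of pq_R'] g_props(3) g_linear[OF W0(2) V(1), symmetric] ..
  finally have "q1_R' ^ 2 dvd pq_R' * (y $ i - (e *s W0 + b *s V) $ i)" for i
    unfolding y vec_eq_iff by (simp add: abs_R'_mod_eq_iff right_diff_distrib)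
  then have "q1_R' ^ 2 dvd y $ i - (e *s W0 + b *s V) $ i" for i by (rule q1_sq_dvd_cancel)
  then have "vmod y = vmod (e *s W0 + b *s V)" by (simp add: vec_eq_iff abs_R'_mod_eq_iff)
  then obtain z where z: "y = e *s W0 + b *s V + q1_R' ^ 2 *s z" using vmod_eq_iff by blast
  obtain x where x: "x = e *s z + (e * pq_R') *s frob X x"
    using semilinear_fixpoint_exists[OF X_frob in_adic_pq_mult] by blast
  define W where "W = W0 + q1_R' ^ 2 *s x"
  have W: "vmod W = g (vmod wM)" using W0 vmod_eq_iff[of W W0] by (auto simp: W_def)
  have W1: "W \<in> fil X 1" unfolding W_def vec_scale_power2 by (rule fil_X(2)[OF W0(1) fil_X(4)])
  have "e *s x = e *s (e *s z + (e * pq_R') *s frob X x)" using x by (rule arg_cong)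
  also have "\<dots> = (e * e) *s z + (e * e) *s (pq_R' *s frob X x)"
    by (simp add: vec_eq_iff algebra_simps)
  finally have ex: "e *s x = z + pq_R' *s frob X x" unfolding ee by simp
  have "frob X W = pq_R' *s (e *s W0 + b *s V + q1_R' ^ 2 *s (z + pq_R' *s frob X x))"
    unfolding W_def semilinear_add[OF X_frob] frob_q1_sq y z
    by (simp add: vec_eq_iff algebra_simps power2_eq_square)
  also have "\<dots> = pq_R' *s (e *s W + b *s V)"
    unfolding ex[symmetric] W_def by (simp add: vec_eq_iff algebra_simps)
  finally have frobW: "frob X W = pq_R' *s (e *s W + b *s V)" .
  have "actM wM = 1 *s wM + (- (q1_R' * gq)) *s (vM :: 'p R' ^ 2)"
    unfolding actM_wM[OF odd_p] by (simp add: vec_eq_iff)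
  then have "vmod (act X W) = g (vmod (1 *s wM + (- (q1_R' * gq)) *s vM))"
    using vmod_act[OF W] by simp
  also have "\<dots> = vmod (W - (q1_R' * gq) *s V)"
    unfolding g_linear[OF W V(1), symmetric] by (simp add: vec_map_def vec_eq_iff)
  finally obtain u where u: "act X W = W - (q1_R' * gq) *s V + q1_R' ^ 2 *s u" using vmod_eq_iff by blast
  have b': "gamma_R' b = b + q1_R' * (e * (gq - phi_R' gq))" using b by (simp add: algebra_simps)
  have "frob X (act X W) = pq_R' *s (e *s act X W + gamma_R' b *s V)"
    unfolding X_comm[symmetric] frobW semilinear_scale[OF X_act] semilinear_add[OF X_act] V(3)
      e_simps(3)[OF odd_p e b] gamma_pq ..
  moreover have "frob X (act X W) = pq_R' *s (e *s W + b *s V) - (q1_R' * pq_R' * phi_R' gq) *s (e *s V)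
      + q1_R' ^ 2 *s (pq_R' ^ 2 *s frob X u)"
    unfolding u semilinear_add[OF X_frob] semilinear_diff[OF X_frob] frob_q1_sq
    unfolding semilinear_scale[OF X_frob] frobW V(2) phi_R'.hom_mult phi_R'_q1 ..
  moreover have "pq_R' *s (e *s act X W + gamma_R' b *s V) = pq_R' *s (e *s W + b *s V)
      - (q1_R' * pq_R' * phi_R' gq) *s (e *s V) + q1_R' ^ 2 *s (pq_R' *s (e *s u))"
    unfolding u b' by (simp add: vec_eq_iff algebra_simps)
  ultimately have "q1_R' ^ 2 *s (pq_R' ^ 2 *s frob X u) = q1_R' ^ 2 *s (pq_R' *s (e *s u))" by simp
  then have "pq_R' ^ 2 *s frob X u = pq_R' *s (e *s u)" by (rule q1_sq_cancel)
  then have "pq_R' *s (pq_R' *s frob X u) = pq_R' *s (e *s u)" unfolding vec_scale_power2 .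
  then have "pq_R' *s frob X u = e *s u" by (rule pq_cancel)
  then have "e *s (pq_R' *s frob X u) = (e * e) *s u" by (simp add: vec_eq_iff mult.assoc)
  then have "u = (e * pq_R') *s frob X u" unfolding ee by (simp add: vec_eq_iff mult.assoc)
  then have "u = 0" using semilinear_fixpoint_unique[OF X_frob in_adic_pq_mult] by blast
  then have "act X W = W - (q1_R' * gq) *s V" using u by simp
  then show ?thesis using W W1 frobW by blast
qed

lemma lift_iso: "\<exists>\<Psi>. mf_iso (obj_M' (phiM e b)) X \<Psi> \<and> (\<forall>m. vmod (\<Psi> m) = g (vmod m))"
proof -
  obtain V where V: "vmod V = g (vmod vM)" "frob X V = e *s V" "act X V = V" using lift_vM by blast
  obtain W where W: "vmod W = g (vmod wM)" "W \<in> fil X 1" "frob X W = pq_R' *s (e *s W + b *s V)"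
    "act X W = W - (q1_R' * gq) *s V" using lift_wM[OF V] by blast
  define \<Psi> where "\<Psi> m = det2 m vM *s W + det2 wM m *s V" for m
  have \<Psi>_add: "\<Psi> (x + y) = \<Psi> x + \<Psi> y" and \<Psi>_scale: "\<Psi> (a *s x) = a *s \<Psi> x" for a x y
    by (simp_all add: \<Psi>_def det2_simps vec_eq_iff algebra_simps)
  have \<Psi>_w: "\<Psi> wM = W" and \<Psi>_v: "\<Psi> vM = V"
    by (simp_all add: \<Psi>_def det2_simps det2_wM_vM[OF odd_p])
  have vmod_\<Psi>: "vmod (\<Psi> m) = g (vmod m)" for m
    unfolding \<Psi>_def g_linear[OF W(1) V(1)] by (simp flip: decomp_wv[OF odd_p])
  \<comment> \<open>Modulo \<open>(q - 1)^2\<close> the map is the bijection \<open>g\<close>, so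
    its image contains vectors congruent to \<open>e1'\<close> and \<open>e2\<close>. Their
    determinant is a unit and a multiple of \<open>det2 W V\<close>.\<close>
  have det: "det2 W V dvd 1"
  proof -
    have "\<exists>n z. \<Psi> n = y + q1_R' ^ 2 *s z" for y
    proof -
      obtain u where "vmod y = g u" using g_props(1) by (metis bij_pointE)
      then have "vmod (\<Psi> (vec_map rep_R'_mod u)) = vmod y" by (simp add: vmod_\<Psi>)
      then show ?thesis using vmod_eq_iff by blast
    qed
    then obtain n1 z1 n2 z2 where n: "\<Psi> n1 = e1' + q1_R' ^ 2 *s z1" "\<Psi> n2 = e2 + q1_R' ^ 2 *s z2" by metis
    have "det2 W V dvd det2 (\<Psi> n1) (\<Psi> n2)"
      unfolding \<Psi>_def det2_simps det2_swap[of V W] by simp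
    moreover have "det2 (\<Psi> n1) (\<Psi> n2) dvd 1"
      unfolding n by (simp add: det2_def fps_dvd_1_iff q1_R'_def power2_eq_square)
    ultimately show ?thesis by (rule dvd_trans)
  qed
  then obtain d where "1 = det2 W V * d" by (rule dvdE)
  then have d: "d * det2 W V = 1" by (metis mult.commute)
  define \<Psi>' where "\<Psi>' y = (d * det2 y V) *s wM + (d * det2 W y) *s vM" for y
  have inv1: "\<Psi> (\<Psi>' y) = y" for y
  proof -
    have "\<Psi> (\<Psi>' y) = d *s (det2 y V *s W + det2 W y *s V)"
      unfolding \<Psi>'_def \<Psi>_add \<Psi>_scale \<Psi>_w \<Psi>_v by (simp add: vec_eq_iff distrib_left mult.assoc)
    also have "\<dots> = d *s (det2 W V *s y)" by (subst (3) det2_cramer) (rule refl)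
    also have "\<dots> = y" by (simp add: vec_eq_iff d flip: mult.assoc)
    finally show ?thesis .
  qed
  have inv2: "\<Psi>' (\<Psi> m) = m" for m
  proof -
    have "det2 (\<Psi> m) V = det2 m vM * det2 W V" "det2 W (\<Psi> m) = det2 wM m * det2 W V"
      by (simp_all add: \<Psi>_def det2_simps)
    then have "\<Psi>' (\<Psi> m) = (d * det2 W V * det2 m vM) *s wM + (d * det2 W V * det2 wM m) *s vM"
      by (simp add: \<Psi>'_def mult_ac)
    then show ?thesis unfolding d by (simp flip: decomp_wv[OF odd_p])
  qed
  have bij: "bij \<Psi>" by (rule bij_betw_byWitness[of _ \<Psi>']) (auto simp: inv1 inv2)
  have inv: "inv \<Psi> = \<Psi>'" by (rule inv_equality) (auto simp: inv1 inv2)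
  have frob: "\<Psi> (phiM e b m) = frob X (\<Psi> m)" for m
  proof -
    have "\<Psi> (phiM e b m) = phi_R' (det2 m vM) *s (pq_R' *s (e *s W + b *s V)) + phi_R' (det2 wM m) *s (e *s V)"
      by (simp only: phiM_def \<Psi>_add \<Psi>_scale \<Psi>_w \<Psi>_v)
    also have "\<dots> = frob X (\<Psi> m)"
      unfolding \<Psi>_def semilinear_add[OF X_frob] semilinear_scale[OF X_frob] W(3) V(2) ..
    finally show ?thesis .
  qed
  have act: "\<Psi> (actM m) = act X (\<Psi> m)" for m
  proof -
    have "actM m = gamma_R' (det2 m vM) *s (wM - (q1_R' * gq) *s vM) + gamma_R' (det2 wM m) *s vM"
      by (subst decomp_wv[OF odd_p, of m]) (simp only: actM_add actM_scale actM_wM[OF odd_p] actM_vM[OF odd_p])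
    also have "wM - (q1_R' * gq) *s vM = wM + (- (q1_R' * gq)) *s vM" by (simp add: vec_eq_iff)
    finally have "\<Psi> (actM m) = gamma_R' (det2 m vM) *s (W + (- (q1_R' * gq)) *s V) + gamma_R' (det2 wM m) *s V"
      by (simp only: \<Psi>_add \<Psi>_scale \<Psi>_w \<Psi>_v)
    also have "W + (- (q1_R' * gq)) *s V = act X W" unfolding W(4) by (simp add: vec_eq_iff)
    also have "gamma_R' (det2 m vM) *s act X W + gamma_R' (det2 wM m) *s V = act X (\<Psi> m)"
      unfolding \<Psi>_def semilinear_add[OF X_act] semilinear_scale[OF X_act] V(3) ..
    finally show ?thesis .
  qed
  have fil1: "\<Psi> m \<in> fil X 1" if m: "m \<in> fil (obj_M' (phiM e b)) 1" for m
  proof -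
    have "q1_R' dvd m $ 2" using m unfolding fil_M'_1 by simp
    then have "q1_R' dvd det2 wM m" by (simp add: det2_def wM_nth)
    then obtain c where "det2 wM m = q1_R' * c" by (rule dvdE)
    then have "det2 wM m *s V = q1_R' *s (c *s V)" by (simp add: vec_eq_iff mult.assoc)
    then show ?thesis unfolding \<Psi>_def using fil_X(2)[OF fil_X(3)[OF W(2)] fil_X(4)] by simp
  qed
  \<comment> \<open>\<open>g\<close> controls the filtration only modulo \<open>(q - 1)^2\<close>;
    the error is harmless because \<open>(q - 1) M'\<close> lies in \<open>Fil^1 M'\<close>.\<close>
  have fil1': "\<Psi>' x \<in> fil (obj_M' (phiM e b)) 1" if x: "x \<in> fil X 1" for x
  proof -
    obtain m where m: "m \<in> fil (obj_M' (phiM e b)) 1" "g (vmod m) = vmod x" using g_props(7)[OF x] by blast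
    then have "vmod x = vmod (\<Psi> m)" by (simp add: vmod_\<Psi>)
    then obtain z where "x = \<Psi> m + q1_R' ^ 2 *s z" using vmod_eq_iff by blast
    then have "x = \<Psi> (m + q1_R' ^ 2 *s \<Psi>' z)" by (simp add: \<Psi>_add \<Psi>_scale inv1)
    then have "\<Psi>' x = m + q1_R' ^ 2 *s \<Psi>' z" by (simp add: inv2)
    then show ?thesis using m(1) unfolding fil_M'_1 by (simp add: power2_eq_square mult.assoc)
  qed
  have lin': "\<Psi>' (x + y) = \<Psi>' x + \<Psi>' y" "\<Psi>' (a *s x) = a *s \<Psi>' x" for a x y
    by (simp_all add: \<Psi>'_def det2_simps vec_eq_iff algebra_simps)
  have frob': "\<Psi>' (frob X x) = phiM e b (\<Psi>' x)" for x
    using arg_cong[OF frob[of "\<Psi>' x"], of \<Psi>'] by (simp add: inv1 inv2)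
  have "mf_iso (obj_M' (phiM e b)) X \<Psi>"
    unfolding mf_iso_def filmod_hom_def inv frob_M' act_M'
  proof (intro conjI)
    show "module_hom (*s) (*s) \<Psi>" by (rule module_hom_vecI[OF \<Psi>_add \<Psi>_scale])
    show "module_hom (*s) (*s) \<Psi>'" by (rule module_hom_vecI[OF lin'])
    show "\<forall>r\<in>{0, 1}. \<Psi> ` fil (obj_M' (phiM e b)) r \<subseteq> fil X r"
      using fil1 fil_X(1) by auto
    show "\<forall>r\<in>{0, 1}. \<Psi>' ` fil X r \<subseteq> fil (obj_M' (phiM e b)) r"
      using fil1' fil_M'_0[of "phiM e b"] by auto
  qed (auto simp: bij frob frob' act)
  then show ?thesis using vmod_\<Psi> by blast
qed

end

section \<open>The classical object\<close>

lemma compare_H0_nth: "compare_H0 y $ 1 = y $ 1" "compare_H0 y $ 2 = - y $ 2"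
  by (simp_all add: compare_H0_def omega_def eta_def axis_def)

lemma compare_H0_compare_H0 [simp]: "compare_H0 (compare_H0 y) = y"
  by (simp add: vec_eq_iff forall_2 compare_H0_nth)

lemma omega_nth [simp]: "omega $ 1 = 1" "omega $ 2 = 0"
  and eta_nth [simp]: "eta $ 1 = 0" "eta $ 2 = 1"
  by (simp_all add: omega_def eta_def axis_def)

lemma module_hom_compare_H0: "module_hom (*s) (*s) compare_H0"
  by (rule module_hom_vecI) (simp_all add: vec_eq_iff forall_2 compare_H0_nth)

text \<open>The surjection from \<open>M'\<close> to \<open>H_0\<close> behind the comparison
  isomorphism. Working with it avoids choosing representatives: it intertwines the connections and,
  for the final choice of Frobenius, the Frobenius maps.\<close>

definition red_H0 :: "'p :: prime_card R' ^ 2 \<Rightarrow> 'p R ^ 2"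
  where "red_H0 m = compare_H0 (vec_map mod_q1 m)"

lemma red_H0_nth: "red_H0 m $ 1 = mod_q1 (m $ 1)" "red_H0 m $ 2 = - mod_q1 (m $ 2)"
  by (simp_all add: red_H0_def compare_H0_nth)

lemma red_H0_add: "red_H0 (x + y) = red_H0 x + red_H0 y"
  by (simp add: vec_eq_iff forall_2 red_H0_nth mod_q1.hom_add)

lemma red_H0_scale: "red_H0 (a *s x) = mod_q1 a *s red_H0 x"
  by (simp add: vec_eq_iff forall_2 red_H0_nth mod_q1.hom_mult)

lemma red_H0_incl: "red_H0 (vec_map incl_A y) = compare_H0 y"
  by (simp add: red_H0_def vec_map_def)

lemma nabla_H0_nth:
  "nabla_H0 x $ 1 = fps_X * fps_deriv (x $ 1) + x $ 2 * fps_X * fps_const (exquo 1 4)"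
  "nabla_H0 x $ 2 = x $ 1 * exquo 1 (1 - fps_X) + fps_X * fps_deriv (x $ 2)"
  by (simp_all add: nabla_H0_def)

lemma nabla_H0_add: "nabla_H0 (x + y) = nabla_H0 x + nabla_H0 y"
  by (simp add: vec_eq_iff forall_2 nabla_H0_nth algebra_simps)

lemma nabla_H0_scale: "nabla_H0 (a *s x) = (fps_X * fps_deriv a) *s x + a *s nabla_H0 x"
  by (simp add: vec_eq_iff forall_2 nabla_H0_nth algebra_simps)

lemma inverse_unique: "(b :: 'a :: comm_ring_1) * x = 1 \<Longrightarrow> b * y = 1 \<Longrightarrow> x = y"
  by (metis mult.commute mult.left_commute mult_1_right)

text \<open>\<open>vbar\<close> is the horizontal vector \<open>hyper *s e2_bar\<close>, and
  \<open>wbar\<close> is \<open>omega\<close> divided by \<open>hyper\<close>; in this basis the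
  classical formulas have the same shape as those for \<open>vM\<close> and
  \<open>wM\<close>.\<close>

definition vbar :: "'p :: prime_card R ^ 2" where "vbar = red_H0 vM"

definition wbar :: "'p :: prime_card R ^ 2" where "wbar = red_H0 wM"

definition uA :: "'p :: prime_card R" where "uA = mod_q1 (exquo 1 fq)"

definition gA :: "'p :: prime_card R" where "gA = mod_q1 gq"

context
  assumes odd_p: "odd CARD('p :: prime_card)"
begin

lemma quarter: "exquo 1 4 = (half * half :: 'p padic_int)"
proof (rule exquo_eqI)
  have "4 * (half * half) = (2 * half) * (2 * half :: 'p padic_int)" by simp
  then show "4 * (half * half) = (1 :: 'p padic_int)" unfolding two_half[OF odd_p] by simp
qed simp

lemma qint_half_nth_0: "fps_nth (qint half :: 'p R) 0 = half"
  using arg_cong[OF X_qint_half[OF odd_p], of "\<lambda>y. fps_nth y 1"] sqrt_q_nth_1[OF odd_p] by simp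

lemma red_H0_nabla: "red_H0 (nabla_M' m) = nabla_H0 (red_H0 (m :: 'p R' ^ 2))"
proof -
  have "(1 - fps_X) * mod_q1 (exquo 1 (1 - fps_X)) = (1 :: 'p R)"
    using arg_cong[OF mult_exquo_unit[OF one_minus_X_unit, of "1 :: 'p R'"], of mod_q1]
    by (simp add: mod_q1.hom_simps)
  then have u: "mod_q1 (exquo 1 (1 - fps_X)) = (exquo 1 (1 - fps_X) :: 'p R)"
    using mult_exquo_unit[OF one_minus_X_unit] by (rule inverse_unique)
  have k: "mod_q1 (fps_const (qint half) ^ 2) = (fps_const (exquo 1 4) :: 'p R)"
    by (simp add: quarter power2_eq_square qint_half_nth_0)
  show ?thesis
    unfolding vec_eq_iff forall_2 red_H0_nth nabla_H0_nth nabla_M'_nth mod_q1.hom_add mod_q1.hom_diff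
      mod_q1.hom_mult k u mod_q1_d_q mod_q1_gamma_R' mod_q1_X mod_q1_q1_R'
    by (simp add: mult_ac)
qed

lemma hyper_uA: "hyper * uA = (1 :: 'p R)"
  using arg_cong[OF fq_inverse[OF odd_p], of mod_q1]
  by (simp only: mod_q1.hom_mult mod_q1.hom_one mod_q1_fq[OF odd_p] uA_def)

lemma hyper_unit: "(hyper :: 'p R) dvd 1"
  using hyper_uA by (metis dvdI)

lemma hyper_neq_0: "(hyper :: 'p R) \<noteq> 0"
  using hyper_uA by auto

lemma phi_hyper_unit: "phi_A (hyper :: 'p R) dvd 1"
  by (rule phi_A.hom_unit[OF hyper_unit])

lemma vbar_nth: "vbar $ 1 = fps_X * (1 - fps_X) * fps_deriv (hyper :: 'p R)" "vbar $ 2 = - (hyper :: 'p R)"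
  by (simp_all add: vbar_def red_H0_nth vM_nth f1q_def mod_q1.hom_simps mod_q1_d_q mod_q1_fq[OF odd_p])

lemma wbar_nth: "wbar $ 1 = (uA :: 'p R)" "wbar $ 2 = (0 :: 'p R)"
  by (simp_all add: wbar_def red_H0_nth wM_nth uA_def mod_q1.hom_zero)

lemma vbar_eq: "vbar = hyper *s (e2_bar :: 'p R ^ 2)"
  using mult_exquo_unit[OF hyper_unit, of "fps_deriv hyper"]
  by (simp add: vec_eq_iff forall_2 vbar_nth e2_bar_def mult.left_commute)

lemma e2_bar_eq: "e2_bar = (uA :: 'p R) *s vbar"
  using hyper_uA by (simp add: vbar_eq vec_eq_iff mult.assoc[symmetric] mult.commute[of uA])

lemma wbar_eq: "wbar = (uA :: 'p R) *s omega"
  by (simp add: vec_eq_iff forall_2 wbar_nth)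

lemma omega_eq: "omega = (hyper :: 'p R) *s wbar"
  using hyper_uA by (simp add: vec_eq_iff forall_2 wbar_nth)

lemma nabla_vbar: "nabla_H0 vbar = (0 :: 'p R ^ 2)"
  unfolding vbar_def red_H0_nabla[symmetric] nabla_vM[OF odd_p]
  by (simp add: vec_eq_iff forall_2 red_H0_nth mod_q1.hom_zero)

lemma nabla_wbar: "nabla_H0 wbar = - (gA :: 'p R) *s vbar"
  unfolding wbar_def red_H0_nabla[symmetric] nabla_wM[OF odd_p] red_H0_scale mod_q1.hom_uminus gA_def vbar_def ..

lemma det2_wbar_vbar: "det2 wbar vbar = (- 1 :: 'p R)"
  using hyper_uA by (simp add: det2_def wbar_nth vbar_nth mult.commute)

end

lemma phi_A_const [simp]: "phi_A (fps_const c) = fps_const c"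
  by (simp add: phi_A_def)

section \<open>The q-deformed Frobenius reduces to the classical one\<close>

context
  fixes \<Phi> :: "'p :: prime_card R ^ 2 \<Rightarrow> 'p R ^ 2"
  assumes odd_p: "odd CARD('p)" and frobenius: "crystalline_frobenius \<Phi>"
begin

definition epsA :: "'p R" where "epsA = (- 1) ^ ((CARD('p) - 1) div 2)"

lemma epsA: "epsA = 1 \<or> epsA = - 1"
  unfolding epsA_def using neg_one_even_power neg_one_odd_power by blast

lemma epsA_const: "phi_A epsA = epsA" "fps_deriv epsA = 0"
proof -
  have "phi_A 1 = (1 :: 'p R)" "phi_A (- 1) = (- 1 :: 'p R)"
    by (simp_all only: phi_A.hom_uminus phi_A.hom_one)
  then show "phi_A epsA = epsA" using epsA by metis
  have "fps_deriv 1 = (0 :: 'p R)" "fps_deriv (- 1) = (0 :: 'p R)" by simp_all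
  then show "fps_deriv epsA = 0" using epsA by metis
qed

lemma Phi_semilinear: "semilinear phi_A \<Phi>"
  using frobenius by (simp add: crystalline_frobenius_def)

lemmas Phi_add = semilinear_add[OF Phi_semilinear] and Phi_scale = semilinear_scale[OF Phi_semilinear]

lemma Phi_horizontal: "nabla_H0 (\<Phi> x) = of_nat CARD('p) *s \<Phi> (nabla_H0 x)"
  using frobenius by (simp add: crystalline_frobenius_def)

lemma Phi_vbar: "\<Phi> vbar = epsA *s vbar"
proof -
  have "\<Phi> e2_bar = (epsA * exquo hyper (phi_A hyper)) *s e2_bar"
    using frobenius unfolding crystalline_frobenius_def Let_def epsA_def by blast
  then have "\<Phi> vbar = (epsA * (phi_A hyper * exquo hyper (phi_A hyper))) *s e2_bar"
    unfolding vbar_eq[OF odd_p] Phi_scale by (simp add: vec_eq_iff mult_ac)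
  also have "phi_A hyper * exquo hyper (phi_A hyper) = (hyper :: 'p R)"
    by (rule mult_exquo_unit[OF phi_hyper_unit[OF odd_p]])
  finally show ?thesis unfolding vbar_eq[OF odd_p] by (simp add: vec_eq_iff mult.assoc)
qed

lemma Phi_wbar: "\<exists>bA. \<Phi> wbar = of_nat CARD('p) *s (epsA *s wbar + bA *s vbar)"
proof -
  obtain b where "\<Phi> omega = (of_nat CARD('p) * epsA * exquo (phi_A hyper) hyper) *s omega
      + (of_nat CARD('p) * b) *s e2_bar"
    using frobenius unfolding crystalline_frobenius_def Let_def epsA_def by blast
  then have "\<Phi> wbar = phi_A uA *s ((of_nat CARD('p) * epsA * exquo (phi_A hyper) hyper) *s (hyper *s wbar)
      + (of_nat CARD('p) * b) *s (uA *s vbar))"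
    unfolding wbar_eq[OF odd_p] Phi_scale e2_bar_eq[OF odd_p, symmetric] by (simp flip: omega_eq[OF odd_p] wbar_eq[OF odd_p])
  also have "\<dots> = of_nat CARD('p) *s ((epsA * (phi_A uA * (hyper * exquo (phi_A hyper) hyper))) *s wbar + (phi_A uA * b * uA) *s vbar)"
    by (simp add: vec_eq_iff algebra_simps)
  also have "hyper * exquo (phi_A hyper) hyper = (phi_A hyper :: 'p R)"
    by (rule mult_exquo_unit[OF hyper_unit[OF odd_p]])
  also have "phi_A uA * phi_A hyper = (1 :: 'p R)"
    unfolding phi_A.hom_mult[symmetric] using hyper_uA[OF odd_p] by (simp add: mult.commute phi_A.hom_one)
  finally show ?thesis by (intro exI[of _ "phi_A uA * b * uA"]) simp
qed

definition bA :: "'p R"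
  where "bA = (SOME bA. \<Phi> wbar = of_nat CARD('p) *s (epsA *s wbar + bA *s vbar))"

lemma Phi_wbar_bA: "\<Phi> wbar = of_nat CARD('p) *s (epsA *s wbar + bA *s vbar)"
  unfolding bA_def by (rule someI_ex[OF Phi_wbar])

lemma of_nat_CARD_neq_0: "of_nat CARD('p) \<noteq> (0 :: 'p R)"
  using CARD_prime_neq_0[where 'p = 'p] by (simp only: of_nat_eq_0_iff not_False_eq_True)

text \<open>Horizontality evaluated at \<open>wbar\<close>, where the connection gives
  \<open>- gA *s vbar\<close>, after cancelling \<open>p\<close>. It is the equation for
  \<open>b\<close> divided by \<open>q - 1\<close>, at \<open>q = 1\<close>.\<close>

lemma bA_equation: "fps_X * fps_deriv bA = epsA * (gA - phi_A gA)"
proof -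
  let ?p = "of_nat CARD('p) :: 'p R"
  have "nabla_H0 (\<Phi> wbar) = ?p *s (epsA *s (- gA *s vbar) + (fps_X * fps_deriv bA) *s vbar)"
    unfolding Phi_wbar_bA nabla_H0_scale nabla_H0_add nabla_wbar[OF odd_p] nabla_vbar[OF odd_p] epsA_const
    by (simp add: vec_eq_iff)
  moreover have "\<Phi> (nabla_H0 wbar) = - phi_A gA *s (epsA *s vbar)"
    unfolding nabla_wbar[OF odd_p] Phi_scale Phi_vbar phi_A.hom_uminus ..
  ultimately have "?p *s (epsA *s (- gA *s vbar) + (fps_X * fps_deriv bA) *s vbar) = ?p *s (- phi_A gA *s (epsA *s vbar))"
    unfolding Phi_horizontal by simp
  from arg_cong[OF this, of "\<lambda>v. v $ 2"]
  have "?p * ((epsA * - gA + fps_X * fps_deriv bA) * vbar $ 2) = ?p * (- phi_A gA * epsA * vbar $ 2)"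
    by (simp add: algebra_simps)
  then have "(epsA * - gA + fps_X * fps_deriv bA) * vbar $ 2 = - phi_A gA * epsA * vbar $ 2"
    using of_nat_CARD_neq_0 by (simp only: mult_cancel_left) simp
  moreover have "vbar $ 2 \<noteq> (0 :: 'p R)" using hyper_neq_0[OF odd_p] by (simp add: vbar_nth[OF odd_p])
  ultimately have "epsA * - gA + fps_X * fps_deriv bA = - phi_A gA * epsA"
    by (simp only: mult_cancel_right) simp
  then show ?thesis by (simp add: algebra_simps)
qed

definition epsR :: "'p R'" where "epsR = (- 1) ^ ((CARD('p) - 1) div 2)"

lemma epsR: "epsR = 1 \<or> epsR = - 1"
  unfolding epsR_def using neg_one_even_power neg_one_odd_power by blast

lemma mod_q1_epsR [simp]: "mod_q1 epsR = epsA"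
  by (simp only: epsR_def epsA_def mod_q1.hom_power mod_q1.hom_uminus mod_q1.hom_one)

lemma incl_A_epsA [simp]: "incl_A epsA = epsR"
  by (simp only: epsR_def epsA_def incl_A.hom_power incl_A.hom_uminus incl_A.hom_one)

text \<open>The factor \<open>1 + (q - 1) / 2\<close> makes \<open>bq\<close> compatible with the canonical deformation modulo \<open>(q - 1)\<^sup>2\<close>.\<close>

lemma ex_bq: "\<exists>b. fps_nth b 0 = fps_const (fps_nth bA 0) * (1 + fps_const half * fps_X)
    \<and> gamma_R' b - b = q1_R' * (epsR * (gq - phi_R' gq))"
proof (rule ex_q_primitive)
  have "fps_nth (gq :: 'p R') 0 = 1"
    using arg_cong[OF gq_mult[OF odd_p], of "\<lambda>y. fps_nth y 0"] by (simp add: gamma_R'_nth qcoef_0[OF odd_p])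
  then show "fps_nth (epsR * (gq - phi_R' gq)) 0 = 0" by (simp add: phi_R'_nth phi_R.hom_one)
next
  fix n :: nat assume "n > 0"
  then have "qnat n dvd fps_nth (phi_R' gq - gq :: 'p R') n" by (rule qnat_dvd_gq[OF odd_p])
  moreover have "fps_nth (epsR * (gq - phi_R' gq)) n = fps_nth (phi_R' gq - gq) n \<or>
      fps_nth (epsR * (gq - phi_R' gq)) n = - fps_nth (phi_R' gq - gq) n"
  proof (rule disjE[OF epsR])
    assume e: "epsR = 1"
    show ?thesis unfolding e by simp
  next
    assume e: "epsR = - 1"
    show ?thesis unfolding e mult_minus1 by simp
  qed
  ultimately show "qnat n dvd fps_nth (epsR * (gq - phi_R' gq)) n" by (elim disjE) (simp_all only: dvd_minus_iff)
qed

definition bq :: "'p R'"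
  where "bq = (SOME b. fps_nth b 0 = fps_const (fps_nth bA 0) * (1 + fps_const half * fps_X)
    \<and> gamma_R' b - b = q1_R' * (epsR * (gq - phi_R' gq)))"

lemma bq_0: "fps_nth bq 0 = fps_const (fps_nth bA 0) * (1 + fps_const half * fps_X)"
  and bq_gamma: "gamma_R' bq - bq = q1_R' * (epsR * (gq - phi_R' gq))"
  using someI_ex[OF ex_bq] unfolding bq_def[symmetric] by blast+

text \<open>The equation for \<open>bq\<close>, divided by \<open>q - 1\<close> and reduced, is
  \<open>bA_equation\<close>. So both series have the same derivative, and \<open>bq_0\<close>
  matches the constant terms.\<close>

lemma mod_q1_bq: "mod_q1 bq = bA"
proof -
  have "q1_R' * (fps_X * d_q bq) = q1_R' * (epsR * (gq - phi_R' gq))"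
    unfolding bq_gamma[symmetric] d_q_eq[symmetric] by (simp only: mult.assoc)
  then have "fps_X * d_q bq = epsR * (gq - phi_R' gq)"
    using q1_R'_neq_0[where 'p = 'p] by (simp only: mult_cancel_left) simp
  from arg_cong[OF this, of mod_q1]
  have "fps_X * fps_deriv (mod_q1 bq) = fps_X * fps_deriv bA"
    unfolding bA_equation by (simp add: mod_q1.hom_mult mod_q1.hom_diff mod_q1_d_q gA_def)
  then have deriv: "fps_deriv (mod_q1 bq) = fps_deriv bA" by simp
  show ?thesis
  proof (rule fps_ext)
    fix n
    show "fps_nth (mod_q1 bq) n = fps_nth bA n"
    proof (cases n)
      case 0
      then show ?thesis by (simp add: bq_0)
    next
      case (Suc m)
      have "of_nat (Suc m) * fps_nth (mod_q1 bq) (Suc m) = of_nat (Suc m) * fps_nth bA (Suc m)"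
        using arg_cong[OF deriv, of "\<lambda>y. fps_nth y m"] by (simp only: fps_deriv_nth Suc_eq_plus1)
      then show ?thesis unfolding Suc by (simp only: mult_cancel_left of_nat_eq_0_iff) simp
    qed
  qed
qed

abbreviation "phiM' \<equiv> phiM epsR bq"

lemma red_H0_phiM: "red_H0 (phiM' m) = \<Phi> (red_H0 m)"
proof -
  have p: "mod_q1 (pq_R' :: 'p R') = of_nat CARD('p)" by (simp add: fps_of_nat)
  have w: "red_H0 (phiM' wM) = \<Phi> wbar"
    unfolding phiM_wM[OF odd_p epsR bq_gamma] red_H0_scale red_H0_add p mod_q1_epsR mod_q1_bq Phi_wbar_bA
    by (simp add: vbar_def wbar_def)
  have v: "red_H0 (phiM' vM) = \<Phi> vbar"
    unfolding phiM_vM[OF odd_p epsR bq_gamma] red_H0_scale mod_q1_epsR Phi_vbar by (simp add: vbar_def)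
  have "red_H0 (phiM' (x *s wM + y *s vM)) = \<Phi> (red_H0 (x *s wM + y *s vM))" for x y
    unfolding phiM_add phiM_scale red_H0_add red_H0_scale w v Phi_add Phi_scale mod_q1_phi_R'
    by (simp add: vbar_def wbar_def)
  then show ?thesis using decomp_wv[OF odd_p, of m] by metis
qed

lemma mic_iso_compare: "mic_iso (obj_M'_mod_q1 phiM') (obj_H0 \<Phi>) compare_H0"
proof -
  have bij: "bij (compare_H0 :: 'p R ^ 2 \<Rightarrow> _)"
    by (rule bij_betw_byWitness[of _ compare_H0]) auto
  have inv: "inv compare_H0 = (compare_H0 :: 'p R ^ 2 \<Rightarrow> _)"
    by (rule inv_equality) auto
  have frob: "compare_H0 (frob (obj_M'_mod_q1 phiM') y) = \<Phi> (compare_H0 y)" for y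
    using red_H0_phiM[of "vec_map incl_A y"] unfolding red_H0_incl by (simp add: obj_M'_mod_q1_def red_H0_def)
  have frob': "compare_H0 (\<Phi> y) = frob (obj_M'_mod_q1 phiM') (compare_H0 y)" for y
    using arg_cong[OF frob[of "compare_H0 y"], of compare_H0] by simp
  have dlog: "compare_H0 (dlog (obj_M'_mod_q1 phiM') y) = nabla_H0 (compare_H0 y)" for y
    using red_H0_nabla[OF odd_p, of "vec_map incl_A y"] unfolding red_H0_incl by (simp add: obj_M'_mod_q1_def red_H0_def)
  have fil0: "fil (obj_M'_mod_q1 phiM') 0 = UNIV"
  proof -
    have "y \<in> range (vec_map mod_q1)" for y :: "'p R ^ 2"
      by (rule range_eqI[of _ _ "vec_map incl_A y"]) (simp add: vec_eq_iff)
    then show ?thesis by (auto simp: obj_M'_mod_q1_def fil_M'_0)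
  qed
  have fil1: "fil (obj_M'_mod_q1 phiM') 1 = {y. y $ 2 = 0}"
  proof -
    have "y \<in> vec_map mod_q1 ` {m. q1_R' dvd m $ 2}" if "y $ 2 = 0" for y :: "'p R ^ 2"
      using that by (intro image_eqI[of _ _ "vec_map incl_A y"]) (auto simp: vec_eq_iff q1_R'_dvd_iff)
    then show ?thesis unfolding obj_M'_mod_q1_def filmod.simps fil_M'_1 by (auto simp: q1_R'_dvd_iff)
  qed
  have H0: "fil (obj_H0 \<Phi>) 0 = UNIV" "fil (obj_H0 \<Phi>) 1 = {y. y $ 2 = 0}"
  proof -
    have "y \<in> range (\<lambda>a. a *s omega)" if "y $ 2 = 0" for y :: "'p R ^ 2"
      using that by (intro range_eqI[of _ _ "y $ 1"]) (simp add: vec_eq_iff forall_2)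
    then show "fil (obj_H0 \<Phi>) 1 = {y. y $ 2 = 0}" by (auto simp: obj_H0_def)
  qed (simp add: obj_H0_def)
  show ?thesis
    unfolding mic_iso_def filmod_hom_def inv
    using bij frob frob' dlog module_hom_compare_H0
    by (auto simp: fil0 fil1[simplified] H0(1) H0(2)[simplified] compare_H0_nth obj_H0_def[of \<Phi>, THEN arg_cong[of _ _ frob]]
      obj_H0_def[of \<Phi>, THEN arg_cong[of _ _ dlog]] fun_eq_iff)
qed

lemma MIC_H0: "MIC (obj_H0 \<Phi>)"
  unfolding MIC_def
proof (intro conjI)
  have H: "fil (obj_H0 \<Phi>) 0 = UNIV" "fil (obj_H0 \<Phi>) 1 = range (\<lambda>a. a *s omega)"
    "frob (obj_H0 \<Phi>) = \<Phi>" "dlog (obj_H0 \<Phi>) = nabla_H0"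
    by (simp_all add: obj_H0_def)
  show "adapted_filtration fil_A (fil (obj_H0 \<Phi>))"
    unfolding adapted_filtration_def
  proof (intro conjI exI)
    let ?e = "\<lambda>\<nu> :: 2. if \<nu> = 1 then omega else eta :: 'p R ^ 2"
    let ?\<rho> = "\<lambda>\<nu> :: 2. if \<nu> = 1 then 1 else 0 :: nat"
    show "is_basis ?e" by (rule is_basis_2I) (simp add: det2_def)
    show "\<forall>\<nu>. ?\<rho> \<nu> \<in> {0, 1}" by simp
    show "fil (obj_H0 \<Phi>) 1 \<subseteq> fil (obj_H0 \<Phi>) 0" by (simp add: H)
    have *: "(\<exists>c. m = (\<Sum>\<nu>\<in>UNIV. c \<nu> *s ?e \<nu>) \<and> (\<forall>\<nu>. c \<nu> \<in> A \<nu>)) \<longleftrightarrow> m $ 1 \<in> A 1 \<and> m $ 2 \<in> A 2" for A m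
    proof
      assume "m $ 1 \<in> A 1 \<and> m $ 2 \<in> A 2"
      then show "\<exists>c. m = (\<Sum>\<nu>\<in>UNIV. c \<nu> *s ?e \<nu>) \<and> (\<forall>\<nu>. c \<nu> \<in> A \<nu>)"
        by (intro exI[of _ "\<lambda>\<nu>. m $ \<nu>"]) (simp add: sum_2 vec_eq_iff forall_2)
    qed (auto simp: sum_2)
    have R: "m \<in> range (\<lambda>a. a *s omega) \<longleftrightarrow> m $ 2 = 0" for m :: "'p R ^ 2"
      by (auto intro!: range_eqI[of _ _ "m $ 1"] simp: vec_eq_iff forall_2)
    show "\<forall>r\<in>{0, 1}. fil (obj_H0 \<Phi>) r =
        {\<Sum>\<nu>\<in>UNIV. c \<nu> *s ?e \<nu> |c. \<forall>\<nu>. c \<nu> \<in> fil_A (int r - int (?\<rho> \<nu>))}"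
      unfolding set_eq_iff mem_Collect_eq * by (auto simp: H(1) H(2)[simplified] R fil_A_def)
  qed
  show "strong_frobenius phi_A (of_nat CARD('p)) (fil (obj_H0 \<Phi>)) (frob (obj_H0 \<Phi>))"
    unfolding strong_frobenius_def H(3)
  proof (intro conjI)
    show "semilinear phi_A \<Phi>" by (rule Phi_semilinear)
    let ?p = "of_nat CARD('p) :: 'p R"
    have om: "\<Phi> (a *s omega) = ?p *s ((phi_A a * phi_A hyper) *s (epsA *s wbar + bA *s vbar))" for a
      unfolding omega_eq[OF odd_p] Phi_scale Phi_wbar_bA by (simp add: vec_eq_iff mult_ac)
    show "\<forall>r\<in>{0, 1}. \<Phi> ` fil (obj_H0 \<Phi>) r \<subseteq> range ((*s) (?p ^ r))"
      by (auto simp: H(1) H(2)[simplified] om)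
    let ?A = "\<Union>r\<in>{0, 1}. {y. ?p ^ r *s y \<in> \<Phi> ` fil (obj_H0 \<Phi>) r}"
    have "?p ^ 1 *s ((phi_A 1 * phi_A hyper) *s (epsA *s wbar + bA *s vbar)) \<in> \<Phi> ` fil (obj_H0 \<Phi>) 1"
      unfolding power_one_right om[symmetric] H by blast
    then have 1: "(phi_A 1 * phi_A hyper) *s (epsA *s wbar + bA *s vbar) \<in> ?A" by blast
    have "?p ^ 0 *s (epsA *s vbar) \<in> \<Phi> ` fil (obj_H0 \<Phi>) 0" unfolding Phi_vbar[symmetric] H by simp
    then have 2: "epsA *s vbar \<in> ?A" by blast
    have "det2 ((phi_A 1 * phi_A hyper) *s (epsA *s wbar + bA *s vbar)) (epsA *s vbar) = - (epsA * epsA) * phi_A hyper"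
      unfolding det2_simps det2_wbar_vbar[OF odd_p] by (simp add: phi_A.hom_one mult_ac)
    moreover have "epsA * epsA = 1"
    proof (rule disjE[OF epsA])
      assume e: "epsA = - 1"
      show ?thesis unfolding e by simp
    qed simp
    ultimately have "det2 ((phi_A 1 * phi_A hyper) *s (epsA *s wbar + bA *s vbar)) (epsA *s vbar) dvd 1"
      using phi_hyper_unit[OF odd_p] by simp
    then show "module.span (*s) ?A = UNIV"
      by (rule span_vec_eq_UNIV_2[OF span_vec_base[OF 1] span_vec_base[OF 2]])
  qed
  show "log_connection (dlog (obj_H0 \<Phi>))"
    unfolding log_connection_def H using nabla_H0_add nabla_H0_scale by blast
  show "\<forall>x. dlog (obj_H0 \<Phi>) (frob (obj_H0 \<Phi>) x) = of_nat CARD('p) *s frob (obj_H0 \<Phi>) (dlog (obj_H0 \<Phi>) x)"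
    unfolding H using Phi_horizontal by blast
  show "dlog (obj_H0 \<Phi>) ` fil (obj_H0 \<Phi>) 1 \<subseteq> fil (obj_H0 \<Phi>) 0" by (simp add: H)
qed

end

section \<open>The canonical deformation modulo the square of q - 1\<close>

lemma mf_iso_sym:
  assumes "mf_iso M N f"
  shows "mf_iso N M (inv f)"
proof -
  have bij: "bij f" and act: "f \<circ> act M = act N \<circ> f" using assms by (simp_all add: mf_iso_def)
  have "inv f (act N y) = act M (inv f y)" for y
  proof -
    have "f (act M (inv f y)) = act N y"
      using fun_cong[OF act, of "inv f y"] bij by (simp add: bij_is_surj surj_f_inv_f)
    then show ?thesis using bij by (metis bij_inv_eq_iff)
  qed
  then show ?thesis using assms bij by (auto simp: mf_iso_def bij_imp_bij_inv inv_inv_eq fun_eq_iff)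
qed

lemma filmod_hom_trans:
  assumes "filmod_hom M N f" "filmod_hom N P g"
  shows "filmod_hom M P (g \<circ> f)"
proof -
  have lin: "module_hom (*s) (*s) f" "module_hom (*s) (*s) g"
    and comm: "f \<circ> frob M = frob N \<circ> f" "g \<circ> frob N = frob P \<circ> g"
    and fil: "\<forall>r\<in>{0, 1}. f ` fil M r \<subseteq> fil N r" "\<forall>r\<in>{0, 1}. g ` fil N r \<subseteq> fil P r"
    using assms by (simp_all add: filmod_hom_def)
  have "module_hom (*s) (*s) (g \<circ> f)"
    by (rule module_hom_vecI) (simp_all add: module_hom.add[OF lin(1)] module_hom.add[OF lin(2)]
      module_hom.scale[OF lin(1)] module_hom.scale[OF lin(2)])
  moreover have "(g \<circ> f) \<circ> frob M = frob P \<circ> (g \<circ> f)"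
    using comm by (metis comp_assoc)
  moreover have "\<forall>r\<in>{0, 1}. (g \<circ> f) ` fil M r \<subseteq> fil P r"
    using fil by fastforce
  ultimately show ?thesis unfolding filmod_hom_def by blast
qed

lemma mf_iso_trans:
  assumes "mf_iso M N f" "mf_iso N P g"
  shows "mf_iso M P (g \<circ> f)"
proof -
  have bij: "bij f" "bij g" and act: "f \<circ> act M = act N \<circ> f" "g \<circ> act N = act P \<circ> g"
    using assms by (simp_all add: mf_iso_def)
  have "(g \<circ> f) \<circ> act M = act P \<circ> (g \<circ> f)" using act by (metis comp_assoc)
  moreover have "filmod_hom M P (g \<circ> f)" "filmod_hom P M (inv f \<circ> inv g)"
    using assms by (auto simp: mf_iso_def intro: filmod_hom_trans)
  ultimately show ?thesis using bij by (simp add: mf_iso_def bij_comp o_inv_distrib)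
qed

text \<open>Recursion on the index: \<open>c_n = c_(n/p) - y_n\<close> if \<open>p\<close> divides
  \<open>n\<close>, and \<open>c_n = - y_n\<close> otherwise. At index 0 the left side is always 0,
  whence the hypothesis; \<open>c_0\<close> is arbitrary and set to 0.\<close>

lemma ex_phi_A_minus_id:
  assumes y0: "fps_nth (y :: 'p :: prime_card R) 0 = 0"
  shows "\<exists>c. phi_A c - c = y"
proof -
  define P where "P f n r \<longleftrightarrow> r = (if n = 0 then 0 else if CARD('p) dvd n then f (n div CARD('p)) - fps_nth y n else - fps_nth y n)"
    for f n and r :: "'p padic_int"
  have div: "n div CARD('p) < n" if "n \<noteq> 0" for n
    using that CARD_gt_1[where 'p = 'p] by (intro div_less_dividend) auto
  have "\<exists>x. \<forall>n. P x n (x n)"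
  proof (rule dependent_wf_choice[OF wf_less])
    fix f g :: "nat \<Rightarrow> 'p padic_int" and n r
    assume "\<And>z. (z, n) \<in> {(x, y). x < y} \<Longrightarrow> f z = g z"
    then show "P f n r = P g n r" using div[of n] by (simp add: P_def)
  qed (simp add: P_def)
  then obtain c where c: "\<And>n. P c n (c n)" by blast
  have "fps_nth (phi_A (Abs_fps c) - Abs_fps c) n = fps_nth y n" for n
    using c[of n] c[of 0] y0 CARD_prime_neq_0[where 'p = 'p] by (cases "n = 0") (auto simp: phi_A_nth P_def)
  then show ?thesis by (intro exI[of _ "Abs_fps c"] fps_ext)
qed

section \<open>First-order expansions in \<open>q - 1\<close>\<close>

abbreviation vincl :: "'p :: prime_card R ^ 'n \<Rightarrow> 'p R' ^ 'n"
  where "vincl \<equiv> vec_map incl_A"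

lemma vincl_simps: "vincl (x + y) = vincl x + vincl y" "vincl (a *s x) = incl_A a *s vincl x" "vincl 0 = 0"
  by (simp_all add: vec_eq_iff incl_A.hom_simps)

lemma abs_q1_sq: "abs_R'_mod q1_R' * abs_R'_mod q1_R' = (0 :: 'p :: prime_card R'_mod)"
proof -
  have "abs_R'_mod (q1_R' * q1_R') = abs_R'_mod (0 :: 'p R')"
    unfolding abs_R'_mod_eq_iff by (simp add: power2_eq_square)
  then show ?thesis by (simp only: abs_R'_mod.hom_mult abs_R'_mod.hom_zero)
qed

lemma abs_q1_sq': "abs_R'_mod q1_R' * (abs_R'_mod q1_R' * x) = (0 :: 'p :: prime_card R'_mod)"
  by (simp only: mult.assoc[symmetric] abs_q1_sq mult_zero_left)

lemma abs_q1_mult: "abs_R'_mod q1_R' * abs_R'_mod x = abs_R'_mod q1_R' * abs_R'_mod (incl_A (mod_q1 x))"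
proof -
  have "q1_R' dvd x - incl_A (mod_q1 x)" by (simp add: q1_R'_dvd_iff mod_q1.hom_diff)
  then have "q1_R' * q1_R' dvd q1_R' * (x - incl_A (mod_q1 x))" by (intro mult_dvd_mono dvd_refl)
  then show ?thesis
    unfolding abs_R'_mod.hom_mult[symmetric] abs_R'_mod_eq_iff power2_eq_square right_diff_distrib .
qed

lemma abs_expand:
  "abs_R'_mod x = abs_R'_mod (incl_A (mod_q1 x)) + abs_R'_mod q1_R' * abs_R'_mod (incl_A (fps_map (\<lambda>c. fps_nth c 1) x))"
proof -
  have "fps_X ^ 2 dvd c - (fps_const (fps_nth c 0) + fps_X * fps_const (fps_nth c 1))" for c :: "'a padic_int fps"
  proof -
    have "c - (fps_const (fps_nth c 0) + fps_X * fps_const (fps_nth c 1)) = fps_X ^ 2 * fps_shift 2 c"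
    proof (rule fps_ext)
      fix n
      show "fps_nth (c - (fps_const (fps_nth c 0) + fps_X * fps_const (fps_nth c 1))) n = fps_nth (fps_X ^ 2 * fps_shift 2 c) n"
      proof (cases "n < 2")
        case True
        then have "n = 0 \<or> n = 1" by auto
        then show ?thesis by (auto simp: fps_X_power_mult_nth)
      next
        case False
        then have n: "n - 2 + 2 = n" "n \<noteq> 0" "n - 1 \<noteq> 0" by auto
        show ?thesis using False n by (simp add: fps_X_power_mult_nth)
      qed
    qed
    then show ?thesis by (rule dvdI)
  qed
  then have "q1_R' ^ 2 dvd x - (incl_A (mod_q1 x) + q1_R' * incl_A (fps_map (\<lambda>c. fps_nth c 1) x))"
    by (simp add: q1_R'_def fps_const_dvd_iff fps_const_power)
  then show ?thesis
    unfolding abs_R'_mod.hom_mult[symmetric] abs_R'_mod.hom_add[symmetric] abs_R'_mod_eq_iff .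
qed

lemma ring_R'_mod_simps:
  "phi ring_R'_mod (abs_R'_mod x) = abs_R'_mod (phi_R' x)" "gam ring_R'_mod (abs_R'_mod x) = abs_R'_mod (gamma_R' x)"
  "qm1 ring_R'_mod = abs_R'_mod q1_R'"
proof -
  have dvd: "q1_R' ^ 2 dvd rep_R'_mod (abs_R'_mod x) - x" using abs_R'_mod_eq_iff abs_rep_R'_mod by blast
  have "q1_R' ^ 2 dvd phi_R' (rep_R'_mod (abs_R'_mod x) - x)" "q1_R' ^ 2 dvd gamma_R' (rep_R'_mod (abs_R'_mod x) - x)"
    using phi_R'.hom_dvd[OF dvd] gamma_R'.hom_dvd[OF dvd] q1_square_dvd dvd_trans by blast+
  then show "phi ring_R'_mod (abs_R'_mod x) = abs_R'_mod (phi_R' x)" "gam ring_R'_mod (abs_R'_mod x) = abs_R'_mod (gamma_R' x)"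
    by (simp_all add: ring_R'_mod_def abs_R'_mod_eq_iff phi_R'.hom_diff gamma_R'.hom_diff)
qed (simp add: ring_R'_mod_def)

lemma mod_q1_rep_abs: "mod_q1 (rep_R'_mod (abs_R'_mod x)) = mod_q1 x"
proof -
  have "q1_R' ^ 2 dvd rep_R'_mod (abs_R'_mod x) - x" using abs_R'_mod_eq_iff abs_rep_R'_mod by blast
  then obtain z where "rep_R'_mod (abs_R'_mod x) - x = q1_R' ^ 2 * z" by (rule dvdE)
  then have "rep_R'_mod (abs_R'_mod x) = x + q1_R' ^ 2 * z" by (simp add: algebra_simps)
  then show ?thesis by (simp add: mod_q1.hom_simps)
qed

text \<open>The linear term of \<open>[p]_q\<close> in \<open>q - 1\<close> is the binomial
  coefficient \<open>p (p - 1) / 2\<close>.\<close>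

lemma abs_pq:
  assumes odd_p: "odd CARD('p :: prime_card)"
  shows "abs_R'_mod (pq_R' :: 'p R') = of_nat CARD('p)
    + abs_R'_mod q1_R' * (of_nat CARD('p) * (of_nat CARD('p) - 1) * abs_R'_mod (incl_A (fps_const half)))"
proof -
  let ?p = "of_nat CARD('p) :: 'p padic_int"
  have s: "2 * fps_nth (qnat n :: 'p R) 1 = of_nat n * (of_nat n - 1)" for n
  proof (induction n)
    case (Suc n)
    have "fps_nth (qnat (Suc n) :: 'p R) 1 = fps_nth (qnat n) 1 + of_nat n"
      by (simp add: qnat_def fps_nth_one_plus_X_power)
    then show ?case using Suc by (simp add: algebra_simps)
  qed (simp add: qnat_def)
  have "fps_nth (qnat CARD('p) :: 'p R) 1 = (2 * half) * fps_nth (qnat CARD('p)) 1"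
    unfolding two_half[OF odd_p] by simp
  also have "\<dots> = ?p * (?p - 1) * half" using s[of "CARD('p)"] by (simp add: mult_ac)
  finally have n1: "fps_nth (qnat CARD('p) :: 'p R) 1 = ?p * (?p - 1) * half" .
  have "mod_q1 (pq_R' :: 'p R') = of_nat CARD('p)" by (simp add: fps_of_nat)
  moreover have "fps_map (\<lambda>c. fps_nth c 1) (pq_R' :: 'p R')
      = of_nat CARD('p) * (of_nat CARD('p) - 1) * fps_const half"
  proof -
    have "fps_map (\<lambda>c. fps_nth c 1) (pq_R' :: 'p R') = fps_const (?p * (?p - 1) * half)"
      by (auto simp: fps_eq_iff n1 simp del: One_nat_def)
    also have "\<dots> = fps_const ?p * (fps_const ?p - fps_const 1) * fps_const half"
      by (simp only: fps_const_mult fps_const_sub)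
    finally show ?thesis by (simp only: fps_of_nat fps_const_1_eq_1)
  qed
  ultimately show ?thesis
    using abs_expand[of "pq_R' :: 'p R'"]
    by (simp only: incl_A.hom_simps abs_R'_mod.hom_simps)
qed

section \<open>Isomorphism of the reduction of \<open>M'\<close> with the first-order deformation of
  \<open>H_0\<close>\<close>

context
  fixes \<Phi> :: "'p :: prime_card R ^ 2 \<Rightarrow> 'p R ^ 2"
  assumes odd_p: "odd CARD('p)" and frobenius: "crystalline_frobenius \<Phi>"
begin

lemmas Phi_facts = Phi_add[OF odd_p frobenius] Phi_scale[OF odd_p frobenius]

abbreviation "eR \<equiv> epsR :: 'p R'"
abbreviation "bR \<equiv> bq \<Phi>"
abbreviation "M' \<equiv> obj_M' (phiM eR bR)"
abbreviation "D \<equiv> deform_mod (obj_H0 \<Phi>)"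

lemmas e_facts = epsR[OF odd_p frobenius] and b_facts = bq_gamma[OF odd_p frobenius]
lemmas phiM_facts = phiM_vM[OF odd_p epsR[OF odd_p frobenius] bq_gamma[OF odd_p frobenius]]
  phiM_wM[OF odd_p epsR[OF odd_p frobenius] bq_gamma[OF odd_p frobenius]]
lemmas MF_M'' = MF_M'[OF odd_p epsR[OF odd_p frobenius] bq_gamma[OF odd_p frobenius]]

lemma eR_sq: "eR * eR = 1"
  by (rule e_simps(1)[OF odd_p epsR[OF odd_p frobenius] bq_gamma[OF odd_p frobenius]])

definition cA :: "'p R"
  where "cA = (SOME c. phi_A c - c = epsA * (fps_map (\<lambda>c. fps_nth c 1) bR - fps_const half * bA \<Phi>))"

text \<open>Solvable because the constant term in \<lambda> of the right side is 0: the first-order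
  term of \<open>bq\<close> there is \<open>half\<close> times the constant term of
  \<open>bA\<close>.\<close>

lemma cA_equation: "phi_A cA - cA = epsA * (fps_map (\<lambda>c. fps_nth c 1) bR - fps_const half * bA \<Phi>)"
  unfolding cA_def
proof (rule someI_ex, rule ex_phi_A_minus_id)
  show "fps_nth (epsA * (fps_map (\<lambda>c. fps_nth c 1) bR - fps_const half * bA \<Phi>)) 0 = 0"
    by (simp add: bq_0[OF odd_p frobenius])
qed

definition hR :: "'p R'" where "hR = incl_A (fps_const half)"

definition Vt :: "'p R' ^ 2" where "Vt = vincl vbar"

text \<open>The image of \<open>wM\<close>. The scalar \<open>1 + q1_R' * hR\<close> is
  \<open>q^(1/2)\<close> modulo \<open>(q - 1)^2\<close>. There \<open>[p]_q\<close> equals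
  \<open>p q^((p - 1)/2)\<close>, and \<phi> turns \<open>q^(1/2)\<close> into
  \<open>q^(p/2)\<close>, so this scaling exchanges \<open>[p]_q\<close> with \<open>p\<close>. The
  term with \<open>cA\<close> absorbs the remaining discrepancy along \<open>Vt\<close>.\<close>

definition Wt :: "'p R' ^ 2"
  where "Wt = (1 + q1_R' * hR) *s vincl wbar + (q1_R' * incl_A cA) *s Vt"

text \<open>\<open>frobL\<close> and \<open>actL\<close> are lifts to \<open>R'\<close> of the
  structure maps of \<open>deform_mod\<close>, meaningful modulo \<open>(q - 1)^2\<close> only. They
  allow computing with power series instead of classes.\<close>

definition frobL :: "'p R' ^ 2 \<Rightarrow> 'p R' ^ 2"
  where "frobL m = phi_R' (m $ 1) *s vincl (\<Phi> omega) + phi_R' (m $ 2) *s vincl (\<Phi> eta)"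

definition actL :: "'p R' ^ 2 \<Rightarrow> 'p R' ^ 2"
  where "actL m = gamma_R' (m $ 1) *s (vincl omega + q1_R' *s vincl (nabla_H0 omega))
    + gamma_R' (m $ 2) *s (vincl eta + q1_R' *s vincl (nabla_H0 eta))"

lemma frobL_semilinear: "semilinear phi_R' frobL"
  by (simp add: semilinear_def frobL_def phi_R'.hom_simps vec_eq_iff algebra_simps)

lemma actL_semilinear: "semilinear gamma_R' actL"
  by (simp add: semilinear_def actL_def gamma_R'.hom_simps vec_eq_iff algebra_simps)

lemma axis_omega_eta: "axis 1 1 = omega" "axis 2 1 = eta"
  by (simp_all add: omega_def eta_def)

lemma frob_D: "frob D (vmod m) = vmod (frobL m)"
  by (simp add: deform_mod_def sum_2 axis_omega_eta ring_R'_mod_simps frobL_def vmod_add vmod_scale tensor_one_def obj_H0_def)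
    (simp add: vec_map_def)

lemma act_D: "act D (vmod m) = vmod (actL m)"
  by (simp add: deform_mod_def sum_2 axis_omega_eta ring_R'_mod_simps actL_def vmod_add vmod_scale tensor_one_def obj_H0_def)
    (simp add: vec_map_def)

lemma basis_A: "y = y $ 1 *s omega + y $ 2 *s (eta :: 'p R ^ 2)"
  by (simp add: vec_eq_iff forall_2)

lemma frobL_incl: "frobL (vincl y) = vincl (\<Phi> y)"
proof -
  have "\<Phi> y = phi_A (y $ 1) *s \<Phi> omega + phi_A (y $ 2) *s \<Phi> eta"
    by (subst basis_A) (simp only: Phi_facts)
  then show ?thesis by (simp add: frobL_def vincl_simps phi_R'_incl_A)
qed

text \<open>Since \<open>\<gamma>(a) = a + (q - 1) \<lambda> d_q a\<close> and \<open>d_q\<close> is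
  the derivative modulo \<open>q - 1\<close>, the coefficients contribute the Leibniz term and the
  basis vectors the connection; products of two corrections vanish.\<close>

lemma vmod_actL_incl: "vmod (actL (vincl y)) = vmod (vincl y) + abs_R'_mod q1_R' *s vmod (vincl (nabla_H0 y))"
proof -
  have g: "abs_R'_mod (gamma_R' (incl_A a)) = abs_R'_mod (incl_A a) + abs_R'_mod q1_R' * abs_R'_mod (incl_A (fps_X * fps_deriv a))"
    for a :: "'p R"
  proof -
    have "gamma_R' (incl_A a) = incl_A a + q1_R' * (fps_X * d_q (incl_A a))"
      using d_q_eq[of "incl_A a"] by (simp add: algebra_simps)
    then have "abs_R'_mod (gamma_R' (incl_A a)) = abs_R'_mod (incl_A a) + abs_R'_mod q1_R' * abs_R'_mod (fps_X * d_q (incl_A a))"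
      by (simp only: abs_R'_mod.hom_add abs_R'_mod.hom_mult)
    then show ?thesis unfolding abs_q1_mult[of "fps_X * d_q (incl_A a)"] by (simp add: mod_q1.hom_mult mod_q1_d_q)
  qed
  have n: "nabla_H0 y = (fps_X * fps_deriv (y $ 1)) *s omega + y $ 1 *s nabla_H0 omega
      + ((fps_X * fps_deriv (y $ 2)) *s eta + y $ 2 *s nabla_H0 eta)"
    by (subst (1) basis_A) (simp only: nabla_H0_add nabla_H0_scale)
  have i: "vmod (vincl y) = abs_R'_mod (incl_A (y $ 1)) *s vmod (vincl omega) + abs_R'_mod (incl_A (y $ 2)) *s vmod (vincl eta)"
    by (subst basis_A) (simp only: vincl_simps vmod_add vmod_scale)
  show ?thesis
    unfolding actL_def vmod_add vmod_scale i unfolding n vincl_simps vmod_add vmod_scale vec_map_nth g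
    by (simp add: vec_eq_iff algebra_simps abs_q1_sq abs_q1_sq')
qed

definition \<Theta> :: "'p R' ^ 2 \<Rightarrow> 'p R' ^ 2"
  where "\<Theta> m = det2 m vM *s Wt + det2 wM m *s Vt"

lemma Theta_add: "\<Theta> (x + y) = \<Theta> x + \<Theta> y" and Theta_scale: "\<Theta> (a *s x) = a *s \<Theta> x"
  by (simp_all add: \<Theta>_def det2_simps vec_eq_iff algebra_simps)

lemma Theta_w: "\<Theta> wM = Wt" and Theta_v: "\<Theta> vM = Vt"
  by (simp_all add: \<Theta>_def det2_simps det2_wM_vM[OF odd_p])

lemma frobL_Vt: "frobL Vt = eR *s Vt"
  unfolding Vt_def frobL_incl Phi_vbar[OF odd_p frobenius] vincl_simps incl_A_epsA[OF odd_p frobenius] ..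

lemma Theta_frob: "vmod (\<Theta> (phiM eR bR m)) = vmod (frobL (\<Theta> m))"
proof -
  define T P h k where "T = (abs_R'_mod q1_R' :: 'p R'_mod)" and "P = (of_nat CARD('p) :: 'p R'_mod)"
    and "h = abs_R'_mod hR" and "k = P * (P - 1) * h"
  define E B1 B0 C C' where "E = abs_R'_mod eR" and "B1 = abs_R'_mod (incl_A (fps_map (\<lambda>c. fps_nth c 1) bR))"
    and "B0 = abs_R'_mod (incl_A (bA \<Phi>))" and "C = abs_R'_mod (incl_A cA)" and "C' = abs_R'_mod (incl_A (phi_A cA))"
  define v w where "v = vmod Vt" and "w = vmod (vincl wbar :: 'p R' ^ 2)"
  have TT: "T * T = 0" "T * (T * x) = 0" for x by (simp_all add: T_def abs_q1_sq abs_q1_sq')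
  have pq: "abs_R'_mod pq_R' = P + T * k"
    unfolding T_def P_def k_def h_def hR_def by (rule abs_pq[OF odd_p])
  have b: "abs_R'_mod bR = B0 + T * B1"
    using abs_expand[of bR] by (simp only: mod_q1_bq[OF odd_p frobenius] B0_def T_def B1_def)
  have EE: "E * E = 1" unfolding E_def abs_R'_mod.hom_mult[symmetric] eR_sq abs_R'_mod.hom_one ..
  have "C' - C = E * (B1 - h * B0)"
    using arg_cong[OF cA_equation, of "\<lambda>x. abs_R'_mod (incl_A x)"]
    by (simp only: incl_A.hom_diff incl_A.hom_mult abs_R'_mod.hom_diff abs_R'_mod.hom_mult incl_A_epsA[OF odd_p frobenius]
      C'_def C_def E_def B1_def B0_def h_def hR_def)
  then have C': "C' = C + E * (B1 - h * B0)" by (simp add: algebra_simps)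
  have "vmod (\<Theta> (phiM eR bR wM)) = (P + T * k) *s (E *s ((1 + T * h) *s w + (T * C) *s v) + (B0 + T * B1) *s v)"
    unfolding phiM_facts Theta_scale Theta_add Theta_w Theta_v Wt_def vmod_add vmod_scale pq b
    by (simp add: E_def T_def h_def C_def v_def w_def abs_R'_mod.hom_simps)
  moreover have "vmod (frobL Wt) = (1 + T * (P + T * k) * h) *s (P *s (E *s w + B0 *s v)) + (T * (P + T * k) * C') *s (E *s v)"
  proof -
    have hh: "phi_R' hR = hR" by (simp add: hR_def phi_R'_incl_A)
    have "frobL Wt = (1 + q1_R' * pq_R' * hR) *s vincl (of_nat CARD('p) *s (epsA *s wbar + bA \<Phi> *s vbar))
        + (q1_R' * pq_R' * incl_A (phi_A cA)) *s (eR *s Vt)"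
      unfolding Wt_def semilinear_add[OF frobL_semilinear] semilinear_scale[OF frobL_semilinear] frobL_Vt frobL_incl
        Phi_wbar_bA[OF odd_p frobenius] phi_R'.hom_add phi_R'.hom_mult phi_R'.hom_one phi_R'_q1 hh phi_R'_incl_A ..
    then show ?thesis
      unfolding pq[symmetric]
      by (simp only: vmod_add vmod_scale vincl_simps incl_A.hom_of_nat incl_A_epsA[OF odd_p frobenius] abs_R'_mod.hom_add
        abs_R'_mod.hom_mult abs_R'_mod.hom_one abs_R'_mod.hom_of_nat T_def P_def h_def C'_def E_def B0_def v_def w_def Vt_def)
  qed
  moreover have "(P + T * k) *s (E *s ((1 + T * h) *s w + (T * C) *s v) + (B0 + T * B1) *s v)
      = (1 + T * (P + T * k) * h) *s (P *s (E *s w + B0 *s v)) + (T * (P + T * k) * C') *s (E *s v)"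
  proof -
    \<comment> \<open>Component along \<open>wbar\<close>: to first order the exponents
      \<open>P - 1\<close> from \<open>[p]_q\<close> and 1 from the scaling of \<open>Wt\<close> add
      up to the \<open>P\<close> obtained from \<phi> on that scaling.\<close>
    have 1: "(P + T * k) * E * (1 + T * h) = (1 + T * (P + T * k) * h) * P * E"
      unfolding k_def by (simp add: algebra_simps TT)
    have EE': "E * (E * x) = x" for x using EE by (simp flip: mult.assoc)
    \<comment> \<open>Component along \<open>vbar\<close>: after inserting \<open>C'\<close>, that
      is \<open>cA_equation\<close>, the terms linear in \<open>T\<close> cancel.\<close>
    have 2: "(P + T * k) * (E * (T * C) + (B0 + T * B1)) = (1 + T * (P + T * k) * h) * P * B0 + T * (P + T * k) * C' * E"
      unfolding k_def C' by (simp add: algebra_simps TT EE EE')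
    have "(P + T * k) *s (E *s ((1 + T * h) *s w + (T * C) *s v) + (B0 + T * B1) *s v)
        = ((P + T * k) * E * (1 + T * h)) *s w + ((P + T * k) * (E * (T * C) + (B0 + T * B1))) *s v"
      by (simp add: vec_eq_iff distrib_left distrib_right mult.assoc add.assoc)
    also have "\<dots> = (1 + T * (P + T * k) * h) *s (P *s (E *s w + B0 *s v)) + (T * (P + T * k) * C') *s (E *s v)"
      unfolding 1 2 by (simp add: vec_eq_iff distrib_left distrib_right mult.assoc add.assoc)
    finally show ?thesis .
  qed
  ultimately have w: "vmod (\<Theta> (phiM eR bR wM)) = vmod (frobL (\<Theta> wM))" by (simp add: Theta_w)
  have v: "vmod (\<Theta> (phiM eR bR vM)) = vmod (frobL (\<Theta> vM))"
    unfolding phiM_facts Theta_scale Theta_v frobL_Vt ..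
  have "vmod (\<Theta> (phiM eR bR (x *s wM + y *s vM))) = vmod (frobL (\<Theta> (x *s wM + y *s vM)))" for x y
    unfolding phiM_add phiM_scale Theta_add Theta_scale semilinear_add[OF frobL_semilinear] semilinear_scale[OF frobL_semilinear]
      vmod_add vmod_scale v w ..
  then show ?thesis using decomp_wv[OF odd_p, of m] by metis
qed

text \<open>The series \<open>gq\<close> and \<open>cA\<close> enter with a factor
  \<open>q - 1\<close>, so only their reductions at \<open>q = 1\<close> matter, and these match the
  classical connection on \<open>wbar\<close>.\<close>

lemma Theta_act: "vmod (\<Theta> (actM m)) = vmod (actL (\<Theta> m))"
proof -
  define T h C G where "T = (abs_R'_mod q1_R' :: 'p R'_mod)" and "h = abs_R'_mod hR" and "C = abs_R'_mod (incl_A cA)"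
    and "G = abs_R'_mod (incl_A (gA :: 'p R))"
  define v w where "v = vmod Vt" and "w = vmod (vincl wbar :: 'p R' ^ 2)"
  have TT: "T * T = 0" "T * (T * x) = 0" for x by (simp_all add: T_def abs_q1_sq abs_q1_sq')
  have TG: "T * abs_R'_mod gq = T * G" unfolding T_def G_def gA_def by (rule abs_q1_mult)
  have TC: "T * abs_R'_mod (gamma_R' (incl_A cA)) = T * C"
    unfolding T_def C_def using abs_q1_mult[of "gamma_R' (incl_A cA)"] by simp
  have actV: "vmod (actL Vt) = v"
    unfolding Vt_def vmod_actL_incl nabla_vbar[OF odd_p] by (simp add: v_def Vt_def vec_eq_iff incl_A.hom_zero abs_R'_mod.hom_zero)
  have actW: "vmod (actL (vincl wbar)) = w + T *s (- G *s v)"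
    unfolding vmod_actL_incl nabla_wbar[OF odd_p] vincl_simps vmod_scale incl_A.hom_uminus abs_R'_mod.hom_uminus
    by (simp only: w_def T_def G_def v_def Vt_def)
  have "actM wM = wM + (- (q1_R' * gq)) *s (vM :: 'p R' ^ 2)"
    unfolding actM_wM[OF odd_p] by (simp add: vec_eq_iff)
  then have "vmod (\<Theta> (actM wM)) = (1 + T * h) *s w + (T * C) *s v + (- (T * G)) *s v"
    by (simp only: Theta_add Theta_scale Theta_w Theta_v Wt_def vmod_add vmod_scale abs_R'_mod.hom_uminus abs_R'_mod.hom_mult
      abs_R'_mod.hom_add abs_R'_mod.hom_one TG T_def[symmetric] h_def[symmetric] C_def[symmetric] v_def[symmetric] w_def[symmetric])
  moreover have "vmod (actL Wt) = (1 + T * h) *s (w + T *s (- G *s v)) + (T * C) *s v"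
  proof -
    have hh: "gamma_R' hR = hR"
    proof -
      have hR: "hR = fps_const (fps_const half)" by (simp add: hR_def fps_eq_iff)
      show ?thesis unfolding hR by (rule gamma_R'_const)
    qed
    have "vmod (actL Wt) = (1 + T * h) *s vmod (actL (vincl wbar)) + (T * abs_R'_mod (gamma_R' (incl_A cA))) *s vmod (actL Vt)"
      unfolding Wt_def semilinear_add[OF actL_semilinear] semilinear_scale[OF actL_semilinear]
      by (simp only: gamma_R'.hom_add gamma_R'.hom_mult gamma_R'.hom_one gamma_R'_q1 hh vmod_add vmod_scale abs_R'_mod.hom_add
        abs_R'_mod.hom_mult abs_R'_mod.hom_one T_def h_def)
    then show ?thesis unfolding TC actV actW .
  qed
  moreover have "(1 + T * h) *s w + (T * C) *s v + (- (T * G)) *s v = (1 + T * h) *s (w + T *s (- G *s v)) + (T * C) *s v"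
    by (simp add: vec_eq_iff algebra_simps TT)
  ultimately have w: "vmod (\<Theta> (actM wM)) = vmod (actL (\<Theta> wM))" by (simp add: Theta_w)
  have v: "vmod (\<Theta> (actM vM)) = vmod (actL (\<Theta> vM))"
    unfolding actM_vM[OF odd_p] Theta_v actV v_def ..
  have "vmod (\<Theta> (actM (x *s wM + y *s vM))) = vmod (actL (\<Theta> (x *s wM + y *s vM)))" for x y
    unfolding actM_add actM_scale Theta_add Theta_scale semilinear_add[OF actL_semilinear] semilinear_scale[OF actL_semilinear]
      vmod_add vmod_scale v w ..
  then show ?thesis using decomp_wv[OF odd_p, of m] by metis
qed

lemma det2_Wt_Vt: "det2 Wt Vt dvd 1"
proof -
  have "det2 (vincl wbar) Vt = (incl_A (det2 wbar vbar) :: 'p R')"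
    by (simp add: Vt_def det2_def incl_A.hom_simps)
  then have "det2 Wt Vt = - (1 + q1_R' * hR)"
    unfolding Wt_def det2_simps det2_wbar_vbar[OF odd_p] by (simp add: incl_A.hom_simps)
  then show ?thesis by (simp add: fps_dvd_1_iff q1_R'_def)
qed

definition dW :: "'p R'" where "dW = exquo 1 (det2 Wt Vt)"

definition \<Theta>' :: "'p R' ^ 2 \<Rightarrow> 'p R' ^ 2"
  where "\<Theta>' y = (dW * det2 y Vt) *s wM + (dW * det2 Wt y) *s vM"

lemma dW: "dW * det2 Wt Vt = 1"
  using mult_exquo_unit[OF det2_Wt_Vt, of 1] by (simp add: dW_def mult.commute)

lemma Theta_Theta': "\<Theta> (\<Theta>' y) = y"
proof -
  have "\<Theta> (\<Theta>' y) = dW *s (det2 y Vt *s Wt + det2 Wt y *s Vt)"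
    unfolding \<Theta>'_def Theta_add Theta_scale Theta_w Theta_v by (simp add: vec_eq_iff distrib_left mult.assoc)
  also have "\<dots> = dW *s (det2 Wt Vt *s y)" by (rule arg_cong[OF det2_cramer[symmetric]])
  also have "\<dots> = y" by (simp add: vec_eq_iff dW flip: mult.assoc)
  finally show ?thesis .
qed

lemma Theta'_Theta: "\<Theta>' (\<Theta> m) = m"
proof -
  have "det2 (\<Theta> m) Vt = det2 m vM * det2 Wt Vt" "det2 Wt (\<Theta> m) = det2 wM m * det2 Wt Vt"
    by (simp_all add: \<Theta>_def det2_simps)
  then have "\<Theta>' (\<Theta> m) = (dW * det2 Wt Vt * det2 m vM) *s wM + (dW * det2 Wt Vt * det2 wM m) *s vM"
    by (simp add: \<Theta>'_def mult_ac)
  then show ?thesis unfolding dW by (simp flip: decomp_wv[OF odd_p])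
qed

lemma Theta'_add: "\<Theta>' (x + y) = \<Theta>' x + \<Theta>' y" and Theta'_scale: "\<Theta>' (a *s x) = a *s \<Theta>' x"
  by (simp_all add: \<Theta>'_def det2_simps vec_eq_iff algebra_simps)

lemma Wt_2: "q1_R' dvd Wt $ 2"
  by (simp add: Wt_def wbar_nth[OF odd_p] incl_A.hom_zero mult.assoc)

lemma Theta_fil: "q1_R' dvd m $ 2 \<Longrightarrow> q1_R' dvd \<Theta> m $ 2"
  using Wt_2 by (simp add: \<Theta>_def det2_def wM_nth)

lemma Theta'_fil: "q1_R' dvd y $ 2 \<Longrightarrow> q1_R' dvd \<Theta>' y $ 2"
  using Wt_2 by (simp add: \<Theta>'_def det2_def wM_nth)

lemma red_Theta: "vec_map mod_q1 (\<Theta> m) = red_H0 m"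
proof -
  have "vec_map mod_q1 (\<Theta> m) = mod_q1 (det2 m vM) *s wbar + mod_q1 (det2 wM m) *s vbar"
    by (simp add: \<Theta>_def Wt_def Vt_def vec_eq_iff mod_q1.hom_simps)
  also have "\<dots> = red_H0 (det2 m vM *s wM + det2 wM m *s vM)"
    by (simp only: red_H0_add red_H0_scale wbar_def vbar_def)
  finally show ?thesis by (simp flip: decomp_wv[OF odd_p])
qed

definition \<theta>0 :: "'p R'_mod ^ 2 \<Rightarrow> 'p R'_mod ^ 2"
  where "\<theta>0 y = vmod (\<Theta> (vec_map rep_R'_mod y))"

definition \<theta>0' :: "'p R'_mod ^ 2 \<Rightarrow> 'p R'_mod ^ 2"
  where "\<theta>0' y = vmod (\<Theta>' (vec_map rep_R'_mod y))"

lemma theta0_vmod: "\<theta>0 (vmod m) = vmod (\<Theta> m)" and theta0'_vmod: "\<theta>0' (vmod m) = vmod (\<Theta>' m)"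
proof -
  have "semilinear (\<lambda>x. x) \<Theta>" "semilinear (\<lambda>x. x) \<Theta>'"
    by (simp_all add: semilinear_def Theta_add Theta_scale Theta'_add Theta'_scale)
  from this[THEN vmod_semilinear, OF dvd_refl vmod_rep]
  show "\<theta>0 (vmod m) = vmod (\<Theta> m)" "\<theta>0' (vmod m) = vmod (\<Theta>' m)"
    unfolding \<theta>0_def \<theta>0'_def .
qed

lemma vmod_surj: "\<exists>m. y = vmod m"
  using vmod_rep[of y] by metis

text \<open>In degree 1 the tensor product filtration is spanned by multiples of
  \<open>q - 1\<close> and multiples of \<open>omega\<close>. Together they impose only divisibility
  of the second coordinate by \<open>q - 1\<close>, the same condition as for
  \<open>M'\<close>.\<close>

lemma fil_D_0: "fil D 0 = UNIV" and fil_D_1: "fil D 1 = vmod ` {m. q1_R' dvd m $ 2}"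
proof -
  have t: "tensor_one y = vmod (vincl y)" for y :: "'p R ^ 2"
    by (simp add: tensor_one_def vec_map_def)
  have basis: "vmod m = abs_R'_mod (m $ 1) *s tensor_one omega + abs_R'_mod (m $ 2) *s tensor_one eta" for m :: "'p R' ^ 2"
    unfolding t by (simp add: vec_eq_iff forall_2 incl_A.hom_zero incl_A.hom_one abs_R'_mod.hom_zero abs_R'_mod.hom_one)
  have H: "fil (obj_H0 \<Phi>) 0 = UNIV" "fil (obj_H0 \<Phi>) 1 = range (\<lambda>a. a *s omega)"
    by (simp_all add: obj_H0_def)
  have F0: "fil_q ring_R'_mod 0 = (UNIV :: 'p R'_mod set)" by (auto simp: fil_q_def)
  have F1: "fil_q ring_R'_mod 1 = range (\<lambda>x. abs_R'_mod q1_R' * (x :: 'p R'_mod))"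
    by (simp add: fil_q_def ring_R'_mod_simps)
  define S where "S r = {a *s tensor_one m | a m. \<exists>i j. j \<in> {0, 1} \<and> i + int j = int r \<and>
        a \<in> fil_q ring_R'_mod i \<and> m \<in> fil (obj_H0 \<Phi>) j}" for r
  have D: "fil D r = module.span (*s) (S r)" for r by (simp add: deform_mod_def S_def)
  have S0: "a *s tensor_one m \<in> S 0" for a m
    unfolding S_def using H F0 by (intro CollectI exI[of _ a] exI[of _ m] exI[of _ 0] exI[of _ "0 :: nat"] conjI) simp_all
  have "vmod m \<in> fil D 0" for m
    unfolding D basis[of m] by (intro span_vec_add span_vec_base S0)
  then show "fil D 0 = UNIV" using vmod_surj by (metis UNIV_eq_I)
  have S1a: "(abs_R'_mod q1_R' * a) *s tensor_one m \<in> S 1" for a m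
    unfolding S_def using H F1
    by (intro CollectI exI[of _ "abs_R'_mod q1_R' * a"] exI[of _ m] exI[of _ 1] exI[of _ "0 :: nat"] conjI) simp_all
  have S1b: "a *s tensor_one omega \<in> S 1" for a
    unfolding S_def using F0
    by (intro CollectI exI[of _ a] exI[of _ omega] exI[of _ 0] exI[of _ "1 :: nat"] conjI)
      (auto simp: H(2)[simplified] intro: range_eqI[of _ _ 1])
  have sub: "x \<in> vmod ` {m. q1_R' dvd m $ 2}" if x: "x \<in> S 1" for x
  proof -
    obtain a m i j where x: "x = a *s tensor_one m" and ij: "j \<in> {0, 1}" "i + int j = 1"
      and a: "a \<in> fil_q ring_R'_mod i" and m: "m \<in> fil (obj_H0 \<Phi>) j"
      using x unfolding S_def by auto
    consider "j = 0" "i = 1" | "j = 1" "i = 0" using ij by auto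
    then show ?thesis
    proof cases
      case 1
      then obtain c where "a = abs_R'_mod q1_R' * c" using a F1 by auto
      then have "x = vmod ((q1_R' * rep_R'_mod c) *s vincl m)" unfolding x t by (simp add: vmod_scale abs_R'_mod.hom_mult)
      moreover have "q1_R' dvd ((q1_R' * rep_R'_mod c) *s vincl m) $ 2" by (simp add: mult.assoc)
      ultimately show ?thesis by blast
    next
      case 2
      then obtain c where "m = c *s omega" using m H(2) by auto
      then have "x = vmod (rep_R'_mod a *s vincl (c *s omega))" unfolding x t by (simp add: vmod_scale)
      moreover have "q1_R' dvd (rep_R'_mod a *s vincl (c *s omega)) $ 2" by (simp add: incl_A.hom_zero)
      ultimately show ?thesis by blast
    qed
  qed
  show "fil D 1 = vmod ` {m. q1_R' dvd m $ 2}"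
  proof (intro equalityI subsetI)
    fix x assume "x \<in> fil D 1"
    then have "x \<in> module.span (*s) (S 1)" unfolding D .
    then show "x \<in> vmod ` {m. q1_R' dvd m $ 2}"
    proof (rule module.span_induct_alt[OF module_vec])
      show "0 \<in> vmod ` {m. q1_R' dvd m $ 2}"
        by (rule image_eqI[of _ _ 0]) (simp_all add: vec_eq_iff abs_R'_mod.hom_zero)
    next
      fix c and x y :: "'p R'_mod ^ 2" assume "x \<in> S 1" and y: "y \<in> vmod ` {m. q1_R' dvd m $ 2}"
      then obtain m n where m: "x = vmod m" "q1_R' dvd m $ 2" and n: "y = vmod n" "q1_R' dvd n $ 2"
        using sub by blast
      have "c *s x + y = vmod (rep_R'_mod c *s m + n)" unfolding m(1) n(1) by (simp add: vmod_add vmod_scale)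
      moreover have "q1_R' dvd (rep_R'_mod c *s m + n) $ 2" using m(2) n(2) by simp
      ultimately show "c *s x + y \<in> vmod ` {m. q1_R' dvd m $ 2}" by blast
    qed
  next
    fix x :: "'p R'_mod ^ 2" assume "x \<in> vmod ` {m. q1_R' dvd m $ 2}"
    then obtain m where m: "x = vmod m" "q1_R' dvd m $ 2" by auto
    then obtain c where "m $ 2 = q1_R' * c" by (auto elim: dvdE)
    then have "x = abs_R'_mod (m $ 1) *s tensor_one omega + (abs_R'_mod q1_R' * abs_R'_mod c) *s tensor_one eta"
      unfolding m(1) basis[of m] by (simp add: abs_R'_mod.hom_mult)
    then show "x \<in> fil D 1" unfolding D by (simp only:) (intro span_vec_add span_vec_base S1a S1b)
  qed
qed

lemma mf_iso_theta0: "mf_iso (reduce_mf M') D \<theta>0"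
proof -
  note R = reduce_mf_simps[OF MF_M'', unfolded frob_M' act_M']
  have inv1: "\<theta>0 (\<theta>0' y) = y" and inv2: "\<theta>0' (\<theta>0 y) = y" for y
    using vmod_surj[of y] by (auto simp: theta0_vmod theta0'_vmod Theta_Theta' Theta'_Theta)
  have bij: "bij \<theta>0" by (rule bij_betw_byWitness[of _ \<theta>0']) (auto simp: inv1 inv2)
  have inv: "inv \<theta>0 = \<theta>0'" by (rule inv_equality) (auto simp: inv1 inv2)
  have add: "\<theta>0 (x + y) = \<theta>0 x + \<theta>0 y" and add': "\<theta>0' (x + y) = \<theta>0' x + \<theta>0' y" for x y
  proof -
    obtain m n where "x = vmod m" "y = vmod n" using vmod_surj by metis
    then show "\<theta>0 (x + y) = \<theta>0 x + \<theta>0 y" "\<theta>0' (x + y) = \<theta>0' x + \<theta>0' y"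
      by (simp_all only: vmod_add[symmetric] theta0_vmod theta0'_vmod Theta_add Theta'_add)
  qed
  have scale: "\<theta>0 (a *s x) = a *s \<theta>0 x" and scale': "\<theta>0' (a *s x) = a *s \<theta>0' x" for a x
  proof -
    obtain m where "x = vmod m" using vmod_surj by metis
    moreover obtain c where "a = abs_R'_mod c" using abs_rep_R'_mod[of a] by metis
    ultimately show "\<theta>0 (a *s x) = a *s \<theta>0 x" "\<theta>0' (a *s x) = a *s \<theta>0' x"
      by (simp_all only: vmod_scale[symmetric] theta0_vmod theta0'_vmod Theta_scale Theta'_scale)
  qed
  have frob: "\<theta>0 (frob (reduce_mf M') y) = frob D (\<theta>0 y)" for y
    using vmod_surj[of y] by (auto simp: R theta0_vmod frob_D Theta_frob)
  have act: "\<theta>0 (act (reduce_mf M') y) = act D (\<theta>0 y)" for y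
    using vmod_surj[of y] by (auto simp: R theta0_vmod act_D Theta_act)
  have frob': "\<theta>0' (frob D y) = frob (reduce_mf M') (\<theta>0' y)" for y
    using arg_cong[OF frob[of "\<theta>0' y"], of \<theta>0'] by (simp add: inv1 inv2)
  have fil0: "fil (reduce_mf M') 0 = UNIV"
    unfolding R fil_M'_0 using vmod_surj by auto
  have fil1: "fil (reduce_mf M') 1 = vmod ` {m. q1_R' dvd m $ 2}"
    unfolding R fil_M'_1 ..
  have f1: "\<theta>0 ` fil (reduce_mf M') 1 \<subseteq> fil D 1" and f1': "\<theta>0' ` fil D 1 \<subseteq> fil (reduce_mf M') 1"
    unfolding fil1 fil_D_1 using Theta_fil Theta'_fil by (auto simp: theta0_vmod theta0'_vmod)
  show ?thesis
    unfolding mf_iso_def filmod_hom_def inv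
  proof (intro conjI)
    show "module_hom (*s) (*s) \<theta>0" by (rule module_hom_vecI[OF add scale])
    show "module_hom (*s) (*s) \<theta>0'" by (rule module_hom_vecI[OF add' scale'])
    show "\<forall>r\<in>{0, 1}. \<theta>0 ` fil (reduce_mf M') r \<subseteq> fil D r" using f1 fil_D_0 by auto
    show "\<forall>r\<in>{0, 1}. \<theta>0' ` fil D r \<subseteq> fil (reduce_mf M') r" using f1' fil0 by auto
  qed (simp_all add: bij fun_eq_iff frob frob' act)
qed

text \<open>The reductions of \<open>M'\<close> and of \<open>X\<close> are both isomorphic to
  \<open>D\<close>, via \<open>\<theta>0\<close> and \<theta>, and \<open>lift_iso\<close> lifts the
  composite. After \<theta> the lift becomes the map \<open>\<Theta>\<close>, whose reduction modulo
  \<open>q - 1\<close> is the given comparison by \<open>red_Theta\<close>.\<close>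

lemma canonical_lift:
  assumes "canonical_q_deformation (obj_H0 \<Phi>) X \<theta>"
  shows "\<exists>\<Psi>. mf_iso M' X \<Psi> \<and> (\<forall>m. canonical_reduction \<theta> (\<Psi> m) = compare_H0 (vec_map mod_q1 m))"
proof -
  have X: "MF ring_R' X" and \<theta>: "mf_iso (reduce_mf X) D \<theta>"
    using assms by (simp_all add: canonical_q_deformation_def)
  have "mf_iso (reduce_mf M') (reduce_mf X) (inv \<theta> \<circ> \<theta>0)"
    by (rule mf_iso_trans[OF mf_iso_theta0 mf_iso_sym[OF \<theta>]])
  from lift_iso[OF odd_p e_facts b_facts X this]
  obtain \<Psi> where \<Psi>: "mf_iso M' X \<Psi>" "\<And>m. vmod (\<Psi> m) = inv \<theta> (\<theta>0 (vmod m))" by auto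
  have "bij \<theta>" using \<theta> by (simp add: mf_iso_def)
  then have "\<theta> (vmod (\<Psi> m)) = vmod (\<Theta> m)" for m
    unfolding \<Psi>(2) theta0_vmod by (simp add: bij_is_surj surj_f_inv_f)
  then have "canonical_reduction \<theta> (\<Psi> m) = vec_map mod_q1 (\<Theta> m)" for m
    by (simp add: canonical_reduction_def vec_eq_iff mod_q1_rep_abs)
  then show ?thesis using \<Psi>(1) unfolding red_Theta red_H0_def by blast
qed

end

theorem theorem4p2:
  fixes \<Phi> :: "'p :: prime_card padic_int fps ^ 2 \<Rightarrow> 'p padic_int fps ^ 2"
  assumes odd_p: "odd CARD('p)"
    and frobenius: "crystalline_frobenius \<Phi>"
  shows "\<exists>\<phi>M :: 'p padic_int fps fps ^ 2 \<Rightarrow> 'p padic_int fps fps ^ 2.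
    semilinear phi_R' \<phi>M \<and>
    (\<exists>f :: 2 \<Rightarrow> 'p padic_int fps fps ^ 2.
      is_basis f \<and> \<phi>M e1' = fps_const (qint (of_nat CARD('p))) *s f 1 \<and> \<phi>M e2 = f 2) \<and>
    MF ring_R' (obj_M' \<phi>M) \<and>
    mic_iso (obj_M'_mod_q1 \<phi>M) (obj_H0 \<Phi>) compare_H0 \<and>
    (\<exists>X \<theta>. canonical_q_deformation (obj_H0 \<Phi>) X \<theta>) \<and>
    (\<forall>X \<theta>. canonical_q_deformation (obj_H0 \<Phi>) X \<theta> \<longrightarrow>
      (\<exists>\<Psi>. mf_iso (obj_M' \<phi>M) X \<Psi> \<and>
        (\<forall>m. canonical_reduction \<theta> (\<Psi> m) = compare_H0 (vec_map mod_q1 m))))"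
proof -
  define f where "f = phiM epsR (bq \<Phi>)"
  note eb = odd_p epsR[OF odd_p frobenius] bq_gamma[OF odd_p frobenius]
  have "semilinear phi_R' f" unfolding f_def by (rule semilinear_phiM)
  moreover have "\<exists>y :: 2 \<Rightarrow> 'p padic_int fps fps ^ 2.
      is_basis y \<and> f e1' = fps_const (qint (of_nat CARD('p))) *s y 1 \<and> f e2 = y 2"
    unfolding f_def by (rule phiM_basis[OF eb])
  moreover have MF: "MF ring_R' (obj_M' f)" unfolding f_def by (rule MF_M'[OF eb])
  moreover have "mic_iso (obj_M'_mod_q1 f) (obj_H0 \<Phi>) compare_H0"
    unfolding f_def by (rule mic_iso_compare[OF odd_p frobenius])
  \<comment> \<open>Existence of a canonical deformation is witnessed by \<open>M'\<close> itself,
    with \<open>\<theta>0\<close> as the identification of its reduction.\<close>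
  moreover have "canonical_q_deformation (obj_H0 \<Phi>) (obj_M' f) (\<theta>0 \<Phi>)"
    unfolding canonical_q_deformation_def
    using MIC_H0[OF odd_p frobenius] MF mf_iso_theta0[OF odd_p frobenius] unfolding f_def by blast
  then have "\<exists>X \<theta>. canonical_q_deformation (obj_H0 \<Phi>) X \<theta>" by blast
  moreover have "\<forall>X \<theta>. canonical_q_deformation (obj_H0 \<Phi>) X \<theta> \<longrightarrow>
      (\<exists>\<Psi>. mf_iso (obj_M' f) X \<Psi> \<and> (\<forall>m. canonical_reduction \<theta> (\<Psi> m) = compare_H0 (vec_map mod_q1 m)))"
    unfolding f_def using canonical_lift[OF odd_p frobenius] by blast
  ultimately show ?thesis by (intro exI[of _ f] conjI)
qed

end
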